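(* Let $(W,\mathcal{S})$ be a finite Coxeter system and $m\ge1$. For each Coxeter element $c$ define a relation $\parallel'_c$ on $\Phi^{(m)}_{\ge-1}$ by $\beta^{(k)}\parallel'_c\gamma^{(\ell)}$ iff $\{\beta^{(k)},\gamma^{(\ell)}\}$ is a face of $\mathrm{Asso}^{(m)}(W,c)$. Then the family $(\parallel'_c)_c$ satisfies: (i) for $\alpha\in\Delta$ and $\beta^{(k)}\in\Phi^{(m)}_{\ge-1}$, $\alpha^{(m)}\parallel'_c\beta^{(k)}$ iff $\beta^{(k)}\in(\Phi_{\langle s_\alpha\rangle})^{(m)}_{\ge-1}$; (ii) for $\beta^{(k)},\gamma^{(\ell)}\in\Phi^{(m)}_{\ge-1}$ and $s$ initial in $c$, $\beta^{(k)}\parallel'_c\gamma^{(\ell)}$ iff $\tau^{(m)}_s(\beta^{(k)})\parallel'_{s^{-1}cs}\tau_s^{(m)}(\gamma^{(\ell)})$. Moreover any family of relations satisfying (i) and (ii) coincides with $(\parallel'_c)_c$, so $\parallel'_c$ is the $m$-eralized $c$-compatibility relation.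
   Context: $\Phi$ is a root system of $W$, $\Phi^+$ positive roots, $\Delta=\{\alpha_s\}$ simple roots, $s_\alpha$ the reflection of $\alpha$. $\Phi^{(m)}_{\ge-1}=\{\beta^{(k)}:\beta\in\Phi^+,0\le k<m\}\cup\{\alpha^{(m)}:\alpha\in\Delta\}$ ($m$-colored almost positive roots). For $s\in\mathcal{S}$, $\Phi_{\langle s\rangle}$ is the root subsystem of the parabolic subgroup generated by $\mathcal{S}\setminus\{s\}$, and $(\Phi_{\langle s\rangle})^{(m)}_{\ge-1}$ is the set of $\beta^{(k)}\in\Phi^{(m)}_{\ge-1}$ with $\beta\in\Phi_{\langle s\rangle}$. The bijection $\tau_s^{(m)}$ of $\Phi^{(m)}_{\ge-1}$ (colors mod $m+1$): $\alpha_s^{(k)}\mapsto\alpha_s^{(k-1)}$ (with $\alpha_s^{(0)}\mapsto\alpha_s^{(m)}$); $\beta^{(m)}\mapsto\beta^{(m)}$ for $\beta\ne\alpha_s$; otherwise $\beta^{(k)}\mapsto[s(\beta)]^{(k)}$. A Coxeter element $c$ is a product of all simple reflections in some order; $s$ is initial in $c$ if $c$ has a reduced word beginning with $s$. Fix a reduced word $\mathbf{c}=s_1\cdots s_n$. Let $w_\circ(\mathbf{c})$ be the lexicographically first subword of $\mathbf{c}^\infty$ that is a reduced word for the longest element $w_\circ$; for a word $Q$ let $\widetilde Q$ replace each letter $t$ by $w_\circ tw_\circ\in\mathcal{S}$; $w_\circ^m(\mathbf{c})$ is the concatenation $w_\circ(\mathbf{c})\widetilde{w_\circ(\mathbf{c})}w_\circ(\mathbf{c})\cdots$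 ($m$ factors), of length $mN$, $N=\ell(w_\circ)$. Colored positive roots are acted on by $t\in\mathcal{S}$ via $t(\beta^{(k)})=[t(\beta)]^{(k)}$ if $\beta\ne\alpha_t$ and $t(\alpha_t^{(k)})=\alpha_t^{(k+1)}$; the colored inversion sequence of a word $t_1\cdots t_p$ has $i$-th entry $t_1(\cdots t_{i-1}(\alpha_{t_i}^{(0)}))$. $\mathrm{Asso}^{(m)}_\Delta(W,c)$ is the simplicial complex on the positions of the word $\mathbf{c}\,w_\circ^m(\mathbf{c})$ whose facets are the position sets $I$ such that the letters outside $I$ form a word of length $mN$ with product $w_\circ^m$ in $W$. The map $L^{(m)}$ sends position $i\le n$ (letter $s_i$ of $\mathbf{c}$) to $\alpha_{s_i}^{(m)}$, and the $i$-th position of $w_\circ^m(\mathbf{c})$ to the $i$-th entry of the colored inversion sequence of $w_\circ^m(\mathbf{c})$; $\mathrm{Asso}^{(m)}(W,c)$ is the image of the faces of $\mathrm{Asso}^{(m)}_\Delta(W,c)$ under $L^{(m)}$ (up to isomorphism independent of the chosen reduced word).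
   Formalization: The relation is taken to hold only between distinct colored roots forming a face; read literally, every colored root would be related to itself, which contradicts (i) for the pair α^(m), α^(m) since α is not in Φ_⟨s_α⟩. *)

theory Defs
  imports
    "HOL-Algebra.Multiplicative_Group"
    "HOL-Algebra.Group_Action"
    "HOL-Analysis.Euclidean_Space"
begin

section \<open>Coxeter systems\<close>

definition word_prod :: "('a, 'b) monoid_scheme \<Rightarrow> 'a list \<Rightarrow> 'a" where
  "word_prod W ws = foldr (\<lambda>x y. x \<otimes>\<^bsub>W\<^esub> y) ws \<one>\<^bsub>W\<^esub>"

text \<open>
  Congruence on words over \<open>S\<close> generated by the Coxeter relations \<open>(st)\<^sup>m\<^sup>(\<^sup>s\<^sup>,\<^sup>t\<^sup>) = 1\<close>,
  where \<open>m(s,t)\<close> is the order of \<open>st\<close>. The case \<open>s = t\<close> gives the relation \<open>ss = 1\<close>, so the monoid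
  presented in this way is the group with that presentation. An infinite order is \<open>0\<close>
  in the library, which turns the corresponding relation into the trivial one.
\<close>
inductive coxeter_cong :: "('a, 'b) monoid_scheme \<Rightarrow> 'a set \<Rightarrow> 'a list \<Rightarrow> 'a list \<Rightarrow> bool"
  for W S where
  refl: "coxeter_cong W S us us"
| sym: "coxeter_cong W S us vs \<Longrightarrow> coxeter_cong W S vs us"
| trans: "coxeter_cong W S us vs \<Longrightarrow> coxeter_cong W S vs ws \<Longrightarrow> coxeter_cong W S us ws"
| relator: "s \<in> S \<Longrightarrow> t \<in> S \<Longrightarrow>
    coxeter_cong W S (us @ concat (replicate (group.ord W (s \<otimes>\<^bsub>W\<^esub> t)) [s, t]) @ vs) (us @ vs)"

definition coxeter_system :: "('a, 'b) monoid_scheme \<Rightarrow> 'a set \<Rightarrow> bool" where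
  "coxeter_system W S \<longleftrightarrow>
     group W \<and> S \<subseteq> carrier W \<and> generate W S = carrier W \<and>
     (\<forall>s\<in>S. s \<noteq> \<one>\<^bsub>W\<^esub> \<and> s \<otimes>\<^bsub>W\<^esub> s = \<one>\<^bsub>W\<^esub>) \<and>
     (\<forall>us vs. set us \<subseteq> S \<longrightarrow> set vs \<subseteq> S \<longrightarrow> word_prod W us = word_prod W vs \<longrightarrow>
        coxeter_cong W S us vs)"

definition cox_length :: "('a, 'b) monoid_scheme \<Rightarrow> 'a set \<Rightarrow> 'a \<Rightarrow> nat" where
  "cox_length W S w = (LEAST n. \<exists>ws. set ws \<subseteq> S \<and> length ws = n \<and> word_prod W ws = w)"

definition reduced_word :: "('a, 'b) monoid_scheme \<Rightarrow> 'a set \<Rightarrow> 'a list \<Rightarrow> 'a \<Rightarrow> bool" where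
  "reduced_word W S ws w \<longleftrightarrow>
     set ws \<subseteq> S \<and> word_prod W ws = w \<and> length ws = cox_length W S w"

definition longest_element :: "('a, 'b) monoid_scheme \<Rightarrow> 'a set \<Rightarrow> 'a" where
  "longest_element W S =
     (THE w. w \<in> carrier W \<and> (\<forall>v\<in>carrier W. cox_length W S v \<le> cox_length W S w))"

definition coxeter_elements :: "('a, 'b) monoid_scheme \<Rightarrow> 'a set \<Rightarrow> 'a set" where
  "coxeter_elements W S = {word_prod W cs | cs. distinct cs \<and> set cs = S}"

definition initial :: "('a, 'b) monoid_scheme \<Rightarrow> 'a set \<Rightarrow> 'a \<Rightarrow> 'a \<Rightarrow> bool" where
  "initial W S s c \<longleftrightarrow> (\<exists>ws. reduced_word W S (s # ws) c)"


section \<open>Root systems\<close>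

definition reflection :: "'v::euclidean_space \<Rightarrow> 'v \<Rightarrow> 'v" where
  "reflection a v = v - (2 * inner v a / inner a a) *\<^sub>R a"

definition root_system :: "'v::euclidean_space set \<Rightarrow> bool" where
  "root_system \<Phi> \<longleftrightarrow>
     finite \<Phi> \<and> 0 \<notin> \<Phi> \<and>
     (\<forall>a\<in>\<Phi>. \<Phi> \<inter> span {a} = {a, - a}) \<and>
     (\<forall>a\<in>\<Phi>. reflection a ` \<Phi> = \<Phi>)"

definition nonneg_combinations :: "'v::euclidean_space set \<Rightarrow> 'v set" where
  "nonneg_combinations \<Delta> = {\<Sum>d\<in>\<Delta>. a d *\<^sub>R d | a. \<forall>d\<in>\<Delta>. 0 \<le> a d}"

definition simple_system :: "'v::euclidean_space set \<Rightarrow> 'v set \<Rightarrow> bool" where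
  "simple_system \<Phi> \<Delta> \<longleftrightarrow>
     \<Delta> \<subseteq> \<Phi> \<and> independent \<Delta> \<and>
     (\<forall>b\<in>\<Phi>. b \<in> nonneg_combinations \<Delta> \<or> - b \<in> nonneg_combinations \<Delta>)"

text \<open>
  \<open>\<Phi>\<close> is a root system of \<open>(W, S)\<close> with simple roots \<open>\<alpha> s\<close>: the group \<open>W\<close> acts on the ambient
  space through the faithful linear representation \<open>\<rho>\<close>, in which \<open>S\<close> becomes the set of simple
  reflections. Neither crystallographicity nor unit root lengths are required.
\<close>
definition root_system_of ::
  "('a, 'b) monoid_scheme \<Rightarrow> 'a set \<Rightarrow> ('a \<Rightarrow> 'v::euclidean_space \<Rightarrow> 'v) \<Rightarrow> 'v set \<Rightarrow> ('a \<Rightarrow> 'v) \<Rightarrow> bool"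
  where
  "root_system_of W S \<rho> \<Phi> \<alpha> \<longleftrightarrow>
     faithful_action W UNIV \<rho> \<and> (\<forall>w\<in>carrier W. linear (\<rho> w)) \<and>
     root_system \<Phi> \<and> inj_on \<alpha> S \<and> simple_system \<Phi> (\<alpha> ` S) \<and>
     (\<forall>s\<in>S. \<rho> s = reflection (\<alpha> s))"

definition pos_roots :: "'a set \<Rightarrow> 'v::euclidean_space set \<Rightarrow> ('a \<Rightarrow> 'v) \<Rightarrow> 'v set" where
  "pos_roots S \<Phi> \<alpha> = \<Phi> \<inter> nonneg_combinations (\<alpha> ` S)"

text \<open>
  The roots of the maximal parabolic subgroup generated by \<open>S - {s}\<close>, that is, the roots whose
  reflections lie in it.
\<close>
definition parabolic_roots ::
  "('a, 'b) monoid_scheme \<Rightarrow> 'a set \<Rightarrow> ('a \<Rightarrow> 'v::euclidean_space \<Rightarrow> 'v) \<Rightarrow> 'v set \<Rightarrow> 'a \<Rightarrow> 'v set" where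
  "parabolic_roots W S \<rho> \<Phi> s = {b \<in> \<Phi>. \<exists>w\<in>generate W (S - {s}). \<rho> w = reflection b}"


section \<open>Colored almost positive roots\<close>

text \<open>The colored root \<open>\<beta>\<^sup>(\<^sup>k\<^sup>)\<close> is the pair \<open>(\<beta>, k)\<close>.\<close>

definition almost_pos_roots ::
  "'a set \<Rightarrow> 'v::euclidean_space set \<Rightarrow> ('a \<Rightarrow> 'v) \<Rightarrow> nat \<Rightarrow> ('v \<times> nat) set" where
  "almost_pos_roots S \<Phi> \<alpha> m = pos_roots S \<Phi> \<alpha> \<times> {..<m} \<union> (\<alpha> ` S) \<times> {m}"

definition parabolic_almost_pos_roots ::
  "('a, 'b) monoid_scheme \<Rightarrow> 'a set \<Rightarrow> ('a \<Rightarrow> 'v::euclidean_space \<Rightarrow> 'v) \<Rightarrow> 'v set \<Rightarrow> ('a \<Rightarrow> 'v) \<Rightarrow> nat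
    \<Rightarrow> 'a \<Rightarrow> ('v \<times> nat) set" where
  "parabolic_almost_pos_roots W S \<rho> \<Phi> \<alpha> m s =
     {x \<in> almost_pos_roots S \<Phi> \<alpha> m. fst x \<in> parabolic_roots W S \<rho> \<Phi> s}"

definition tau ::
  "('a \<Rightarrow> 'v::euclidean_space \<Rightarrow> 'v) \<Rightarrow> ('a \<Rightarrow> 'v) \<Rightarrow> nat \<Rightarrow> 'a \<Rightarrow> 'v \<times> nat \<Rightarrow> 'v \<times> nat" where
  "tau \<rho> \<alpha> m s = (\<lambda>(b, k).
     if b = \<alpha> s then (b, if k = 0 then m else k - 1)
     else if k = m then (b, m)
     else (\<rho> s b, k))"


section \<open>The word \<open>c w\<^sub>\<circ>\<^sup>m(c)\<close>\<close>

text \<open>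
  Subwords of \<open>c\<^sup>\<infinity>\<close> are given by their (increasing) lists of positions, counted from \<open>0\<close>;
  these lists are compared lexicographically.
\<close>
definition longest_subword :: "('a, 'b) monoid_scheme \<Rightarrow> 'a set \<Rightarrow> 'a list \<Rightarrow> nat list \<Rightarrow> bool" where
  "longest_subword W S cs ps \<longleftrightarrow>
     sorted_wrt (<) ps \<and>
     reduced_word W S (map (\<lambda>i. cs ! (i mod length cs)) ps) (longest_element W S)"

definition sorting_word :: "('a, 'b) monoid_scheme \<Rightarrow> 'a set \<Rightarrow> 'a list \<Rightarrow> 'a list" where
  "sorting_word W S cs = map (\<lambda>i. cs ! (i mod length cs))
     (THE ps. longest_subword W S cs ps \<and>
        (\<forall>qs. longest_subword W S cs qs \<longrightarrow> ps = qs \<or> (ps, qs) \<in> lexord less_than))"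

definition twist :: "('a, 'b) monoid_scheme \<Rightarrow> 'a set \<Rightarrow> 'a list \<Rightarrow> 'a list" where
  "twist W S = map (\<lambda>t. longest_element W S \<otimes>\<^bsub>W\<^esub> t \<otimes>\<^bsub>W\<^esub> longest_element W S)"

definition sorting_word_pow ::
  "('a, 'b) monoid_scheme \<Rightarrow> 'a set \<Rightarrow> nat \<Rightarrow> 'a list \<Rightarrow> 'a list" where
  "sorting_word_pow W S m cs =
     concat (map (\<lambda>i. if even i then sorting_word W S cs else twist W S (sorting_word W S cs)) [0..<m])"

definition asso_word :: "('a, 'b) monoid_scheme \<Rightarrow> 'a set \<Rightarrow> nat \<Rightarrow> 'a list \<Rightarrow> 'a list" where
  "asso_word W S m cs = cs @ sorting_word_pow W S m cs"

definition colored_act ::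
  "('a \<Rightarrow> 'v::euclidean_space \<Rightarrow> 'v) \<Rightarrow> ('a \<Rightarrow> 'v) \<Rightarrow> 'a \<Rightarrow> 'v \<times> nat \<Rightarrow> 'v \<times> nat" where
  "colored_act \<rho> \<alpha> t = (\<lambda>(b, k). if b = \<alpha> t then (b, k + 1) else (\<rho> t b, k))"

definition colored_inversions ::
  "('a \<Rightarrow> 'v::euclidean_space \<Rightarrow> 'v) \<Rightarrow> ('a \<Rightarrow> 'v) \<Rightarrow> 'a list \<Rightarrow> ('v \<times> nat) list" where
  "colored_inversions \<rho> \<alpha> ts =
     map (\<lambda>i. foldr (colored_act \<rho> \<alpha>) (take i ts) (\<alpha> (ts ! i), 0)) [0..<length ts]"


section \<open>The \<open>m\<close>-eralized associahedron\<close>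

definition asso_pos_facets :: "('a, 'b) monoid_scheme \<Rightarrow> 'a set \<Rightarrow> nat \<Rightarrow> 'a list \<Rightarrow> nat set set" where
  "asso_pos_facets W S m cs =
     {I. I \<subseteq> {..<length (asso_word W S m cs)} \<and>
         length (nths (asso_word W S m cs) (- I)) = m * cox_length W S (longest_element W S) \<and>
         word_prod W (nths (asso_word W S m cs) (- I)) = longest_element W S [^]\<^bsub>W\<^esub> m}"

definition asso_pos_faces :: "('a, 'b) monoid_scheme \<Rightarrow> 'a set \<Rightarrow> nat \<Rightarrow> 'a list \<Rightarrow> nat set set" where
  "asso_pos_faces W S m cs = {J. \<exists>I\<in>asso_pos_facets W S m cs. J \<subseteq> I}"

definition asso_label ::
  "('a, 'b) monoid_scheme \<Rightarrow> 'a set \<Rightarrow> ('a \<Rightarrow> 'v::euclidean_space \<Rightarrow> 'v) \<Rightarrow> ('a \<Rightarrow> 'v) \<Rightarrow> nat \<Rightarrow> 'a list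
    \<Rightarrow> nat \<Rightarrow> 'v \<times> nat" where
  "asso_label W S \<rho> \<alpha> m cs i =
     (if i < length cs then (\<alpha> (cs ! i), m)
      else colored_inversions \<rho> \<alpha> (sorting_word_pow W S m cs) ! (i - length cs))"

definition asso_faces ::
  "('a, 'b) monoid_scheme \<Rightarrow> 'a set \<Rightarrow> ('a \<Rightarrow> 'v::euclidean_space \<Rightarrow> 'v) \<Rightarrow> ('a \<Rightarrow> 'v) \<Rightarrow> nat \<Rightarrow> 'a list
    \<Rightarrow> ('v \<times> nat) set set" where
  "asso_faces W S \<rho> \<alpha> m cs = (\<lambda>J. asso_label W S \<rho> \<alpha> m cs ` J) ` asso_pos_faces W S m cs"

text \<open>
  Two colored roots are related if they form a face with two vertices. Every single colored root
  is a vertex, so without the condition \<open>x \<noteq> y\<close> the relation would be reflexive, which is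
  incompatible with the initial condition below at \<open>\<beta>\<^sup>(\<^sup>k\<^sup>) = \<alpha>\<^sup>(\<^sup>m\<^sup>)\<close>.
\<close>
definition asso_related ::
  "('a, 'b) monoid_scheme \<Rightarrow> 'a set \<Rightarrow> ('a \<Rightarrow> 'v::euclidean_space \<Rightarrow> 'v) \<Rightarrow> ('a \<Rightarrow> 'v) \<Rightarrow> nat \<Rightarrow> 'a list
    \<Rightarrow> 'v \<times> nat \<Rightarrow> 'v \<times> nat \<Rightarrow> bool" where
  "asso_related W S \<rho> \<alpha> m cs x y \<longleftrightarrow> x \<noteq> y \<and> {x, y} \<in> asso_faces W S \<rho> \<alpha> m cs"

definition compatibility_family ::
  "('a, 'b) monoid_scheme \<Rightarrow> 'a set \<Rightarrow> ('a \<Rightarrow> 'v::euclidean_space \<Rightarrow> 'v) \<Rightarrow> 'v set \<Rightarrow> ('a \<Rightarrow> 'v) \<Rightarrow> nat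
    \<Rightarrow> ('a \<Rightarrow> 'v \<times> nat \<Rightarrow> 'v \<times> nat \<Rightarrow> bool) \<Rightarrow> bool" where
  "compatibility_family W S \<rho> \<Phi> \<alpha> m R \<longleftrightarrow>
     (\<forall>c\<in>coxeter_elements W S. \<forall>s\<in>S. \<forall>x\<in>almost_pos_roots S \<Phi> \<alpha> m.
        R c (\<alpha> s, m) x \<longleftrightarrow> x \<in> parabolic_almost_pos_roots W S \<rho> \<Phi> \<alpha> m s) \<and>
     (\<forall>c\<in>coxeter_elements W S. \<forall>s\<in>S. initial W S s c \<longrightarrow>
        (\<forall>x\<in>almost_pos_roots S \<Phi> \<alpha> m. \<forall>y\<in>almost_pos_roots S \<Phi> \<alpha> m.
           R c x y \<longleftrightarrow>
           R (inv\<^bsub>W\<^esub> s \<otimes>\<^bsub>W\<^esub> c \<otimes>\<^bsub>W\<^esub> s) (tau \<rho> \<alpha> m s x) (tau \<rho> \<alpha> m s y)))"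

end

theory Submission
  imports Defs "HOL-Analysis.Linear_Algebra"
begin

text \<open>
  Deleting the letters at positions \<open>i\<^sub>1 < \<dots> < i\<^sub>n\<close> from \<open>c w\<^sub>\<circ>\<^sup>m(c)\<close> leaves a word for \<open>w\<^sub>\<circ>\<^sup>m\<close> iff the
  reflections at these positions multiply, in this order, to \<open>c\<^sup>-\<^sup>1\<close>. So the facets are the
  reflection factorizations of \<open>c\<close> whose factors are ordered by position, and only the relative
  order of noncommuting reflections matters. With the Euler form
  \<open>E(x, y) = ((1 - c)\<^sup>-\<^sup>1 x, y)\<close> this order depends on \<open>c\<close> alone: writing \<open>\<omega>\<^sub>q\<close> for the fundamental
  weights and \<open>p\<^sub>q = \<omega>\<^sub>q - c \<omega>\<^sub>q\<close>, the positive roots are the roots \<open>c\<^sup>k p\<^sub>q\<close> up to the first sign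
  change of the orbit; the corresponding letters of \<open>c\<^sup>\<infinity>\<close> form an ideal of its heap, which makes
  them the sorting word of \<open>w\<^sub>\<circ>\<close>; and if \<open>b\<close> precedes \<open>b'\<close> in its inversion sequence, then
  \<open>E(b, b') \<ge> 0 \<ge> E(b', b)\<close>.

  Conjugating \<open>c\<close> by an initial letter \<open>s\<close> moves \<open>\<alpha>\<^sub>s\<^sup>(\<^sup>m\<^sup>)\<close> from the first to the last
  place of the order and conjugates everything else, which is condition (ii). Condition (i) for
  initial \<open>s\<close> compares a facet through \<open>\<alpha>\<^sub>s\<^sup>(\<^sup>m\<^sup>)\<close> with a facet of the parabolic subgroup omitting \<open>s\<close>.
  Rotating far enough turns every colored root into one of color \<open>m\<close>, whence uniqueness.
\<close>

section \<open>Words of reflections\<close>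

text \<open>The sorting words of \<open>c\<close> and \<open>scs\<close> are never compared.
  \<open>facet\<close> and \<open>precedes\<close> mention \<open>c\<close> only, and conjugation by
  \<open>s\<close> carries the Euler form, hence the order inside a color, from \<open>c\<close> to
  \<open>scs\<close>. The exceptions are the roots over \<open>s\<close>: within its color,
  \<open>s\<close> precedes every noncommuting root for \<open>c\<close> and follows it for
  \<open>scs\<close>. Standing first in one color block and standing last in the preceding block
  compare in the same way with all other roots, and this is what forces the shift from
  \<open>k\<close> to \<open>k - 1\<close> in \<open>tau\<close>. The letters of the prefix
  \<open>c\<close> form the block before color 0, so color \<open>m\<close> is the predecessor of
  color 0. Words return to show that noncommuting reflections are always comparable and that the
  order is the one along \<open>c w_o^m(c)\<close>. As no crystallographic lattice is given, the
  Euler form comes from real coweights instead of integer coordinates; all its signs come from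
  positivity of roots.\<close>

abbreviation act :: "'v::euclidean_space list \<Rightarrow> 'v \<Rightarrow> 'v" where
  "act \<equiv> foldr reflection"

lemma linear_reflection: "linear (reflection a)"
  by (rule linearI)
    (auto simp: reflection_def inner_left_distrib algebra_simps add_divide_distrib)

lemma inner_reflection: "inner (reflection a x) (reflection a y) = inner x y"
proof (cases "a = 0")
  case False
  then have "inner a a \<noteq> 0" by simp
  then show ?thesis
    by (simp add: reflection_def inner_diff_left inner_diff_right inner_commute field_simps)
qed (simp add: reflection_def)

lemma reflection_self: "a \<noteq> 0 \<Longrightarrow> reflection a a = - a"
  by (simp add: reflection_def scaleR_2)

lemma reflection_reflection [simp]: "reflection a (reflection a x) = x"
proof (cases "a = 0")
  case False
  then have "inner a a \<noteq> 0" by simp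
  then show ?thesis
    by (simp add: reflection_def inner_diff_left inner_diff_right algebra_simps)
qed (simp add: reflection_def)

lemma reflection_minus_root: "reflection (- a) = reflection a"
  by (rule ext) (simp add: reflection_def)

lemma reflection_fix: "inner x a = 0 \<Longrightarrow> reflection a x = x"
  by (simp add: reflection_def)

lemma reflection_commute:
  "inner a b = 0 \<Longrightarrow> reflection a (reflection b x) = reflection b (reflection a x)"
  by (simp add: reflection_def inner_diff_left inner_diff_right inner_commute)

lemma linear_act: "linear (act ws)"
proof (induction ws)
  case (Cons a ws)
  then show ?case
    using linear_compose[OF Cons linear_reflection[of a]] by (simp add: o_def)
qed (simp add: linear_iff)

lemmas act_add = linear_add[OF linear_act]
  and act_diff = linear_diff[OF linear_act]
  and act_minus = linear_neg[OF linear_act]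
  and act_scaleR = linear_cmul[OF linear_act]

lemma inner_act: "inner (act ws x) (act ws y) = inner x y"
  by (induction ws) (simp_all add: inner_reflection)

lemma act_rev_act [simp]: "act (rev ws) (act ws x) = x"
  by (induction ws arbitrary: x) simp_all

lemma act_act_rev [simp]: "act ws (act (rev ws) x) = x"
  using act_rev_act[of "rev ws"] by simp

lemma inj_act: "inj (act ws)"
  by (metis act_rev_act injI)

lemma inner_act_left: "inner (act ws x) y = inner x (act (rev ws) y)"
  by (metis act_act_rev inner_act)

lemma reflection_act: "reflection (act ws a) x = act ws (reflection a (act (rev ws) x))"
  by (simp add: reflection_def act_diff act_scaleR inner_act inner_act_left[symmetric] inner_commute[of x])
    (metis inner_act_left inner_commute rev_rev_ident)

lemma reflection_act_act: "reflection (act ws a) (act ws x) = act ws (reflection a x)"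
  by (simp add: reflection_act)

lemma reflection_refl_refl: "reflection (reflection s a) (reflection s x) = reflection s (reflection a x)"
  using reflection_act_act[of "[s]"] by simp

lemma act_fix: "(\<And>a. a \<in> set ws \<Longrightarrow> inner x a = 0) \<Longrightarrow> act ws x = x"
  by (induction ws) (simp_all add: reflection_fix)

lemma inner_act_fix: "(\<And>a. a \<in> set ws \<Longrightarrow> inner x a = 0) \<Longrightarrow> inner x (act ws y) = inner x y"
  by (metis act_fix inner_act)

lemma diff_reflection_in_span: "x - reflection a x \<in> span {a}"
  by (simp add: reflection_def span_base span_scale)

lemma diff_act_in_span: "x - act ws x \<in> span (set ws)"
proof (induction ws)
  case (Cons a ws)
  have "x - act ws x \<in> span (set (a # ws))"
    using Cons span_mono[of "set ws" "set (a # ws)"] by auto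
  moreover have "act ws x - reflection a (act ws x) \<in> span (set (a # ws))"
    using diff_reflection_in_span[of "act ws x" a] span_mono[of "{a}" "set (a # ws)"] by auto
  ultimately have "(x - act ws x) + (act ws x - reflection a (act ws x)) \<in> span (set (a # ws))"
    by (rule span_add)
  then show ?case by simp
qed (simp add: span_zero)

lemma act_in_span: "set ws \<subseteq> span A \<Longrightarrow> x \<in> span A \<Longrightarrow> act ws x \<in> span A"
proof -
  assume "set ws \<subseteq> span A" "x \<in> span A"
  then have "x - act ws x \<in> span A"
    by (meson diff_act_in_span span_minimal subsetD subspace_span)
  then have "x - (x - act ws x) \<in> span A"
    using \<open>x \<in> span A\<close> by (rule span_diff[rotated])
  then show ?thesis by simp
qed

lemma act_pow: "((act ws) ^^ k) = act (concat (replicate k ws))"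
  by (induction k) (simp_all add: fun_eq_iff)

section \<open>Inversion sequences and deletion of letters\<close>

definition inversions :: "'v::euclidean_space list \<Rightarrow> 'v list" where
  "inversions ws = map (\<lambda>i. act (take i ws) (ws ! i)) [0..<length ws]"

lemma inversions_Nil [simp]: "inversions [] = []"
  by (simp add: inversions_def)

lemma inversions_snoc: "inversions (ws @ [a]) = inversions ws @ [act ws a]"
  by (auto simp: inversions_def nth_append)

lemma length_inversions [simp]: "length (inversions ws) = length ws"
  by (simp add: inversions_def)

text \<open>Deleting a letter multiplies the product on the left by the reflection of its inversion.
  Deletions made from right to left leave the prefixes of the remaining positions intact, so the
  reflections appear in the order of the positions.\<close>

lemma act_nths_compl: "act (nths ws (- A)) x = act (nths (inversions ws) A) (act ws x)"
proof (induction ws arbitrary: x rule: rev_induct)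
  case (snoc a ws)
  show ?case
    using snoc[of x] snoc[of "reflection a x"]
    by (auto simp: nths_append inversions_snoc nths_singleton reflection_act_act)
qed simp

section \<open>Root systems with a simple system\<close>

locale simple_root_system =
  fixes \<Phi> \<Delta> :: "'v::euclidean_space set"
  assumes root_system: "root_system \<Phi>" and simple_system: "simple_system \<Phi> \<Delta>"
begin

definition pos :: "'v set" where
  "pos = \<Phi> \<inter> nonneg_combinations \<Delta>"

lemma finite_roots: "finite \<Phi>"
  and zero_not_root: "0 \<notin> \<Phi>"
  using root_system by (auto simp: root_system_def)

lemma simple_roots: "\<Delta> \<subseteq> \<Phi>"
  and independent_simple: "independent \<Delta>"
  using simple_system by (auto simp: simple_system_def)

lemma simple_root: "a \<in> \<Delta> \<Longrightarrow> a \<in> \<Phi>"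
  using simple_roots by auto

lemma finite_simple: "finite \<Delta>"
  using simple_roots finite_roots finite_subset by auto

lemma simple_nonzero: "a \<in> \<Delta> \<Longrightarrow> a \<noteq> 0"
  using simple_roots zero_not_root by auto

lemma inner_simple_pos: "a \<in> \<Delta> \<Longrightarrow> 0 < inner a a"
  using simple_nonzero by simp

lemma pos_root: "b \<in> pos \<Longrightarrow> b \<in> \<Phi>"
  by (simp add: pos_def)

lemma finite_pos: "finite pos"
  using finite_roots by (simp add: pos_def)

lemma ex_weight:
  assumes "a \<in> \<Delta>"
  shows "\<exists>w. inner w a = inner a a / 2 \<and> (\<forall>b\<in>\<Delta> - {a}. inner w b = 0)"
proof -
  obtain g :: "'v \<Rightarrow> real" where g: "linear g" "\<forall>b\<in>\<Delta>. g b = (if b = a then inner a a / 2 else 0)"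
    using linear_independent_extend[OF independent_simple,
        of "\<lambda>b. if b = a then inner a a / 2 else (0::real)"] by blast
  \<comment> \<open>The functional \<open>g\<close> has real values, so its adjoint is determined by
    its value at 1, and this value is the vector representing \<open>g\<close>.\<close>
  have "inner (adjoint g 1) b = g b" for b
    using adjoint_works[OF g(1), of b 1] by (simp add: inner_commute)
  then show ?thesis using g(2) assms by (intro exI[of _ "adjoint g 1"]) auto
qed

text \<open>The fundamental coweights up to the factor \<open>\<bar>a\<bar>\<^sup>2 / 2\<close>, which makes
  \<^term>\<open>reflection a\<close> subtract exactly \<open>a\<close> from the weight of \<open>a\<close>. Only their products with
  vectors in the span of the roots are determined.\<close>

definition weight :: "'v \<Rightarrow> 'v" where
  "weight a = (SOME w. inner w a = inner a a / 2 \<and> (\<forall>b\<in>\<Delta> - {a}. inner w b = 0))"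

lemma weight_same: "a \<in> \<Delta> \<Longrightarrow> inner (weight a) a = inner a a / 2"
  and weight_other: "a \<in> \<Delta> \<Longrightarrow> b \<in> \<Delta> \<Longrightarrow> b \<noteq> a \<Longrightarrow> inner (weight a) b = 0"
  using someI_ex[OF ex_weight, of a] by (auto simp: weight_def)

lemma weight_simple_pos: "a \<in> \<Delta> \<Longrightarrow> 0 < inner (weight a) a"
  using inner_simple_pos by (simp add: weight_same)

lemma weight_simple_nonneg: "a \<in> \<Delta> \<Longrightarrow> b \<in> \<Delta> \<Longrightarrow> 0 \<le> inner (weight a) b"
  by (cases "b = a") (auto simp: weight_same weight_other)

lemma weight_combination:
  assumes "d \<in> \<Delta>"
  shows "inner (weight d) (\<Sum>e\<in>\<Delta>. f e *\<^sub>R e) = f d * (inner d d / 2)"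
proof -
  have "inner (weight d) (\<Sum>e\<in>\<Delta>. f e *\<^sub>R e) = (\<Sum>e\<in>\<Delta>. f e * inner (weight d) e)"
    by (simp add: inner_sum_right)
  also have "\<dots> = (\<Sum>e\<in>\<Delta>. if e = d then f d * (inner d d / 2) else 0)"
    using assms by (intro sum.cong) (auto simp: weight_same weight_other)
  finally show ?thesis using assms finite_simple by simp
qed

abbreviation coefficient where
  "coefficient d x \<equiv> 2 * inner (weight d) x / inner d d"

lemma span_combination:
  assumes "x \<in> span \<Delta>"
  shows "x = (\<Sum>d\<in>\<Delta>. coefficient d x *\<^sub>R d)"
proof -
  obtain f where f: "x = (\<Sum>d\<in>\<Delta>. f d *\<^sub>R d)"
    using assms by (auto simp: span_finite[OF finite_simple])
  have "coefficient d x = f d" if "d \<in> \<Delta>" for d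
    unfolding f weight_combination[OF that] using inner_simple_pos[OF that] by simp
  then show ?thesis by (subst f) (auto intro: sum.cong)
qed

lemma span_eq_0: "x \<in> span \<Delta> \<Longrightarrow> (\<And>d. d \<in> \<Delta> \<Longrightarrow> inner (weight d) x = 0) \<Longrightarrow> x = 0"
  by (subst span_combination) auto

lemma nonneg_combination_iff:
  "x \<in> nonneg_combinations \<Delta> \<longleftrightarrow> x \<in> span \<Delta> \<and> (\<forall>d\<in>\<Delta>. 0 \<le> inner (weight d) x)"
proof
  assume "x \<in> nonneg_combinations \<Delta>"
  then obtain f where f: "x = (\<Sum>d\<in>\<Delta>. f d *\<^sub>R d)" "\<forall>d\<in>\<Delta>. 0 \<le> f d"
    by (auto simp: nonneg_combinations_def)
  then show "x \<in> span \<Delta> \<and> (\<forall>d\<in>\<Delta>. 0 \<le> inner (weight d) x)"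
    by (auto simp: weight_combination intro: span_sum span_scale span_base)
next
  assume x: "x \<in> span \<Delta> \<and> (\<forall>d\<in>\<Delta>. 0 \<le> inner (weight d) x)"
  show "x \<in> nonneg_combinations \<Delta>"
    unfolding nonneg_combinations_def
    using x span_combination[of x]
    by (intro CollectI exI[of _ "\<lambda>d. coefficient d x"]) auto
qed

lemma root_in_span: "b \<in> \<Phi> \<Longrightarrow> b \<in> span \<Delta>"
  using simple_system nonneg_combination_iff span_neg[of "- b"] by (auto simp: simple_system_def)

lemma pos_iff: "b \<in> \<Phi> \<Longrightarrow> b \<in> pos \<longleftrightarrow> (\<forall>d\<in>\<Delta>. 0 \<le> inner (weight d) b)"
  using root_in_span by (auto simp: pos_def nonneg_combination_iff)

lemma pos_weight: "b \<in> pos \<Longrightarrow> d \<in> \<Delta> \<Longrightarrow> 0 \<le> inner (weight d) b"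
  using pos_iff pos_root by blast

lemma simple_pos: "a \<in> \<Delta> \<Longrightarrow> a \<in> pos"
  using pos_iff simple_roots weight_simple_nonneg by blast

lemma reflection_root: "a \<in> \<Phi> \<Longrightarrow> b \<in> \<Phi> \<Longrightarrow> reflection a b \<in> \<Phi>"
  using root_system by (auto simp: root_system_def)

lemma root_line: "a \<in> \<Phi> \<Longrightarrow> b \<in> \<Phi> \<Longrightarrow> b \<in> span {a} \<Longrightarrow> b = a \<or> b = - a"
  using root_system by (auto simp: root_system_def)

lemma neg_root: "a \<in> \<Phi> \<Longrightarrow> - a \<in> \<Phi>"
  using root_system by (auto simp: root_system_def)

lemma root_nonzero: "a \<in> \<Phi> \<Longrightarrow> a \<noteq> 0"
  using zero_not_root by auto

lemma not_pos_iff: "b \<in> \<Phi> \<Longrightarrow> b \<notin> pos \<longleftrightarrow> - b \<in> pos"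
proof -
  assume b: "b \<in> \<Phi>"
  have "b \<in> pos \<or> - b \<in> pos"
    using simple_system b neg_root[OF b] by (auto simp: simple_system_def pos_def)
  moreover have False if "b \<in> pos" "- b \<in> pos"
  proof -
    have "inner (weight d) b = 0" if "d \<in> \<Delta>" for d
      using pos_weight[OF \<open>b \<in> pos\<close> that] pos_weight[OF \<open>- b \<in> pos\<close> that]
        by simp
    then show False using span_eq_0[OF root_in_span[OF b]] root_nonzero[OF b] by blast
  qed
  ultimately show ?thesis by blast
qed

lemma uminus_pos: "b \<in> pos \<Longrightarrow> - b \<notin> pos"
  using not_pos_iff pos_root by blast

lemma pos_if_weight: "b \<in> \<Phi> \<Longrightarrow> d \<in> \<Delta> \<Longrightarrow> 0 < inner (weight d) b \<Longrightarrow> b \<in> pos"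
  using not_pos_iff[of b] pos_weight[of "- b" d] by auto

lemma act_root: "set ws \<subseteq> \<Phi> \<Longrightarrow> b \<in> \<Phi> \<Longrightarrow> act ws b \<in> \<Phi>"
  by (induction ws) (auto simp: reflection_root)

lemma act_root_simple: "set ws \<subseteq> \<Delta> \<Longrightarrow> b \<in> \<Phi> \<Longrightarrow> act ws b \<in> \<Phi>"
  using act_root simple_roots by blast

lemma reflection_weight: "a \<in> \<Delta> \<Longrightarrow> reflection a (weight a) = weight a - a"
  using inner_simple_pos[of a] by (simp add: reflection_def weight_same)

lemma act_weight: "a \<in> \<Delta> \<Longrightarrow> set ws \<subseteq> \<Delta> - {a} \<Longrightarrow> act ws (weight a) = weight a"
  by (rule act_fix) (auto intro: weight_other)

lemma weight_act: "a \<in> \<Delta> \<Longrightarrow> set ws \<subseteq> \<Delta> - {a} \<Longrightarrow> inner (weight a) (act ws x) = inner (weight a) x"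
  by (rule inner_act_fix) (auto intro: weight_other)

lemma weight_reflection_other:
  "a \<in> \<Delta> \<Longrightarrow> b \<in> \<Delta> \<Longrightarrow> a \<noteq> b \<Longrightarrow> inner (weight a) (reflection b x) = inner (weight a) x"
  using weight_act[of a "[b]"] by simp

lemma weight_reflection:
  "a \<in> \<Delta> \<Longrightarrow> inner (weight a) (reflection a x) = inner (weight a) x - inner x a"
  using inner_simple_pos[of a] by (simp add: reflection_def inner_diff_right weight_same)

text \<open>\<open>reflection a\<close> changes only the coefficient of \<open>a\<close>. A positive
  root other than \<open>a\<close> is not proportional to \<open>a\<close>, so another simple root
  has a positive coefficient, which survives and decides the sign.\<close>

lemma reflection_pos:
  assumes "a \<in> \<Delta>" "b \<in> pos" "b \<noteq> a"
  shows "reflection a b \<in> pos"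
proof -
  have "\<exists>d\<in>\<Delta> - {a}. inner (weight d) b \<noteq> 0"
  proof (rule ccontr)
    assume *: "\<not> ?thesis"
    have "b = (\<Sum>d\<in>\<Delta>. coefficient d b *\<^sub>R d)"
      using span_combination root_in_span pos_root assms by blast
    also have "\<dots> = (\<Sum>d\<in>\<Delta>. if d = a then coefficient a b *\<^sub>R a else 0)"
      using * by (intro sum.cong) auto
    also have "\<dots> \<in> span {a}"
      using assms finite_simple by (simp add: span_base span_scale)
    finally have "b = - a"
      using root_line[of a b] assms simple_root pos_root by auto
    then show False using uminus_pos simple_pos assms by blast
  qed
  then obtain d where d: "d \<in> \<Delta>" "d \<noteq> a" "inner (weight d) b \<noteq> 0" by auto
  then have "0 < inner (weight d) (reflection a b)"
    using pos_weight[OF assms(2) d(1)] weight_reflection_other[of d a b] assms by simp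
  then show ?thesis
    using pos_if_weight d reflection_root assms pos_root simple_root by blast
qed

lemma reflection_simple_pos_iff:
  assumes "a \<in> \<Delta>" "b \<in> \<Phi>"
  shows "reflection a b \<in> pos \<longleftrightarrow> (if b = a then False else if b = - a then True else b \<in> pos)"
proof -
  have a: "reflection a a = - a" using reflection_self simple_nonzero assms by blast
  have minus: "reflection a (- b) = - reflection a b"
    using linear_neg[OF linear_reflection] by blast
  show ?thesis
  proof (cases "b \<in> pos")
    case True
    then show ?thesis using reflection_pos assms a uminus_pos simple_pos by auto
  next
    case False
    then have "- b \<in> pos" using not_pos_iff assms by blast
    show ?thesis
    proof (cases "- b = a")
      case True
      then have "reflection a b = a" using a minus by (metis minus_equation_iff)
      then show ?thesis using True simple_pos[OF assms(1)] uminus_pos[of a] by auto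
    next
      case ne: False
      then have "- reflection a b \<in> pos" using reflection_pos \<open>- b \<in> pos\<close> assms minus
        by metis
      then have "reflection a b \<notin> pos" using uminus_pos by force
      then show ?thesis using ne False by (auto)
    qed
  qed
qed

lemma simple_obtuse:
  assumes "a \<in> \<Delta>" "b \<in> \<Delta>" "a \<noteq> b"
  shows "inner a b \<le> 0"
proof -
  have "0 \<le> inner (weight a) (reflection a b)"
    using reflection_pos[of a b] assms simple_pos pos_weight by blast
  then show ?thesis using assms by (simp add: weight_reflection[of a b] weight_other inner_commute[of a b])
qed

text \<open>With no coefficient at \<open>q\<close>, every summand of \<open>y\<close> meets
  \<open>q\<close> at a right or obtuse angle, and the summand at \<open>r\<close> contributes
  strictly. This is the source of strictness in \<open>weight_proj_root_pos\<close> and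
  \<open>weight_act_proj_root_pos\<close>.\<close>

lemma inner_pos_simple_neg:
  assumes "y \<in> pos" "q \<in> \<Delta>" "r \<in> \<Delta>" "inner (weight q) y = 0" "0 < inner (weight r) y" "inner r q \<noteq> 0"
  shows "inner y q < 0"
proof -
  have y: "y = (\<Sum>d\<in>\<Delta>. coefficient d y *\<^sub>R d)"
    using span_combination root_in_span pos_root assms by blast
  have "r \<noteq> q" using assms by auto
  have "0 < (\<Sum>d\<in>\<Delta>. - (coefficient d y * inner d q))"
  proof (rule sum_pos2[OF finite_simple \<open>r \<in> \<Delta>\<close>])
    have "inner r q < 0" using simple_obtuse \<open>r \<noteq> q\<close> assms by force
    then have "coefficient r y * inner r q < 0"
      using assms inner_simple_pos[of r] by (intro mult_pos_neg) auto
    then show "0 < - (coefficient r y * inner r q)" by simp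
    fix d assume d: "d \<in> \<Delta>"
    show "0 \<le> - (coefficient d y * inner d q)"
    proof (cases "d = q")
      case False
      then have "coefficient d y * inner d q \<le> 0"
        using simple_obtuse[of d q] pos_weight[of y d] assms d inner_simple_pos[OF d]
        by (intro mult_nonneg_nonpos) auto
      then show ?thesis by simp
    qed (use assms in simp)
  qed
  also have "\<dots> = - inner (\<Sum>d\<in>\<Delta>. coefficient d y *\<^sub>R d) q"
    by (simp add: inner_sum_left sum_negf)
  finally show ?thesis using y by simp
qed

subsection \<open>Inversions and reduced words\<close>

definition inv_set :: "'v list \<Rightarrow> 'v set" where
  "inv_set ws = {b \<in> pos. act (rev ws) b \<notin> pos}"

lemma act_eq_imp_act_rev_eq: "act vs = act ws \<Longrightarrow> act (rev vs) = act (rev ws)"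
  by (metis act_act_rev act_rev_act ext)

lemma inv_set_cong: "act vs = act ws \<Longrightarrow> inv_set vs = inv_set ws"
  using act_eq_imp_act_rev_eq[of vs ws] by (simp add: inv_set_def)

text \<open>Up to sign, \<open>a\<close> is the only root whose sign \<open>reflection a\<close>
  changes, so appending \<open>a\<close> affects only \<open>act ws a\<close> or its
  negative.\<close>

lemma inv_set_snoc:
  assumes "set ws \<subseteq> \<Delta>" "a \<in> \<Delta>"
  shows "inv_set (ws @ [a]) =
    (if act ws a \<in> pos then insert (act ws a) (inv_set ws) else inv_set ws - {- act ws a})"
proof -
  have "reflection a (act (rev ws) b) \<notin> pos \<longleftrightarrow>
      (b = act ws a \<or> act (rev ws) b \<notin> pos \<and> b \<noteq> - act ws a)" if "b \<in> pos" for b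
  proof -
    have "act (rev ws) b \<in> \<Phi>" using act_root_simple[of "rev ws" b] assms pos_root that by simp
    moreover have "act (rev ws) b = a \<longleftrightarrow> b = act ws a" by (metis act_act_rev act_rev_act)
    moreover have "act (rev ws) b = - a \<longleftrightarrow> b = - act ws a"
      by (metis act_act_rev act_rev_act act_minus)
    ultimately show ?thesis
      using reflection_simple_pos_iff[of a "act (rev ws) b"] assms simple_pos[of a] uminus_pos[of a]
      by (auto split: if_splits)
  qed
  then have mem: "b \<in> inv_set (ws @ [a]) \<longleftrightarrow>
      b \<in> pos \<and> (b = act ws a \<or> b \<in> inv_set ws \<and> b \<noteq> - act ws a)" for b
    unfolding inv_set_def by auto
  have sub: "inv_set ws \<subseteq> pos" by (auto simp: inv_set_def)
  show ?thesis
  proof (cases "act ws a \<in> pos")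
    case True
    then have "- act ws a \<notin> inv_set ws" using uminus_pos sub by blast
    have "b \<in> inv_set (ws @ [a]) \<longleftrightarrow> b = act ws a \<or> b \<in> inv_set ws" for b
      by (metis mem True \<open>- act ws a \<notin> inv_set ws\<close> sub subsetD)
    then show ?thesis using True by auto
  next
    case False
    have "b \<in> inv_set (ws @ [a]) \<longleftrightarrow> b \<in> inv_set ws \<and> b \<noteq> - act ws a" for b
      by (metis mem False sub subsetD)
    then show ?thesis using False by auto
  qed
qed

lemma inv_set_Nil [simp]: "inv_set [] = {}"
  by (simp add: inv_set_def)

lemma finite_inv_set: "finite (inv_set ws)"
  using finite_pos by (simp add: inv_set_def)

lemma card_inv_set_le: "set ws \<subseteq> \<Delta> \<Longrightarrow> card (inv_set ws) \<le> length ws"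
proof (induction ws rule: rev_induct)
  case (snoc a ws)
  then have "card (inv_set (ws @ [a])) \<le> Suc (card (inv_set ws))"
    using finite_inv_set[of ws]
    by (auto simp: inv_set_snoc card_insert_if intro!: le_SucI card_mono)
  then show ?case using snoc by simp
qed simp

lemma inversions_pos:
  "set ws \<subseteq> \<Delta> \<Longrightarrow> set (inversions ws) \<subseteq> pos \<Longrightarrow>
    distinct (inversions ws) \<and> inv_set ws = set (inversions ws)"
proof (induction ws rule: rev_induct)
  case (snoc a ws)
  have "act ws a \<notin> inv_set ws" using simple_pos snoc.prems by (simp add: inv_set_def)
  then show ?case using snoc by (auto simp: inversions_snoc inv_set_snoc)
qed simp

text \<open>The letter at which the sign changes is the image of \<open>a\<close> under the letters
  after it, so reflecting there and reflecting in \<open>a\<close> at the end cancel.\<close>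

lemma deletion:
  "set ws \<subseteq> \<Delta> \<Longrightarrow> a \<in> \<Delta> \<Longrightarrow> act ws a \<notin> pos \<Longrightarrow>
    \<exists>vs. set vs \<subseteq> \<Delta> \<and> Suc (length vs) = length ws \<and> act vs = act (ws @ [a])"
proof (induction ws)
  case Nil
  then show ?case using simple_pos by simp
next
  case (Cons b ws)
  show ?case
  proof (cases "act ws a \<in> pos")
    case True
    then have eq: "act ws a = b" using reflection_pos[of b "act ws a"] Cons.prems by auto
    have "reflection b (act ws (reflection a x)) = act ws x" for x
      unfolding eq[symmetric] reflection_act_act by simp
    then show ?thesis using Cons.prems by (intro exI[of _ ws]) auto
  next
    case False
    then obtain vs where "set vs \<subseteq> \<Delta>" "Suc (length vs) = length ws" "act vs = act (ws @ [a])"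
      using Cons.IH Cons.prems by force
    then show ?thesis using Cons.prems by (intro exI[of _ "b # vs"]) (auto simp: fun_eq_iff)
  qed
qed

lemma minimal_inversions_pos:
  "set ws \<subseteq> \<Delta> \<Longrightarrow> (\<And>vs. set vs \<subseteq> \<Delta> \<Longrightarrow> act vs = act ws \<Longrightarrow> length ws \<le> length vs) \<Longrightarrow>
    set (inversions ws) \<subseteq> pos"
proof (induction ws rule: rev_induct)
  case (snoc a ws)
  have "length ws \<le> length vs" if "set vs \<subseteq> \<Delta>" "act vs = act ws" for vs
    using snoc.prems(1) snoc.prems(2)[of "vs @ [a]"] that by (auto simp: fun_eq_iff)
  then have "set (inversions ws) \<subseteq> pos" using snoc by auto
  moreover have "act ws a \<in> pos"
    using deletion[of ws a] snoc.prems by force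
  ultimately show ?case by (simp add: inversions_snoc)
qed simp

text \<open>A word of minimal length has as many letters as inversions, and an element that
  preserves the positive roots has no inversions.\<close>

lemma act_eq_id:
  assumes "set ws \<subseteq> \<Delta>" "\<And>b. b \<in> pos \<Longrightarrow> act ws b \<in> pos"
  shows "act ws x = x"
proof -
  obtain vs where vs: "set vs \<subseteq> \<Delta>" "act vs = act ws"
    and min: "\<And>us. set us \<subseteq> \<Delta> \<Longrightarrow> act us = act ws \<Longrightarrow> length vs \<le> length us"
    using ex_has_least_nat[of "\<lambda>us. set us \<subseteq> \<Delta> \<and> act us = act ws" ws length] assms(1)
      by blast
  have "b \<notin> inv_set ws" for b
  proof
    assume b: "b \<in> inv_set ws"
    then have "- act (rev ws) b \<in> pos"
      using not_pos_iff act_root_simple[of "rev ws" b] assms(1) pos_root by (auto simp: inv_set_def)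
    from assms(2)[OF this] show False
      using b uminus_pos by (auto simp: inv_set_def act_minus)
  qed
  then have "inv_set vs = {}" using inv_set_cong[OF vs(2)] by blast
  then have "set (inversions vs) = {}"
    using inversions_pos[of vs] minimal_inversions_pos[of vs] vs min by simp
  then have "vs = []" by (metis length_inversions length_0_conv set_empty)
  then show ?thesis using vs by (metis foldr.simps(1) id_apply)
qed

end

lemma inner_act_pow: "inner ((act ws ^^ k) x) ((act ws ^^ k) y) = inner x y"
  by (simp add: act_pow inner_act)

lemma act_pow_diff: "(act ws ^^ k) (x - y) = (act ws ^^ k) x - (act ws ^^ k) y"
  by (simp add: act_pow act_diff)

lemma inner_act_pow_le:
  "k \<le> l \<Longrightarrow> inner ((act ws ^^ k) x) ((act ws ^^ l) y) = inner x ((act ws ^^ (l - k)) y)"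
  by (auto simp: le_iff_add funpow_add inner_act_pow)

lemma act_pow_eq_iff: "(act ws ^^ k) x = (act ws ^^ k) y \<longleftrightarrow> x = y"
  using inj_fn[OF inj_act[of ws]] by (auto dest: injD)

lemma act_rev_pow_act_pow: "k \<le> l \<Longrightarrow> (act (rev ws) ^^ k) ((act ws ^^ l) x) = (act ws ^^ (l - k)) x"
proof (induction k arbitrary: l)
  case (Suc k)
  then obtain l' where "l = Suc l'" by (cases l) auto
  have "(act (rev ws) ^^ Suc k) ((act ws ^^ Suc l') x) = (act (rev ws) ^^ k) ((act ws ^^ l') x)"
    by (subst funpow_Suc_right) simp
  then show ?case using Suc \<open>l = Suc l'\<close> by simp
qed simp

section \<open>Coxeter elements\<close>

definition before :: "'v list \<Rightarrow> 'v \<Rightarrow> 'v \<Rightarrow> bool" where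
  "before cs q r \<longleftrightarrow> (\<exists>xs ys zs. cs = xs @ q # ys @ r # zs)"

lemma before_nth: "i < j \<Longrightarrow> j < length cs \<Longrightarrow> before cs (cs ! i) (cs ! j)"
  unfolding before_def
proof (intro exI)
  assume "i < j" "j < length cs"
  then have "drop (Suc i) cs = take (j - Suc i) (drop (Suc i) cs) @ cs ! j # drop (Suc j) cs"
    using id_take_nth_drop[of "j - Suc i" "drop (Suc i) cs"] by simp
  then show "cs = take i cs @ cs ! i # take (j - Suc i) (drop (Suc i) cs) @ cs ! j # drop (Suc j) cs"
    using id_take_nth_drop[of i cs] \<open>i < j\<close> \<open>j < length cs\<close> by simp
qed

text \<open>The Euler form of \<open>c\<close> is \<open>((1 - c)\<^sup>-\<^sup>1 x, y)\<close>. A fixed vector of \<open>c\<close> is orthogonal to the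
  roots, so on the span of the roots the choice of the preimage does not matter.\<close>

definition euler :: "('v::euclidean_space \<Rightarrow> 'v) \<Rightarrow> 'v \<Rightarrow> 'v \<Rightarrow> real" where
  "euler c x y = inner (SOME u. u - c u = x) y"

context simple_root_system
begin

definition coxeter_word :: "'v list \<Rightarrow> bool" where
  "coxeter_word cs \<longleftrightarrow> distinct cs \<and> set cs = \<Delta>"

text \<open>For \<open>c = xs q ys\<close> this is \<open>act xs q\<close>, the inversion of
  \<open>c\<close> at the letter \<open>q\<close>; written with the weight, it depends on the
  element \<open>c\<close> only.\<close>

definition proj_root :: "('v \<Rightarrow> 'v) \<Rightarrow> 'v \<Rightarrow> 'v" where
  "proj_root c q = weight q - c (weight q)"

text \<open>Cuts the orbit at its first sign change. Positivity of the single root with exponent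
  \<open>k\<close> would also admit later returns of the orbit to the positive side.\<close>

definition pos_upto :: "('v \<Rightarrow> 'v) \<Rightarrow> 'v \<Rightarrow> nat \<Rightarrow> bool" where
  "pos_upto c q k \<longleftrightarrow> (\<forall>j\<le>k. (c ^^ j) (proj_root c q) \<in> pos)"

lemma coxeter_word_rev [simp]: "coxeter_word (rev cs) \<longleftrightarrow> coxeter_word cs"
  by (simp add: coxeter_word_def)

lemma coxeter_word_set: "coxeter_word cs \<Longrightarrow> set cs = \<Delta>"
  by (simp add: coxeter_word_def)

lemma coxeter_word_split:
  assumes "coxeter_word cs" "q \<in> \<Delta>"
  obtains xs ys where "cs = xs @ q # ys"
  using assms by (metis coxeter_word_def split_list)

lemma coxeter_wordD:
  assumes "coxeter_word (xs @ q # ys)"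
  shows "q \<in> \<Delta>" "set xs \<subseteq> \<Delta> - {q}" "set ys \<subseteq> \<Delta> - {q}"
  using assms by (auto simp: coxeter_word_def)

lemma proj_root_eq:
  assumes "coxeter_word (xs @ q # ys)"
  shows "proj_root (act (xs @ q # ys)) q = act xs q"
  using coxeter_wordD[OF assms]
  by (simp add: proj_root_def act_weight reflection_weight act_diff)

lemma inversions_coxeter_word:
  assumes "coxeter_word cs"
  shows "inversions cs = map (proj_root (act cs)) cs"
proof (rule nth_equalityI)
  fix i assume "i < length (inversions cs)"
  then have i: "i < length cs" by simp
  then have "cs = take i cs @ cs ! i # drop (Suc i) cs" by (rule id_take_nth_drop)
  with proj_root_eq[of "take i cs" "cs ! i" "drop (Suc i) cs"] assms
  show "inversions cs ! i = map (proj_root (act cs)) cs ! i"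
    using i by (simp add: inversions_def)
qed simp

lemma proj_root_pos:
  assumes "coxeter_word cs" "q \<in> \<Delta>"
  shows "proj_root (act cs) q \<in> pos"
proof -
  obtain xs ys where cs: "cs = xs @ q # ys" using coxeter_word_split assms by blast
  note D = coxeter_wordD[OF assms(1)[unfolded cs]]
  have "act xs q \<in> pos"
    using pos_if_weight[of "act xs q" q] act_root_simple[of xs q] D simple_root weight_act[of q xs q]
      weight_simple_pos[of q] by auto
  then show ?thesis using proj_root_eq assms cs by simp
qed

lemma proj_root_root: "coxeter_word cs \<Longrightarrow> q \<in> \<Delta> \<Longrightarrow> proj_root (act cs) q \<in> \<Phi>"
  using proj_root_pos pos_root by blast

lemma act_pow_root: "coxeter_word cs \<Longrightarrow> b \<in> \<Phi> \<Longrightarrow> (act cs ^^ k) b \<in> \<Phi>"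
  by (induction k) (auto intro: act_root_simple simp: coxeter_word_set)

lemma act_rev_proj_root: "act (rev cs) (proj_root (act cs) q) = - proj_root (act (rev cs)) q"
  by (simp add: proj_root_def act_diff)

lemma act_rev_proj_root_not_pos:
  "coxeter_word cs \<Longrightarrow> q \<in> \<Delta> \<Longrightarrow> act (rev cs) (proj_root (act cs) q) \<notin> pos"
  using act_rev_proj_root uminus_pos[OF proj_root_pos[of "rev cs" q]] by simp

lemma coxeter_word_inversion:
  assumes "coxeter_word cs" "b \<in> pos" "act (rev cs) b \<notin> pos"
  obtains q where "q \<in> \<Delta>" "b = proj_root (act cs) q"
proof -
  have cs: "set cs = \<Delta>" using assms by (simp add: coxeter_word_def)
  have "set (inversions cs) \<subseteq> pos"
    using inversions_coxeter_word[OF assms(1)] proj_root_pos[OF assms(1)] cs by auto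
  then have "b \<in> set (inversions cs)"
    using inversions_pos[of cs] cs assms by (auto simp: inv_set_def)
  then show ?thesis using that inversions_coxeter_word[OF assms(1)] cs by auto
qed

lemma act_fixed_orthogonal:
  "distinct ws \<Longrightarrow> set ws \<subseteq> \<Delta> \<Longrightarrow> act ws u = u \<Longrightarrow> a \<in> set ws \<Longrightarrow> inner u a = 0"
proof (induction ws)
  case (Cons b ws)
  then have u: "act ws u = reflection b u" by (metis foldr.simps(2) comp_apply reflection_reflection)
  have "inner (weight b) (act ws u) = inner (weight b) u"
    using Cons.prems by (intro weight_act) auto
  then have b: "inner u b = 0" using u weight_reflection[of b u] Cons.prems by simp
  then show ?case using Cons u by (auto simp: reflection_fix)
qed simp

lemma orthogonal_span_simple:
  assumes "\<And>a. a \<in> \<Delta> \<Longrightarrow> inner u a = 0" "x \<in> span \<Delta>"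
  shows "inner u x = 0"
  using assms(2)
  by (induction rule: span_induct_alt) (auto simp: inner_add_right assms(1))

lemma coxeter_fixed_orthogonal:
  "coxeter_word cs \<Longrightarrow> act cs u = u \<Longrightarrow> x \<in> span \<Delta> \<Longrightarrow> inner u x = 0"
  using act_fixed_orthogonal[of cs u] orthogonal_span_simple[of u x] by (auto simp: coxeter_word_def)

lemma diff_coxeter_eq:
  assumes "coxeter_word cs" "u - act cs u = v - act cs v" "x \<in> span \<Delta>"
  shows "inner u x = inner v x"
proof -
  have "act cs (u - v) = u - v" using assms(2) by (simp add: act_diff algebra_simps)
  from coxeter_fixed_orthogonal[OF assms(1) this assms(3)] show ?thesis
    by (simp add: inner_diff_left)
qed

lemma euler_eq:
  assumes "coxeter_word cs" "x \<in> span \<Delta>"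
  shows "euler (act cs) (u - act cs u) x = inner u x"
  using diff_coxeter_eq[OF assms(1) _ assms(2)]
    someI[of "\<lambda>v. v - act cs v = u - act cs u" u] unfolding euler_def by blast

text \<open>A positive orbit would be finite, hence periodic, and its sum over a period a vector of
  the span fixed by \<open>c\<close>, that is 0. A vanishing sum of nonnegative coefficients
  vanishes termwise.\<close>

lemma coxeter_orbit_not_pos:
  assumes "coxeter_word cs" "b \<in> pos"
  shows "\<exists>k. (act cs ^^ k) b \<notin> pos"
proof (rule ccontr)
  assume "\<not> ?thesis"
  then have P: "(act cs ^^ k) b \<in> pos" for k by blast
  then have "{y. \<exists>n. y = (act cs ^^ n) b} \<subseteq> pos" by auto
  then obtain h where h: "h > 0" "(act cs ^^ h) b = b"
    using funpow_inj_finite[OF inj_act[of cs], of b] finite_subset[OF _ finite_pos] by blast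
  define v where "v = (\<Sum>k<h. (act cs ^^ k) b)"
  have "act cs v = (\<Sum>k<h. (act cs ^^ Suc k) b)"
    unfolding v_def by (simp add: linear_sum[OF linear_act])
  also have "\<dots> = v"
    using sum.lessThan_Suc_shift[of "\<lambda>k. (act cs ^^ k) b" h]
      sum.lessThan_Suc[of "\<lambda>k. (act cs ^^ k) b" h] h
    unfolding v_def by (simp del: funpow.simps(2))
  finally have "inner v x = 0" if "x \<in> span \<Delta>" for x
    using coxeter_fixed_orthogonal assms that by blast
  moreover have "v \<in> span \<Delta>" unfolding v_def using P root_in_span pos_root by (intro span_sum) blast
  ultimately have "v = 0" by (metis inner_eq_zero_iff)
  have "inner (weight d) b = 0" if d: "d \<in> \<Delta>" for d
  proof -
    have "(\<Sum>k<h. inner (weight d) ((act cs ^^ k) b)) = 0"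
      using \<open>v = 0\<close> by (metis v_def inner_sum_right inner_zero_right)
    moreover have "\<forall>k<h. 0 \<le> inner (weight d) ((act cs ^^ k) b)" using P pos_weight d by blast
    ultimately have "\<forall>k\<in>{..<h}. inner (weight d) ((act cs ^^ k) b) = 0"
      by (subst (asm) sum_nonneg_eq_0_iff) auto
    then show ?thesis using h by (metis lessThan_iff funpow_0)
  qed
  then have "b = 0" using span_eq_0 root_in_span pos_root assms by blast
  then show False using assms pos_root root_nonzero by blast
qed

text \<open>Going back from \<open>b\<close> by \<open>c^-1\<close> up to the sign change ends at an
  inversion of \<open>c\<close>, and these are the values of \<open>proj_root\<close>.\<close>

lemma pos_orbit:
  assumes cs: "coxeter_word cs" and b: "b \<in> pos"
  obtains q k where "q \<in> \<Delta>" "pos_upto (act cs) q k" "b = (act cs ^^ k) (proj_root (act cs) q)"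
proof -
  let ?d = "act (rev cs)"
  obtain K where K: "(?d ^^ K) b \<notin> pos" "\<And>j. j < K \<Longrightarrow> (?d ^^ j) b \<in> pos"
    using coxeter_orbit_not_pos[of "rev cs" b] cs b exists_least_iff[of "\<lambda>k. (?d ^^ k) b \<notin> pos"]
    by auto
  then obtain k where k: "K = Suc k" using b by (cases K) auto
  obtain q where q: "q \<in> \<Delta>" "(?d ^^ k) b = proj_root (act cs) q"
    using coxeter_word_inversion[OF cs, of "(?d ^^ k) b"] K k by auto
  have orbit: "(act cs ^^ j) (proj_root (act cs) q) = (?d ^^ (k - j)) b" if "j \<le> k" for j
    using act_rev_pow_act_pow[OF that, of "rev cs" b] q by simp
  have "pos_upto (act cs) q k"
    unfolding pos_upto_def using orbit K(2) k by simp
  moreover have "b = (act cs ^^ k) (proj_root (act cs) q)" using orbit[of k] by simp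
  ultimately show ?thesis using that q by blast
qed

text \<open>\<open>c^-1\<close> makes every \<open>proj_root\<close> negative, so unequal exponents
  would put a negative root inside a positive stretch. With equal exponents, the weights of
  \<open>q\<close> and \<open>r\<close> would pair equally with \<open>q\<close>.\<close>

lemma pos_upto_inj:
  assumes cs: "coxeter_word cs" and "q \<in> \<Delta>" "r \<in> \<Delta>" "pos_upto (act cs) q k" "pos_upto (act cs) r l"
    and eq: "(act cs ^^ k) (proj_root (act cs) q) = (act cs ^^ l) (proj_root (act cs) r)"
  shows "q = r \<and> k = l"
proof -
  let ?c = "act cs" let ?p = "proj_root ?c"
  have less: False if "k < l" "q \<in> \<Delta>" "pos_upto ?c r l" "(?c ^^ k) (?p q) = (?c ^^ l) (?p r)" for k l q r
  proof -
    have "k + Suc (l - k - 1) = l" using that by simp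
    then have "(?c ^^ k) ((?c ^^ Suc (l - k - 1)) (?p r)) = (?c ^^ l) (?p r)"
      by (metis comp_apply funpow_add)
    then have "?p q = ?c ((?c ^^ (l - k - 1)) (?p r))"
      using that(4) act_pow_eq_iff[of k cs] by (metis comp_apply funpow.simps(2))
    then have "act (rev cs) (?p q) = (?c ^^ (l - k - 1)) (?p r)" by simp
    moreover have "(?c ^^ (l - k - 1)) (?p r) \<in> pos" using that by (simp add: pos_upto_def)
    ultimately show False using act_rev_proj_root_not_pos cs that by metis
  qed
  have kl: "k = l" using less[of k l q r] less[of l k r q] assms by (metis linorder_neqE_nat)
  then have "?p q = ?p r"
    using eq act_pow_eq_iff by blast
  then have "inner (weight q) q = inner (weight r) q"
    using diff_coxeter_eq[OF cs, of "weight q" "weight r" q] assms(2) by (simp add: proj_root_def span_base)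
  then show ?thesis using kl weight_other[of r q] weight_simple_pos[of q] assms by auto
qed

lemma weight_pow_proj_root_nonneg:
  "pos_upto c r l \<Longrightarrow> j \<le> l \<Longrightarrow> q \<in> \<Delta> \<Longrightarrow> 0 \<le> inner (weight q) ((c ^^ j) (proj_root c r))"
  using pos_weight by (auto simp: pos_upto_def)

lemma weight_proj_root_before:
  assumes "coxeter_word cs" "before cs q r"
  shows "inner (weight r) (proj_root (act cs) q) = 0"
proof -
  obtain xs ys zs where cs: "cs = xs @ q # ys @ r # zs" using assms by (auto simp: before_def)
  have "q \<noteq> r" "q \<in> \<Delta>" "r \<in> \<Delta>" "set xs \<subseteq> \<Delta> - {r}" using assms cs
    by (auto simp: coxeter_word_def)
  then show ?thesis
    using proj_root_eq[of xs q "ys @ r # zs"] assms cs by (simp add: weight_act weight_other)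
qed

lemma pow_proj_root:
  "(act cs ^^ k) (proj_root (act cs) q) = (act cs ^^ k) (weight q) - act cs ((act cs ^^ k) (weight q))"
  by (simp add: proj_root_def act_pow_diff funpow_swap1)

lemma euler_pow_proj_root:
  "coxeter_word cs \<Longrightarrow> x \<in> span \<Delta> \<Longrightarrow>
    euler (act cs) ((act cs ^^ k) (proj_root (act cs) q)) x = inner ((act cs ^^ k) (weight q)) x"
  unfolding pow_proj_root by (rule euler_eq)

text \<open>Since \<open>c\<close> is an isometry, the first value is the pairing of
  \<open>weight q\<close> with the positive root \<open>c^(l-k) p_r\<close>. In the second,
  expanding \<open>p_q\<close> and shifting the difference to the other side gives minus the pairing
  with \<open>c^(l-k-1) p_r\<close>; for \<open>k = l\<close> the order of the letters in
  \<open>cs\<close> makes the value 0.\<close>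

lemma euler_order:
  assumes cs: "coxeter_word cs" and qr: "q \<in> \<Delta>" "r \<in> \<Delta>"
    and P: "pos_upto (act cs) q k" "pos_upto (act cs) r l"
    and less: "k < l \<or> k = l \<and> before cs q r"
  shows "0 \<le> euler (act cs) ((act cs ^^ k) (proj_root (act cs) q)) ((act cs ^^ l) (proj_root (act cs) r))"
      (is ?A)
    and "euler (act cs) ((act cs ^^ l) (proj_root (act cs) r)) ((act cs ^^ k) (proj_root (act cs) q)) \<le> 0"
      (is ?B)
proof -
  let ?c = "act cs" let ?p = "proj_root ?c"
  have "(?c ^^ k) (?p q) \<in> span \<Delta>" "(?c ^^ l) (?p r) \<in> span \<Delta>"
    using P root_in_span pos_root by (auto simp: pos_upto_def)
  then have e: "euler ?c ((?c ^^ k) (?p q)) ((?c ^^ l) (?p r)) = inner ((?c ^^ k) (weight q)) ((?c ^^ l) (?p r))"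
    "euler ?c ((?c ^^ l) (?p r)) ((?c ^^ k) (?p q)) = inner ((?c ^^ l) (weight r)) ((?c ^^ k) (?p q))"
    using euler_pow_proj_root cs by blast+
  show ?A
    using e(1) less inner_act_pow_le[of k l cs "weight q" "?p r"]
      weight_pow_proj_root_nonneg[OF P(2), of "l - k" q] qr by auto
  show ?B
  proof (cases "k = l")
    case True
    then show ?thesis using e(2) less weight_proj_root_before cs by (simp add: inner_act_pow)
  next
    case False
    then have kl: "k < l" using less by simp
    have "inner ((?c ^^ l) (weight r)) ((?c ^^ k) (?p q)) =
        inner ((?c ^^ k) (weight q)) ((?c ^^ l) (weight r)) - inner ((?c ^^ Suc k) (weight q)) ((?c ^^ l) (weight r))"
      by (simp add: pow_proj_root inner_diff_right inner_commute)
    also have "\<dots> = inner (weight q) ((?c ^^ (l - k)) (weight r)) - inner (weight q) ((?c ^^ (l - Suc k)) (weight r))"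
      using kl by (simp only: inner_act_pow_le less_imp_le Suc_leI)
    also have "\<dots> = - inner (weight q) ((?c ^^ (l - Suc k)) (?p r))"
    proof -
      have "l - k = Suc (l - Suc k)" using kl by simp
      then show ?thesis by (simp add: pow_proj_root inner_diff_right)
    qed
    also have "\<dots> \<le> 0" using weight_pow_proj_root_nonneg[OF P(2), of "l - Suc k" q] qr by simp
    finally show ?thesis using e(2) by simp
  qed
qed

text \<open>Just before \<open>q\<close> acts, the root has no component at \<open>q\<close> but one
  at the neighbor \<open>r\<close>, so \<open>reflection q\<close> creates a positive coefficient at
  \<open>q\<close>, which the letters in \<open>xs\<close> leave alone.\<close>

lemma weight_proj_root_pos:
  assumes "coxeter_word cs" "before cs q r" "inner r q \<noteq> 0"
  shows "0 < inner (weight q) (proj_root (act cs) r)"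
proof -
  obtain xs ys zs where cs: "cs = xs @ q # ys @ r # zs" using assms by (auto simp: before_def)
  have D: "q \<noteq> r" "q \<in> \<Delta>" "r \<in> \<Delta>" "set xs \<subseteq> \<Delta> - {q}" "set ys \<subseteq> \<Delta> - {q}" "set ys \<subseteq> \<Delta> - {r}"
    using assms cs by (auto simp: coxeter_word_def)
  have "proj_root (act cs) r = act (xs @ q # ys) r"
    using proj_root_eq[of "xs @ q # ys" r zs] assms cs by simp
  moreover have "inner (act ys r) q < 0"
  proof (rule inner_pos_simple_neg)
    have w: "inner (weight r) (act ys r) > 0" using D weight_act[of r ys r] weight_simple_pos[of r] by simp
    then show "inner (weight r) (act ys r) > 0" .
    show "act ys r \<in> pos" using pos_if_weight[OF _ _ w] act_root_simple[of ys r] D simple_root by blast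
    show "inner (weight q) (act ys r) = 0" using D by (simp add: weight_act weight_other)
  qed (use D assms in auto)
  moreover have "inner (weight q) (act ys r) = 0" using D by (simp add: weight_act weight_other)
  ultimately show ?thesis using D by (simp add: weight_act weight_reflection)
qed

text \<open>If \<open>r\<close> comes first, \<open>q\<close> does not occur in the prefix defining
  \<open>proj_root\<close>. Applying \<open>c\<close> lets \<open>q\<close> act for the first time,
  on \<open>act (zs @ xs) r\<close>, and the argument of \<open>weight_proj_root_pos\<close>
  repeats.\<close>

lemma weight_act_proj_root_pos:
  assumes "coxeter_word cs" "before cs r q" "inner r q \<noteq> 0"
  shows "0 < inner (weight q) (act cs (proj_root (act cs) r))"
proof -
  obtain xs ys zs where cs: "cs = xs @ r # ys @ q # zs" using assms by (auto simp: before_def)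
  have D: "q \<noteq> r" "q \<in> \<Delta>" "r \<in> \<Delta>" "set (xs @ r # ys) \<subseteq> \<Delta> - {q}" "set (zs @ xs) \<subseteq> \<Delta> - {q}" "set (zs @ xs) \<subseteq> \<Delta> - {r}"
    using assms cs by (auto simp: coxeter_word_def)
  let ?y = "act (zs @ xs) r"
  have "act cs (proj_root (act cs) r) = act (xs @ r # ys) (reflection q ?y)"
    using proj_root_eq[of xs r "ys @ q # zs"] assms cs by simp
  moreover have "inner ?y q < 0"
  proof (rule inner_pos_simple_neg)
    have w: "inner (weight r) ?y > 0" using D weight_act[of r "zs @ xs" r] weight_simple_pos[of r] by simp
    then show "inner (weight r) ?y > 0" .
    show "?y \<in> pos" using pos_if_weight[OF _ _ w] act_root_simple[of "zs @ xs" r] D simple_root by blast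
    show "inner (weight q) ?y = 0" using D weight_act[of q "zs @ xs" r] weight_other[of q r] by simp
  qed (use D assms in auto)
  moreover have "inner (weight q) ?y = 0" using D weight_act[of q "zs @ xs" r] weight_other[of q r] by simp
  ultimately show ?thesis using D weight_act[of q "xs @ r # ys" "reflection q ?y"] weight_reflection[of q ?y]
    by (simp del: foldr.simps foldr_append)
qed

text \<open>At the first sign change, \<open>c\<^sup>a p\<^sub>q = - p\<^sub>x\<close> and hence \<open>c\<^sup>a\<close> maps the weight of \<open>q\<close> to
  minus the weight of \<open>x\<close>. The pairing of the weight of \<open>q\<close> with the next \<open>r\<close>-root being
  positive, that root acquires a negative coefficient at \<open>x\<close>.\<close>

lemma pos_upto_ideal:
  assumes cs: "coxeter_word cs" and qr: "q \<in> \<Delta>" "r \<in> \<Delta>" and adj: "inner r q \<noteq> 0"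
    and P: "pos_upto (act cs) r l" and less: "k < l \<or> k = l \<and> before cs q r"
  shows "pos_upto (act cs) q k"
proof (rule ccontr)
  assume not: "\<not> ?thesis"
  let ?c = "act cs" let ?p = "proj_root ?c"
  obtain a where a: "a \<le> k" "(?c ^^ a) (?p q) \<notin> pos" "\<And>j. j < a \<Longrightarrow> (?c ^^ j) (?p q) \<in> pos"
    using not exists_least_iff[of "\<lambda>j. j \<le> k \<and> (?c ^^ j) (?p q) \<notin> pos"]
    by (auto simp: pos_upto_def)
  have root: "(?c ^^ j) (?p t) \<in> \<Phi>" if "t \<in> \<Delta>" for j t
    using that proj_root_root cs act_pow_root by blast
  obtain a' where a': "a = Suc a'" using a proj_root_pos[OF cs qr(1)] by (cases a) auto
  have "- (?c ^^ a) (?p q) \<in> pos" using not_pos_iff a root qr by blast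
  moreover have "act (rev cs) (- (?c ^^ a) (?p q)) \<notin> pos"
    using a(3)[of a'] a' uminus_pos by (simp add: act_minus)
  ultimately obtain x where x: "x \<in> \<Delta>" "- (?c ^^ a) (?p q) = ?p x"
    using coxeter_word_inversion[OF cs] by blast
  have w: "inner ((?c ^^ a) (weight q)) y = - inner (weight x) y" if "y \<in> \<Phi>" for y
  proof -
    have "(?c ^^ a) (weight q) - ?c ((?c ^^ a) (weight q)) = (- weight x) - ?c (- weight x)"
      using x(2) by (simp add: pow_proj_root act_minus) (simp add: proj_root_def algebra_simps)
    from diff_coxeter_eq[OF cs this root_in_span[OF that]] show ?thesis by simp
  qed
  have contra: False if "d \<le> l - a" "a \<le> l" "0 < inner (weight q) ((?c ^^ d) (?p r))" for d
  proof -
    have "inner (weight q) ((?c ^^ d) (?p r)) = inner ((?c ^^ a) (weight q)) ((?c ^^ (a + d)) (?p r))"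
      by (simp add: inner_act_pow_le)
    also have "\<dots> = - inner (weight x) ((?c ^^ (a + d)) (?p r))" using w root qr by blast
    also have "\<dots> \<le> 0" using P pos_weight[of "(?c ^^ (a + d)) (?p r)" x] x that
      by (auto simp: pos_upto_def)
    finally show False using that by simp
  qed
  \<comment> \<open>When \<open>r\<close> comes first, its root acquires a coefficient at
    \<open>q\<close> only after one more application of \<open>c\<close>. The strict
    \<open>k < l\<close> leaves room for it: \<open>contra\<close> is used with \<open>d = 1\<close>
    there and with \<open>d = 0\<close> when \<open>q\<close> comes first.\<close>
  consider "before cs q r" "k \<le> l" | "before cs r q" "k < l" | "q = r" "k < l"
  proof -
    obtain i j where "i < length cs" "j < length cs" "cs ! i = q" "cs ! j = r"
      using qr cs by (metis coxeter_word_def in_set_conv_nth)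
    then show ?thesis using that less before_nth[of i j cs] before_nth[of j i cs]
      by (metis less_imp_le linorder_neqE_nat order_refl)
  qed
  then show False
  proof cases
    case 1
    then show ?thesis using contra[of 0] weight_proj_root_pos[OF cs 1(1) adj] a by auto
  next
    case 2
    have "1 \<le> l - a" "a \<le> l" using 2 a by simp_all
    then show ?thesis using contra[of 1] weight_act_proj_root_pos[OF cs 2(1) adj] by simp
  next
    case 3
    then show ?thesis using P a by (auto simp: pos_upto_def)
  qed
qed

end

section \<open>The sorting word of the longest element\<close>

lemma act_reflection_commute:
  "(\<And>a. a \<in> set ws \<Longrightarrow> inner a q = 0) \<Longrightarrow> act ws (reflection q x) = reflection q (act ws x)"
  by (induction ws) (simp_all add: reflection_commute[of _ q])

lemma set_inversions_append: "set (inversions us) \<subseteq> set (inversions (us @ vs))"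
proof (induction vs rule: rev_induct)
  case (snoc a vs)
  then show ?case using inversions_snoc[of "us @ vs" a] by auto
qed simp

lemma filter_upt_eq_sorted_list_of_set:
  "A \<subseteq> {..<M} \<Longrightarrow> filter (\<lambda>i. i \<in> A) [0..<M] = sorted_list_of_set A"
proof (rule sorted_distinct_set_unique)
  assume "A \<subseteq> {..<M}"
  moreover from this have "finite A" using finite_subset by blast
  ultimately show "set (filter (\<lambda>i. i \<in> A) [0..<M]) = set (sorted_list_of_set A)" by auto
qed (simp_all add: sorted_wrt_filter)

definition letter :: "'a list \<Rightarrow> nat \<Rightarrow> 'a" where
  "letter cs i = cs ! (i mod length cs)"

context simple_root_system
begin

text \<open>Positions are selected by signs along the orbits, without mention of reduced words. That
  they give the lexicographically first choice is the outcome in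
  \<open>sorting_positions_least\<close>.\<close>

definition sorting_positions :: "'v list \<Rightarrow> nat set" where
  "sorting_positions cs = {i. pos_upto (act cs) (letter cs i) (i div length cs)}"

definition root_at :: "'v list \<Rightarrow> nat \<Rightarrow> 'v" where
  "root_at cs i = (act cs ^^ (i div length cs)) (proj_root (act cs) (letter cs i))"

definition sorting_list :: "'v list \<Rightarrow> 'v list" where
  "sorting_list cs = map (letter cs) (sorted_list_of_set (sorting_positions cs))"

context
  fixes cs :: "'v list"
  assumes cs: "coxeter_word cs" and nonempty: "cs \<noteq> []"
begin

private abbreviation f where
  "f \<equiv> letter cs"

private abbreviation P where
  "P \<equiv> sorting_positions cs"

private lemma f_in: "f i \<in> \<Delta>"
  using cs nonempty nth_mem[of "i mod length cs" cs] by (simp add: letter_def coxeter_word_def)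

private lemma f_image: "f ` A \<subseteq> \<Delta>"
  using f_in by auto

private lemma act_periodic:
  "act (map f [0..<i]) x = (act cs ^^ (i div length cs)) (act (take (i mod length cs) cs) x)"
proof (induction i arbitrary: x)
  case (Suc i)
  let ?n = "length cs"
  have "i mod ?n < ?n" using nonempty by simp
  have "act (map f [0..<Suc i]) x = (act cs ^^ (i div ?n)) (act (take (Suc (i mod ?n)) cs) x)"
    using Suc[of "reflection (f i) x"] \<open>i mod ?n < ?n\<close>
    by (simp add: take_Suc_conv_app_nth letter_def[of cs i])
  also have "\<dots> = (act cs ^^ (Suc i div ?n)) (act (take (Suc i mod ?n) cs) x)"
  proof (cases "Suc (i mod ?n) = ?n")
    case True
    then show ?thesis by (simp add: div_Suc mod_Suc funpow_swap1)
  next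
    case False
    then show ?thesis by (simp add: div_Suc mod_Suc)
  qed
  finally show ?case .
qed simp

text \<open>So \<open>root_at\<close> gives the inversions of the full word
  \<open>c c c ...\<close>, skipped letters included; \<open>act_taken_letter\<close> shows that
  skipping leaves the values at the taken positions unchanged.\<close>

private lemma act_periodic_letter: "act (map f [0..<i]) (f i) = root_at cs i"
proof -
  let ?j = "i mod length cs"
  have "?j < length cs" using nonempty by simp
  then have "proj_root (act cs) (cs ! ?j) = act (take ?j cs) (cs ! ?j)"
    using proj_root_eq[of "take ?j cs" "cs ! ?j" "drop (Suc ?j) cs"] cs
    by (metis id_take_nth_drop)
  then show ?thesis by (simp add: act_periodic root_at_def letter_def)
qed

private lemma root_at_pos: "i \<in> P \<Longrightarrow> root_at cs i \<in> pos"
  by (auto simp: sorting_positions_def root_at_def pos_upto_def)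

private lemma nth_distinct: "i < length cs \<Longrightarrow> j < length cs \<Longrightarrow> cs ! i = cs ! j \<Longrightarrow> i = j"
  using cs nth_eq_iff_index_eq by (auto simp: coxeter_word_def)

private lemma bij_root_at: "bij_betw (root_at cs) P pos"
  unfolding bij_betw_def
proof
  show "inj_on (root_at cs) P"
  proof (rule inj_onI)
    fix i j assume ij: "i \<in> P" "j \<in> P" "root_at cs i = root_at cs j"
    then have "f i = f j \<and> i div length cs = j div length cs"
      using pos_upto_inj[OF cs f_in f_in, of i "i div length cs" j "j div length cs"]
      by (simp add: sorting_positions_def root_at_def letter_def)
    then show "i = j"
      using nth_distinct[of "i mod length cs" "j mod length cs"] nonempty
      by (metis letter_def length_greater_0_conv mod_less_divisor div_mult_mod_eq)
  qed
  show "root_at cs ` P = pos"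
  proof
    show "root_at cs ` P \<subseteq> pos" using root_at_pos by auto
    show "pos \<subseteq> root_at cs ` P"
    proof
      fix b assume "b \<in> pos"
      then obtain q k where q: "q \<in> \<Delta>" "pos_upto (act cs) q k" "b = (act cs ^^ k) (proj_root (act cs) q)"
        using pos_orbit[OF cs] by blast
      then obtain j where "j < length cs" "cs ! j = q"
        using cs by (metis coxeter_word_def in_set_conv_nth)
      moreover have "(j + k * length cs) div length cs = k"
        using \<open>j < length cs\<close> by (subst div_mult_self1) auto
      ultimately show "b \<in> root_at cs ` P"
        using q by (intro image_eqI[of _ _ "j + k * length cs"])
          (auto simp: root_at_def sorting_positions_def letter_def)
    qed
  qed
qed

private lemma finite_P: "finite P"
  using bij_root_at finite_pos bij_betw_finite by blast

private lemma before_positions: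
  "i < j \<Longrightarrow> i div length cs < j div length cs \<or>
    i div length cs = j div length cs \<and> before cs (f i) (f j)"
proof -
  assume "i < j"
  then have "i div length cs < j div length cs \<or>
      i div length cs = j div length cs \<and> i mod length cs < j mod length cs"
    by (metis div_le_mono div_mult_mod_eq le_neq_implies_less less_imp_le nat_add_left_cancel_less)
  then show ?thesis using before_nth[of "i mod length cs" "j mod length cs" cs] nonempty
    by (auto simp: letter_def)
qed

private lemma P_ideal: "i \<in> P \<Longrightarrow> j < i \<Longrightarrow> inner (f i) (f j) \<noteq> 0 \<Longrightarrow> j \<in> P"
  using pos_upto_ideal[OF cs f_in f_in, of i j "i div length cs" "j div length cs"] before_positions[of j i]
  by (simp add: sorting_positions_def letter_def)

private abbreviation taken where
  "taken i \<equiv> map f (filter (\<lambda>j. j \<in> P) [0..<i])"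

private abbreviation skipped where
  "skipped i \<equiv> map f (filter (\<lambda>j. j \<notin> P) [0..<i])"

private lemma skipped_orthogonal: "i \<in> P \<Longrightarrow> a \<in> set (skipped i) \<Longrightarrow> inner a (f i) = 0"
  using P_ideal[of i] by (auto simp: inner_commute[of a])

text \<open>By the ideal property a taken letter is orthogonal to all letters skipped before it, so
  the skipped letters can be commuted to the right end.\<close>

private lemma act_taken_skipped: "act (map f [0..<i]) x = act (taken i) (act (skipped i) x)"
proof (induction i arbitrary: x)
  case (Suc i)
  show ?case
  proof (cases "i \<in> P")
    case True
    then show ?thesis
      using Suc[of "reflection (f i) x"] act_reflection_commute[of "skipped i" "f i" x]
        skipped_orthogonal[of i] by simp
  qed (use Suc[of "reflection (f i) x"] in simp)
qed simp

private lemma act_taken_letter: "i \<in> P \<Longrightarrow> act (taken i) (f i) = root_at cs i"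
  using act_taken_skipped[of i "f i"] act_fix[of "skipped i" "f i"] skipped_orthogonal[of i]
    act_periodic_letter[of i]
  by (simp add: inner_commute)

private lemma inversions_taken:
  "inversions (taken i) = map (root_at cs) (filter (\<lambda>j. j \<in> P) [0..<i])"
  by (induction i) (auto simp: inversions_snoc act_taken_letter)

private lemma taken_eq: "P \<subseteq> {..<M} \<Longrightarrow> taken M = sorting_list cs"
  by (simp add: filter_upt_eq_sorted_list_of_set sorting_list_def letter_def)

private lemma ex_bound: "\<exists>M\<ge>i. P \<subseteq> {..<M}"
proof -
  obtain M where "\<forall>j\<in>P. j < M" using finite_nat_set_iff_bounded finite_P by blast
  then show ?thesis by (intro exI[of _ "max i M"]) auto
qed

lemma inversions_sorting_list:
  "inversions (sorting_list cs) = map (root_at cs) (sorted_list_of_set (sorting_positions cs))"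
proof -
  obtain M where "P \<subseteq> {..<M}" using ex_bound by blast
  then show ?thesis
    using inversions_taken[of M] taken_eq[of M] filter_upt_eq_sorted_list_of_set[of P M] by simp
qed

lemma set_sorting_list: "set (sorting_list cs) \<subseteq> \<Delta>"
  using f_image by (auto simp: sorting_list_def letter_def)

lemma set_inversions_sorting_list: "set (inversions (sorting_list cs)) = pos"
  using bij_root_at finite_P by (simp add: inversions_sorting_list bij_betw_def)

lemma distinct_inversions_sorting_list: "distinct (inversions (sorting_list cs))"
  using inversions_pos[OF set_sorting_list] set_inversions_sorting_list by simp

lemma length_sorting_list: "length (sorting_list cs) = card pos"
  using distinct_card[OF distinct_inversions_sorting_list] set_inversions_sorting_list by simp

lemma act_sorting_list_not_pos: "b \<in> pos \<Longrightarrow> act (sorting_list cs) b \<notin> pos"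
proof
  assume b: "b \<in> pos" "act (sorting_list cs) b \<in> pos"
  then have "act (sorting_list cs) b \<in> inv_set (sorting_list cs)"
    using inversions_pos[OF set_sorting_list] set_inversions_sorting_list by simp
  then show False using b by (simp add: inv_set_def)
qed

lemma sorting_list_euler:
  assumes "i < j" "j < length (sorting_list cs)"
  shows "euler (act cs) (inversions (sorting_list cs) ! j) (inversions (sorting_list cs) ! i) \<le> 0" (is ?A)
    and "0 \<le> euler (act cs) (inversions (sorting_list cs) ! i) (inversions (sorting_list cs) ! j)" (is ?B)
proof -
  let ?l = "sorted_list_of_set P"
  have len: "length (sorting_list cs) = length ?l" by (simp add: sorting_list_def)
  have less: "?l ! i < ?l ! j"
    using assms len sorted_wrt_nth_less[OF strict_sorted_list_of_set] by metis
  have mem: "?l ! k \<in> P" if "k < length ?l" for k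
    using nth_mem[OF that] finite_P by simp
  have ij: "i < length ?l" "j < length ?l" using assms len by simp_all
  have up: "pos_upto (act cs) (f (?l ! k)) (?l ! k div length cs)" if "k < length ?l" for k
    using mem[OF that] by (simp add: sorting_positions_def)
  have nth: "inversions (sorting_list cs) ! k = root_at cs (?l ! k)" if "k < length ?l" for k
    using that by (simp add: inversions_sorting_list)
  show ?A ?B
    unfolding nth[OF ij(1)] nth[OF ij(2)] root_at_def
    using euler_order[OF cs f_in f_in up[OF ij(1)] up[OF ij(2)] before_positions[OF less]] by simp_all
qed

text \<open>Letters taken after the skipped position are orthogonal to its letter, again by the
  ideal property. So the prefix sends this letter where the whole sorting word sends it, to a
  negative root.\<close>

private lemma act_taken_skipped_letter_not_pos:
  assumes "i \<notin> P"
  shows "act (taken i) (f i) \<notin> pos"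
proof -
  obtain M where M: "i \<le> M" "P \<subseteq> {..<M}" using ex_bound by blast
  have "[0..<M] = [0..<i] @ [i..<M]" using M upt_add_eq_append[of 0 i "M - i"] by simp
  then have "sorting_list cs = taken i @ map f (filter (\<lambda>j. j \<in> P) [i..<M])"
    using taken_eq[OF M(2)] by simp
  moreover have "act (map f (filter (\<lambda>j. j \<in> P) [i..<M])) (f i) = f i"
  proof (rule act_fix)
    fix a assume "a \<in> set (map f (filter (\<lambda>j. j \<in> P) [i..<M]))"
    then obtain j where "j \<in> P" "i \<le> j" "a = f j" by auto
    then show "inner (f i) a = 0" using P_ideal[of j i] assms by (cases "i = j") (auto simp: inner_commute)
  qed
  ultimately show ?thesis using act_sorting_list_not_pos[OF simple_pos[OF f_in[of i]]] by simp
qed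

text \<open>At the first difference, a smaller competitor takes a position \<open>b\<close> that is
  skipped here; after the common prefix its letter yields an inversion that is not positive.\<close>

lemma sorting_positions_least:
  assumes qs: "sorted_wrt (<) qs" "length qs = card pos"
    "set (inversions (map (letter cs) qs)) \<subseteq> pos"
  shows "sorted_list_of_set (sorting_positions cs) = qs \<or>
    (sorted_list_of_set (sorting_positions cs), qs) \<in> lexord less_than"
proof (rule disjCI)
  let ?l = "sorted_list_of_set P"
  assume "(sorted_list_of_set (sorting_positions cs), qs) \<notin> lexord less_than"
  show "sorted_list_of_set (sorting_positions cs) = qs"
  proof (rule ccontr)
    assume "sorted_list_of_set (sorting_positions cs) \<noteq> qs"
    moreover have "length ?l = length qs"
      using qs(2) length_sorting_list by (simp add: sorting_list_def)
    ultimately obtain us a b xs ys where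
      split: "a \<noteq> b" "?l = us @ [a] @ xs" "qs = us @ [b] @ ys"
      using same_length_different[of ?l qs] by blast
    have "\<not> a < b"
      using lexord_append_left_rightI[of a b less_than us xs ys] split
        \<open>(?l, qs) \<notin> lexord less_than\<close>
      by auto
    then have "b < a" using split by simp
    have sl: "sorted_wrt (<) (us @ [a] @ xs)"
      using strict_sorted_list_of_set[of P] split by simp
    have P_set: "P = set us \<union> {a} \<union> set xs"
      using split(2) finite_P set_sorted_list_of_set[of P] by auto
    have us_b: "\<forall>x\<in>set us. x < b" using qs(1) split by (auto simp: sorted_wrt_append)
    have xs_a: "\<forall>x\<in>set xs. a < x" using sl by (auto simp: sorted_wrt_append)
    have "b \<notin> P" using P_set us_b xs_a \<open>b < a\<close> by force
    moreover have "filter (\<lambda>j. j \<in> P) [0..<b] = us"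
    proof (rule sorted_distinct_set_unique)
      show "set (filter (\<lambda>j. j \<in> P) [0..<b]) = set us"
        using P_set us_b xs_a \<open>b < a\<close> by force
      show "sorted us" "distinct us" using sl by (auto simp: sorted_wrt_append strict_sorted_iff)
    qed (auto simp: sorted_wrt_filter)
    ultimately have "act (map f us) (f b) \<notin> pos"
      using act_taken_skipped_letter_not_pos[of b] by simp
    moreover have "act (map f us) (f b) \<in> set (inversions (map f us @ [f b]))"
      by (simp add: inversions_snoc)
    ultimately show False
      using qs(3) split(3) set_inversions_append[of "map f us @ [f b]" "map f ys"] by (auto simp: letter_def)
  qed
qed

end

end

section \<open>Ordered reflection factorizations\<close>

text \<open>Whatever stands before \<open>x\<close> in \<open>ys\<close> is \<open>R\<close>-related
  to \<open>x\<close> in both directions, hence orthogonal to it, and \<open>x\<close> can be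
  commuted to the front.\<close>

lemma act_sorted_permutation:
  assumes "sorted_wrt R xs" "sorted_wrt R ys" "distinct xs" "distinct ys" "set xs = set ys"
    and "\<And>x y. x \<in> set xs \<Longrightarrow> y \<in> set xs \<Longrightarrow> x \<noteq> y \<Longrightarrow> R x y \<Longrightarrow> R y x \<Longrightarrow> inner (g x) (g y) = 0"
  shows "act (map g xs) v = act (map g ys) v"
  using assms
proof (induction xs arbitrary: ys v)
  case (Cons x xs)
  then obtain as bs where ys: "ys = as @ x # bs" by (metis list.set_intros(1) split_list)
  have "act (map g as) (reflection (g x) u) = reflection (g x) (act (map g as) u)" for u
  proof (rule act_reflection_commute)
    fix b assume "b \<in> set (map g as)"
    then obtain a where a: "a \<in> set as" "b = g a" by auto
    have "a \<noteq> x" "a \<in> set (x # xs)" using Cons.prems(4,5) a ys by auto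
    then show "inner b (g x) = 0"
      using Cons.prems a ys by (auto simp: sorted_wrt_append)
  qed
  moreover have "act (map g xs) v = act (map g (as @ bs)) v"
  proof (rule Cons.IH)
    have "x \<notin> set xs" "x \<notin> set (as @ bs)" "insert x (set xs) = insert x (set (as @ bs))"
      using Cons.prems(3-5) ys by auto
    then show "set xs = set (as @ bs)" by (metis insert_ident)
    show "inner (g a) (g b) = 0" if "a \<in> set xs" "b \<in> set xs" "a \<noteq> b" "R a b" "R b a" for a b
      using Cons.prems(6)[of a b] that by simp
  qed (use Cons.prems ys in \<open>auto simp: sorted_wrt_append\<close>)
  ultimately show ?case using ys by simp
qed simp

lemma sorted_wrt_nths: "sorted_wrt R xs \<Longrightarrow> sorted_wrt R (nths xs I)"
proof (induction xs arbitrary: I)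
  case (Cons x xs)
  then show ?case using set_nths_subset[of xs "{j. Suc j \<in> I}"] by (auto simp: nths_Cons)
qed simp

text \<open>The index of the block of a color along \<open>c w_o^m(c)\<close>, whose prefix
  \<open>c\<close> carries color \<open>m\<close>.\<close>

definition level :: "nat \<Rightarrow> nat \<Rightarrow> nat" where
  "level m k = (if k = m then 0 else Suc k)"

context simple_root_system
begin

definition colored_roots :: "nat \<Rightarrow> ('v \<times> nat) set" where
  "colored_roots m = pos \<times> {..<m} \<union> \<Delta> \<times> {m}"

text \<open>Up to sign, the root of the reflection that deleting the letter with label \<open>x\<close> from the word
  \<open>c w\<^sub>\<circ>\<^sup>m(c)\<close> multiplies its product with.\<close>

definition position_root :: "('v \<Rightarrow> 'v) \<Rightarrow> nat \<Rightarrow> 'v \<times> nat \<Rightarrow> 'v" where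
  "position_root c m x = (if snd x = m then proj_root c (fst x) else c (fst x))"

abbreviation nonorthogonal where
  "nonorthogonal c m x y \<equiv> inner (position_root c m x) (position_root c m y) \<noteq> 0"

text \<open>The order in which two noncommuting reflections occur along \<open>c w\<^sub>\<circ>\<^sup>m(c)\<close>, expressed by
  \<open>c\<close> alone.\<close>

definition precedes :: "('v \<Rightarrow> 'v) \<Rightarrow> nat \<Rightarrow> 'v \<times> nat \<Rightarrow> 'v \<times> nat \<Rightarrow> bool" where
  "precedes c m x y \<longleftrightarrow>
     nonorthogonal c m x y \<and>
     (level m (snd x) < level m (snd y) \<or>
      snd x = snd y \<and>
      euler c (position_root c m y) (position_root c m x) < euler c (position_root c m x) (position_root c m y))"

abbreviation ordered where
  "ordered c m \<equiv> sorted_wrt (\<lambda>x y. \<not> precedes c m y x)"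

text \<open>A list instead of a set, so that rotation can move an entry from one end to the other;
  by \<open>facet_permute\<close> any admissible order serves. Only the element \<open>c\<close>
  enters, which makes the faces independent of a word for it.\<close>

definition facet :: "('v \<Rightarrow> 'v) \<Rightarrow> nat \<Rightarrow> ('v \<times> nat) list \<Rightarrow> bool" where
  "facet c m xs \<longleftrightarrow>
     distinct xs \<and> set xs \<subseteq> colored_roots m \<and> length xs = card \<Delta> \<and>
     ordered c m xs \<and>
     (\<forall>v. act (map (position_root c m) xs) (c v) = v)"

definition face :: "('v \<Rightarrow> 'v) \<Rightarrow> nat \<Rightarrow> ('v \<times> nat) set \<Rightarrow> bool" where
  "face c m X \<longleftrightarrow> (\<exists>xs. facet c m xs \<and> X \<subseteq> set xs)"

section \<open>Identities of the Euler form and comparability of noncommuting roots\<close>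

lemma finite_colored_roots: "finite (colored_roots m)"
  using finite_pos finite_simple by (simp add: colored_roots_def)

text \<open>Makes \<open>euler\<close> computable on all roots: up to sign each lies in the orbit of
  some \<open>proj_root\<close>, a difference of this form by construction.\<close>

lemma coxeter_primitive:
  assumes "coxeter_word cs" "b \<in> \<Phi>"
  obtains u where "b = u - act cs u"
proof -
  have *: "\<exists>u. b = u - act cs u" if "b \<in> pos" for b
    using pos_orbit[OF assms(1) that] pow_proj_root by metis
  show ?thesis
  proof (cases "b \<in> pos")
    case False
    then obtain u where "- b = u - act cs u" using * not_pos_iff assms(2) by blast
    then have "b = (- u) - act cs (- u)" by (simp add: act_minus algebra_simps)
    then show ?thesis using that by blast
  qed (use * that in blast)
qed

lemma euler_minus_left:
  assumes "coxeter_word cs" "a \<in> \<Phi>" "b \<in> \<Phi>"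
  shows "euler (act cs) (- a) b = - euler (act cs) a b"
proof -
  obtain u where u: "a = u - act cs u" using coxeter_primitive assms by blast
  then have "- a = (- u) - act cs (- u)" by (simp add: act_minus)
  then show ?thesis using euler_eq[OF assms(1) root_in_span[OF assms(3)]] u by (metis inner_minus_left)
qed

text \<open>The Euler form is a nonsymmetric half of the inner product because \<open>c\<close> is
  an isometry. This turns nonorthogonality into a strict comparison in
  \<open>euler_less\<close>.\<close>

lemma euler_add_swap:
  assumes "coxeter_word cs" "a \<in> \<Phi>" "b \<in> \<Phi>"
  shows "euler (act cs) a b + euler (act cs) b a = inner a b"
proof -
  obtain u v where u: "a = u - act cs u" "b = v - act cs v" using coxeter_primitive assms by metis
  have "euler (act cs) a b = inner u b" "euler (act cs) b a = inner v a"
    using euler_eq[OF assms(1)] root_in_span assms u by metis+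
  then show ?thesis
    unfolding u by (simp add: inner_diff_left inner_diff_right inner_act inner_commute)
qed

lemma euler_act:
  assumes "coxeter_word cs" "a \<in> \<Phi>" "b \<in> \<Phi>"
  shows "euler (act cs) (act cs a) (act cs b) = euler (act cs) a b"
proof -
  obtain u where u: "a = u - act cs u" using coxeter_primitive assms by blast
  have "act cs b \<in> span \<Delta>" using act_root_simple[of cs b] assms coxeter_word_set root_in_span by simp
  moreover have "act cs a = act cs u - act cs (act cs u)" using u by (simp add: act_diff)
  ultimately show ?thesis
    using euler_eq[OF assms(1)] u root_in_span[OF assms(3)] by (metis inner_act)
qed

text \<open>The analogue of the Auslander-Reiten formula, with \<open>c\<close> as translation. It
  moves a simple root from the second argument to the first, where \<open>euler_proj_root\<close>
  can evaluate the form.\<close>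

lemma euler_act_left:
  assumes "coxeter_word cs" "a \<in> \<Phi>" "b \<in> \<Phi>"
  shows "euler (act cs) (act cs a) b = - euler (act cs) b a"
proof -
  obtain u v where u: "a = u - act cs u" "b = v - act cs v" using coxeter_primitive assms by metis
  then have "act cs a = act cs u - act cs (act cs u)" by (simp add: act_diff)
  then have "euler (act cs) (act cs a) b = inner (act cs u) b" "euler (act cs) b a = inner v a"
    using euler_eq[OF assms(1)] root_in_span assms u by metis+
  then show ?thesis
    unfolding u by (simp add: inner_diff_left inner_diff_right inner_act inner_commute)
qed

lemma euler_proj_root:
  "coxeter_word cs \<Longrightarrow> b \<in> \<Phi> \<Longrightarrow> euler (act cs) (proj_root (act cs) q) b = inner (weight q) b"
  unfolding proj_root_def by (rule euler_eq) (auto intro: root_in_span)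

lemma euler_less:
  assumes "coxeter_word cs" "a \<in> \<Phi>" "b \<in> \<Phi>" "inner a b \<noteq> 0"
    "0 \<le> euler (act cs) a b" "euler (act cs) b a \<le> 0"
  shows "euler (act cs) b a < euler (act cs) a b"
  using euler_add_swap[OF assms(1-3)] assms by linarith

lemma position_root_root:
  assumes "coxeter_word cs" "x \<in> colored_roots m"
  shows "position_root (act cs) m x \<in> \<Phi>"
proof (cases "snd x = m")
  case True
  then show ?thesis using assms proj_root_root by (auto simp: position_root_def colored_roots_def)
next
  case False
  then have "fst x \<in> \<Phi>" using assms pos_root by (auto simp: colored_roots_def)
  then show ?thesis
    using False act_root_simple[of cs "fst x"] coxeter_word_set[OF assms(1)] by (simp add: position_root_def)
qed

lemma simple_euler_order:
  assumes "coxeter_word cs" "before cs q r"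
  shows "0 \<le> euler (act cs) (proj_root (act cs) q) (proj_root (act cs) r)" (is ?A)
    and "euler (act cs) (proj_root (act cs) r) (proj_root (act cs) q) \<le> 0" (is ?B)
proof -
  have "q \<in> \<Delta>" "r \<in> \<Delta>" using assms by (auto simp: before_def coxeter_word_def)
  then show ?A ?B
    using euler_order[OF assms(1), of q r 0 0] proj_root_pos[OF assms(1)] assms(2)
    by (simp_all add: pos_upto_def)
qed

text \<open>Two roots of one color both occur in the inversion sequence of \<open>c\<close> or of
  its sorting word, which gives weak signs of the Euler form in one of the two orders;
  nonorthogonality makes the comparison strict. For colors below \<open>m\<close>,
  \<open>euler_act\<close> absorbs the \<open>c\<close> in \<open>position_root\<close>.\<close>

lemma precedes_total:
  assumes cs: "coxeter_word cs" and x: "x \<in> colored_roots m" and y: "y \<in> colored_roots m" "x \<noteq> y"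
    and inner: "nonorthogonal (act cs) m x y"
  shows "precedes (act cs) m x y \<or> precedes (act cs) m y x"
proof (cases "snd x = snd y")
  case False
  then show ?thesis using inner by (auto simp: precedes_def level_def inner_commute)
next
  case True
  let ?t = "position_root (act cs) m"
  let ?L = "\<lambda>x y. 0 \<le> euler (act cs) (?t x) (?t y) \<and> euler (act cs) (?t y) (?t x) \<le> 0"
  have "?L x y \<or> ?L y x"
  proof (cases "snd x = m")
    case m: True
    then have mem: "fst x \<in> set cs" "fst y \<in> set cs"
      using x y True cs by (auto simp: colored_roots_def coxeter_word_def)
    then obtain i j where ij: "i < length cs" "j < length cs" "cs ! i = fst x" "cs ! j = fst y"
      by (metis in_set_conv_nth)
    moreover have "i \<noteq> j" using ij y True by (metis prod_eqI)
    ultimately have "before cs (fst x) (fst y) \<or> before cs (fst y) (fst x)"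
      using before_nth by (metis linorder_neqE_nat)
    then show ?thesis using simple_euler_order[OF cs] m True by (auto simp: position_root_def)
  next
    case m: False
    then have b: "fst x \<in> pos" "fst y \<in> pos" using x y True by (auto simp: colored_roots_def)
    then have "\<Delta> \<noteq> {}" using root_in_span[of "fst x"] pos_root root_nonzero by fastforce
    then have "cs \<noteq> []" using cs by (auto simp: coxeter_word_def)
    note set = set_inversions_sorting_list[OF cs this] and order = sorting_list_euler[OF cs this]
    have "fst x \<in> set (inversions (sorting_list cs))" "fst y \<in> set (inversions (sorting_list cs))"
      using b set by simp_all
    then obtain i j where ij: "i < length (sorting_list cs)" "j < length (sorting_list cs)"
      "inversions (sorting_list cs) ! i = fst x" "inversions (sorting_list cs) ! j = fst y"
      by (metis in_set_conv_nth length_inversions)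
    moreover have "i \<noteq> j" using ij y True by (metis prod_eqI)
    ultimately show ?thesis
      using order[of i j] order[of j i] m True euler_act[OF cs] b[THEN pos_root]
      by (auto simp: position_root_def neq_iff)
  qed
  moreover have "precedes (act cs) m x y" if "?L x y"
    using euler_less[OF cs, of "?t x" "?t y"] that inner True position_root_root[OF cs] x y
    by (simp add: precedes_def)
  moreover have "precedes (act cs) m y x" if "?L y x"
    using euler_less[OF cs, of "?t y" "?t x"] that inner True position_root_root[OF cs] x y
    by (simp add: precedes_def inner_commute)
  ultimately show ?thesis by blast
qed

lemma precedes_asym: "precedes c m x y \<Longrightarrow> \<not> precedes c m y x"
  by (auto simp: precedes_def)

lemma not_precedes_if_euler:
  assumes "coxeter_word cs" "snd x = snd y"
    "0 \<le> euler (act cs) (position_root (act cs) m x) (position_root (act cs) m y)"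
    "euler (act cs) (position_root (act cs) m y) (position_root (act cs) m x) \<le> 0"
  shows "\<not> precedes (act cs) m y x"
  using assms by (auto simp: precedes_def)

lemma facet_permute:
  assumes cs: "coxeter_word cs" and xs: "facet (act cs) m xs"
    and ys: "distinct ys" "set ys = set xs" "ordered (act cs) m ys"
  shows "facet (act cs) m ys"
proof -
  have "act (map (position_root (act cs) m) ys) v = act (map (position_root (act cs) m) xs) v" for v
    using xs ys precedes_total[OF cs] unfolding facet_def
    by (intro act_sorted_permutation[of "\<lambda>x y. \<not> precedes (act cs) m y x"]) blast+
  moreover have "length ys = length xs" using xs ys unfolding facet_def by (metis distinct_card)
  ultimately show ?thesis using xs ys by (simp add: facet_def)
qed

section \<open>The labels along \<open>c w_o^m(c)\<close>\<close>

definition labels_upto :: "'v list \<Rightarrow> nat \<Rightarrow> nat \<Rightarrow> ('v \<times> nat) list" where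
  "labels_upto cs m k = map (\<lambda>q. (q, m)) cs @
     concat (map (\<lambda>j. map (\<lambda>b. (b, j)) (inversions (sorting_list cs))) [0..<k])"

abbreviation labels where
  "labels cs m \<equiv> labels_upto cs m m"

lemma sorted_simple_labels:
  assumes cs: "coxeter_word cs"
  shows "ordered (act cs) m (map (\<lambda>q. (q, m)) cs)"
  unfolding sorted_wrt_map unfolding sorted_wrt_iff_nth_less
proof (intro allI impI)
  fix i j assume "i < j" "j < length cs"
  from simple_euler_order[OF cs before_nth[OF this]]
  show "\<not> precedes (act cs) m (cs ! j, m) (cs ! i, m)"
    by (intro not_precedes_if_euler[OF cs]) (simp_all add: position_root_def)
qed

lemma labels_upto:
  assumes cs: "coxeter_word cs" "cs \<noteq> []"
  shows "k \<le> m \<Longrightarrow> distinct (labels_upto cs m k) \<and>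
    set (labels_upto cs m k) = pos \<times> {..<k} \<union> \<Delta> \<times> {m} \<and>
    ordered (act cs) m (labels_upto cs m k)"
proof (induction k)
  case 0
  then show ?case
    using sorted_simple_labels[OF cs(1)] cs
    by (auto simp: labels_upto_def coxeter_word_def distinct_map inj_on_def)
next
  case (Suc k)
  let ?B = "map (\<lambda>b. (b, k)) (inversions (sorting_list cs))"
  let ?A = "labels_upto cs m k"
  have B: "set ?B = pos \<times> {k}" "distinct ?B"
    using set_inversions_sorting_list[OF cs] distinct_inversions_sorting_list[OF cs]
    by (auto simp: distinct_map inj_on_def)
  have A: "distinct ?A" "set ?A = pos \<times> {..<k} \<union> \<Delta> \<times> {m}"
    "ordered (act cs) m ?A" using Suc by auto
  have "ordered (act cs) m ?B"
    unfolding sorted_wrt_map unfolding sorted_wrt_iff_nth_less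
  proof (intro allI impI)
    fix i j assume ij: "i < j" "j < length (inversions (sorting_list cs))"
    let ?b = "\<lambda>i. inversions (sorting_list cs) ! i"
    have "?b i \<in> \<Phi>" "?b j \<in> \<Phi>"
      using ij set_inversions_sorting_list[OF cs] pos_root nth_mem[of _ "inversions (sorting_list cs)"]
      by (metis less_trans)+
    then show "\<not> precedes (act cs) m (?b j, k) (?b i, k)"
      using sorting_list_euler[OF cs ij(1)] ij Suc.prems euler_act[OF cs(1)]
      by (intro not_precedes_if_euler[OF cs(1)]) (simp_all add: position_root_def)
  qed
  moreover have "\<not> precedes (act cs) m y x" if "x \<in> set ?A" "y \<in> set ?B" for x y
    using that Suc.prems unfolding A B by (auto simp: precedes_def level_def)
  ultimately have "ordered (act cs) m (?A @ ?B)"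
    unfolding sorted_wrt_append using A by blast
  moreover have "distinct (?A @ ?B)" using A B Suc.prems by (simp only: distinct_append) auto
  moreover have "set (?A @ ?B) = pos \<times> {..<Suc k} \<union> \<Delta> \<times> {m}"
    using A(2) B(1) by (simp only: set_append) (auto simp: lessThan_Suc)
  moreover have "labels_upto cs m (Suc k) = ?A @ ?B" by (simp add: labels_upto_def)
  ultimately show ?case by simp
qed

lemma
  assumes "coxeter_word cs" "cs \<noteq> []"
  shows distinct_labels: "distinct (labels cs m)"
    and set_labels: "set (labels cs m) = colored_roots m"
    and sorted_labels: "ordered (act cs) m (labels cs m)"
  using labels_upto[OF assms order_refl, of m] by (simp_all add: colored_roots_def)

text \<open>Filtering the label list by a facet lists its elements in an admissible order, so
  \<open>facet_permute\<close> lets every facet be read off from a set of positions.\<close>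

lemma face_iff_labels:
  assumes cs: "coxeter_word cs" "cs \<noteq> []"
  shows "face (act cs) m X \<longleftrightarrow>
    (\<exists>I. length (nths (labels cs m) I) = card \<Delta> \<and> X \<subseteq> set (nths (labels cs m) I) \<and>
      (\<forall>v. act (map (position_root (act cs) m) (nths (labels cs m) I)) (act cs v) = v))"
    (is "_ \<longleftrightarrow> (\<exists>I. ?F I)")
proof
  let ?t = "position_root (act cs) m"
  assume "face (act cs) m X"
  then obtain xs where xs: "facet (act cs) m xs" "X \<subseteq> set xs" by (auto simp: face_def)
  let ?ys = "filter (\<lambda>x. x \<in> set xs) (labels cs m)"
  have ys: "distinct ?ys" "set ?ys = set xs" "ordered (act cs) m ?ys"
    using distinct_labels[OF cs] set_labels[OF cs] sorted_labels[OF cs] xs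
    by (auto simp: facet_def sorted_wrt_filter)
  then have "facet (act cs) m ?ys" using facet_permute cs(1) xs(1) by blast
  then have "length ?ys = card \<Delta> \<and> X \<subseteq> set ?ys \<and>
      (\<forall>v. act (map ?t ?ys) (act cs v) = v)"
    using xs(2) ys(2) unfolding facet_def by blast
  then show "\<exists>I. ?F I" unfolding filter_eq_nths by (rule exI)
next
  assume "\<exists>I. ?F I"
  then obtain I where I: "?F I" by blast
  have "ordered (act cs) m (nths (labels cs m) I)"
    using sorted_labels[OF cs] by (rule sorted_wrt_nths)
  moreover have "set (nths (labels cs m) I) \<subseteq> colored_roots m"
    using set_labels[OF cs] set_nths_subset[of "labels cs m" I] by simp
  moreover have "distinct (nths (labels cs m) I)" using distinct_labels[OF cs] by simp
  ultimately show "face (act cs) m X"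
    using I unfolding face_def facet_def by blast
qed

text \<open>Deletes the prefix \<open>c\<close>; the remaining word is \<open>w_o^m(c)\<close>
  itself.\<close>

lemma facet_simple:
  assumes cs: "coxeter_word cs"
  shows "facet (act cs) m (map (\<lambda>q. (q, m)) cs)"
proof -
  let ?xs = "map (\<lambda>q. (q, m)) cs"
  have "map (position_root (act cs) m) ?xs = nths (inversions cs) UNIV"
    by (simp add: inversions_coxeter_word[OF cs] position_root_def nths_all o_def)
  then have "act (map (position_root (act cs) m) ?xs) (act cs v) = v" for v
    using act_nths_compl[of cs UNIV v] by simp
  then show ?thesis
    using sorted_simple_labels[OF cs] cs distinct_card[of cs]
    by (auto simp: facet_def coxeter_word_def distinct_map inj_on_def colored_roots_def)
qed

end

section \<open>Rotation\<close>

lemma act_map_Cons: "act (map g (x # xs)) v = reflection (g x) (act (map g xs) v)"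
  by simp

lemma act_map_snoc: "act (map g (xs @ [x])) v = act (map g xs) (reflection (g x) v)"
  by simp

definition rotate_root :: "nat \<Rightarrow> 'v::euclidean_space \<Rightarrow> 'v \<times> nat \<Rightarrow> 'v \<times> nat" where
  "rotate_root m s x =
     (if fst x = s then (s, if snd x = 0 then m else snd x - 1)
      else if snd x = m then x else (reflection s (fst x), snd x))"

context simple_root_system
begin

text \<open>For a root that wins every tie inside its color the Euler form drops out of the order:
  only blocks are compared, weakly in one direction and strictly in the other.\<close>

lemma precedes_iff_level:
  fixes x y :: "'v \<times> nat"
  assumes "snd x = snd y \<Longrightarrow> nonorthogonal c m x y \<Longrightarrow> precedes c m x y"
  shows "precedes c m x y \<longleftrightarrow>
      nonorthogonal c m x y \<and> level m (snd x) \<le> level m (snd y)" (is ?A)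
    and "precedes c m y x \<longleftrightarrow>
      nonorthogonal c m x y \<and> level m (snd y) < level m (snd x)" (is ?B)
proof -
  have i: "precedes c m x y \<Longrightarrow> nonorthogonal c m x y"
    "precedes c m y x \<Longrightarrow> nonorthogonal c m x y"
    by (simp_all add: precedes_def inner_commute)
  have "?A \<and> ?B"
  proof (cases "snd x = snd y")
    case True
    then show ?thesis using assms i precedes_asym[of c m x y] by (metis less_irrefl order_refl)
  next
    case False
    then have "level m (snd x) \<noteq> level m (snd y)" by (auto simp: level_def)
    then show ?thesis using False by (simp add: precedes_def inner_commute le_less)
  qed
  then show ?A ?B by blast+
qed

lemma coxeter_word_rotate: "coxeter_word (s # ws) \<Longrightarrow> coxeter_word (ws @ [s])"
  by (auto simp: coxeter_word_def)

context
  fixes s ws and m :: nat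
  assumes cs: "coxeter_word (s # ws)" and m: "0 < m"
  notes foldr.simps [simp del] and foldr_append [simp del]
begin

private abbreviation "c \<equiv> act (s # ws)"
private abbreviation "c' \<equiv> act (ws @ [s])"

private abbreviation "rot \<equiv> rotate_root m s"
private abbreviation "pr \<equiv> position_root c m"
private abbreviation "pr' \<equiv> position_root c' m"

private abbreviation "croots \<equiv> colored_roots m"

private lemma cs': "coxeter_word (ws @ [s])"
  using cs by (rule coxeter_word_rotate)

private lemma act_c: "c v = reflection s (act ws v)"
  by (simp add: foldr.simps)

private lemma act_c': "c' v = act ws (reflection s v)"
  by (simp add: foldr.simps foldr_append)

private lemma s: "s \<in> \<Delta>" and ws: "set ws \<subseteq> \<Delta> - {s}"
  using cs by (auto simp: coxeter_word_def)

private lemma refl_s: "reflection s s = - s"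
  using reflection_self simple_nonzero s by blast

private lemma proj_root_s: "proj_root c s = s"
  using proj_root_eq[of "[]" s ws] cs by (simp add: foldr.simps(1))

private lemma proj_root_s': "proj_root c' s = act ws s"
  using proj_root_eq[of ws s "[]"] cs' by simp

private lemma proj_root_rotate: "q \<in> \<Delta> \<Longrightarrow> q \<noteq> s \<Longrightarrow> proj_root c' q = reflection s (proj_root c q)"
  using weight_other[of q s] s
  by (simp add: proj_root_def linear_diff[OF linear_reflection] reflection_fix act_c act_c')

text \<open>If \<open>u\<close> is a preimage of \<open>a\<close> under \<open>1 - c\<close>, then
  \<open>s u\<close> is a preimage of \<open>s a\<close> under \<open>1 - scs\<close>.\<close>

lemma euler_rotate:
  assumes "a \<in> \<Phi>" "b \<in> \<Phi>"
  shows "euler c' (reflection s a) (reflection s b) = euler c a b"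
proof -
  obtain u where u: "a = u - c u" using coxeter_primitive[OF cs] assms by blast
  then have "reflection s a = reflection s u - c' (reflection s u)"
    by (simp add: linear_diff[OF linear_reflection] act_c act_c')
  moreover have "reflection s b \<in> span \<Delta>"
    using assms reflection_root simple_root s root_in_span by blast
  ultimately show ?thesis
    using euler_eq[OF cs'] euler_eq[OF cs] u root_in_span[OF assms(2)]
    by (metis inner_reflection)
qed

lemma rotate_root_in: "x \<in> croots \<Longrightarrow> rot x \<in> croots"
  using reflection_pos[OF s] s m simple_pos[OF s]
  by (auto simp: colored_roots_def rotate_root_def)

private lemma inj_rotate_root: "inj_on (rot) (croots)"
proof (rule inj_onI)
  fix x y assume xy: "x \<in> croots" "y \<in> croots" "rot x = rot y"
  have ne: "reflection s a \<noteq> s" if "a \<in> pos" for a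
  proof
    assume "reflection s a = s"
    then have "a = - s" using refl_s by (metis reflection_reflection)
    then show False using that uminus_pos simple_pos s by blast
  qed
  moreover have "a \<in> pos \<Longrightarrow> s \<noteq> reflection s a" for a using ne by metis
  moreover have "reflection s a = reflection s b \<Longrightarrow> a = b" for a b
    by (metis reflection_reflection)
  moreover have "snd x \<le> m" "snd y \<le> m" "snd x \<noteq> m \<Longrightarrow> fst x \<in> pos" "snd y \<noteq> m \<Longrightarrow> fst y \<in> pos"
    using xy by (auto simp: colored_roots_def)
  ultimately show "x = y"
    using xy(3) m unfolding rotate_root_def
    by (cases x; cases y) (auto split: if_splits)
qed

private lemma rotate_root_image: "rot ` croots = croots"
  using rotate_root_in inj_rotate_root finite_colored_roots by (intro endo_inj_surj) auto

lemma rotate_root_eq_iff: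
  "x \<in> croots \<Longrightarrow> y \<in> croots \<Longrightarrow> rot x = rot y \<longleftrightarrow> x = y"
  using inj_rotate_root by (auto dest: inj_onD)

private lemma c'_reflection: "c' (reflection s v) = reflection s (c v)"
  by (simp add: act_c act_c')

private lemma position_root_rotate_other:
  "x \<in> croots \<Longrightarrow> fst x \<noteq> s \<Longrightarrow>
    pr' (rot x) = reflection s (pr x)"
  using proj_root_rotate[of "fst x"] c'_reflection[of "fst x"]
  by (auto simp: position_root_def rotate_root_def colored_roots_def)

text \<open>The two signs reflect \<open>c' s = - proj_root c' s\<close>: for \<open>k = 0\<close>
  the new color is \<open>m\<close>, where \<open>position_root\<close> switches its
  formula.\<close>

private lemma position_root_rotate_same:
  "k < m \<Longrightarrow> pr' (rot (s, k)) = reflection s (c s) \<or>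
    pr' (rot (s, k)) = - reflection s (c s)"
  using proj_root_s' refl_s
  by (auto simp: position_root_def rotate_root_def act_minus act_c act_c')

text \<open>\<open>(s, m)\<close> is excluded because it travels from one end of the order to the
  other, and its reflection turns from that of \<open>s\<close> into that of
  \<open>c' s\<close>.\<close>

private lemma position_root_rotate:
  assumes "x \<in> croots" "x \<noteq> (s, m)"
  shows "pr' (rot x) = reflection s (pr x) \<or>
    pr' (rot x) = - reflection s (pr x)"
proof (cases "fst x = s")
  case True
  then have "snd x < m" "x = (s, snd x)" using assms by (auto simp: colored_roots_def)
  then show ?thesis
    using position_root_rotate_same[of "snd x"] by (metis position_root_def fst_conv snd_conv less_irrefl)
qed (use position_root_rotate_other assms in blast)

private lemma inner_position_root_rotate:
  assumes "x \<in> croots" "x \<noteq> (s, m)" "y \<in> croots" "y \<noteq> (s, m)"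
  shows "inner (pr' (rot x)) (pr' (rot y)) = 0 \<longleftrightarrow>
    inner (pr x) (pr y) = 0"
  using position_root_rotate[OF assms(1,2)] position_root_rotate[OF assms(3,4)]
  by (auto simp: inner_reflection)

text \<open>All letters but the first fix the weight of \<open>s\<close>. So \<open>E(s, b)\<close>
  is its pairing with \<open>b\<close>, and \<open>E(b, s)\<close> is minus its pairing with
  \<open>s b\<close>; both \<open>b\<close> and \<open>s b\<close> are positive.\<close>

private lemma initial_precedes:
  assumes y: "y \<in> croots" "y \<noteq> (s, snd y)"
    and inner: "nonorthogonal c m (s, snd y) y"
  shows "precedes c m (s, snd y) y"
proof -
  have sy: "(s, snd y) \<in> croots"
    using y s simple_pos by (auto simp: colored_roots_def)
  have "\<not> precedes c m y (s, snd y)"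
  proof (rule not_precedes_if_euler[OF cs])
    let ?E = "\<lambda>x y. 0 \<le> euler c (pr x) (pr y) \<and>
        euler c (pr y) (pr x) \<le> 0"
    have "?E (s, snd y) y"
    proof (cases "snd y = m")
      case True
      then have "fst y \<in> set ws" using y cs by (auto simp: colored_roots_def coxeter_word_def)
      then have "before (s # ws) s (fst y)" unfolding before_def by (metis append_Nil split_list)
      then show ?thesis using simple_euler_order[OF cs] True by (auto simp: position_root_def)
    next
      case False
      then have b: "fst y \<in> pos" "fst y \<noteq> s" using y by (auto simp: colored_roots_def)
      let ?b = "fst y"
      have root: "?b \<in> \<Phi>" "s \<in> \<Phi>" "act (rev (s # ws)) ?b \<in> \<Phi>"
        using b pos_root s simple_root act_root_simple[of "rev (s # ws)" ?b] ws by auto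
      have "euler c s ?b = inner (weight s) ?b"
        using euler_proj_root[OF cs root(1), of s] proj_root_s by simp
      moreover have "euler c ?b s = - inner (weight s) (act (rev (s # ws)) ?b)"
        using euler_act_left[OF cs root(3,2)] euler_proj_root[OF cs root(3), of s] proj_root_s
        by (simp only: act_act_rev minus_minus)
      moreover have "inner (weight s) (act (rev (s # ws)) ?b) = inner (weight s) (reflection s ?b)"
        using weight_act[of s "rev ws"] s ws by (simp add: foldr.simps foldr_append)
      ultimately show ?thesis
        using pos_weight[of ?b s] pos_weight[of "reflection s ?b" s] reflection_pos[OF s b] b s False
          euler_act[OF cs root(1,2)] euler_act[OF cs root(2,1)]
        by (simp add: position_root_def)
    qed
    then show "0 \<le> euler c (pr (s, snd y)) (pr y)" "euler c (pr y) (pr (s, snd y)) \<le> 0"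
      by simp_all
  qed simp
  then show ?thesis using precedes_total[OF cs sy y(1)] y(2) inner by auto
qed

text \<open>The mirror image of \<open>initial_precedes\<close>, through
  \<open>c' s = - proj_root c' s\<close>: now \<open>E(b, s)\<close> is the pairing of the weight of
  \<open>s\<close> with \<open>b\<close>, and \<open>E(s, b)\<close> is minus its pairing with
  \<open>s b\<close>.\<close>

private lemma final_precedes:
  assumes y: "y \<in> croots" "y \<noteq> (s, snd y)"
    and inner: "nonorthogonal c' m y (s, snd y)"
  shows "precedes c' m y (s, snd y)"
proof -
  have sy: "(s, snd y) \<in> croots"
    using y s simple_pos by (auto simp: colored_roots_def)
  have "\<not> precedes c' m (s, snd y) y"
  proof (rule not_precedes_if_euler[OF cs'])
    let ?E = "\<lambda>x y. 0 \<le> euler c' (pr' x) (pr' y) \<and>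
        euler c' (pr' y) (pr' x) \<le> 0"
    have "?E y (s, snd y)"
    proof (cases "snd y = m")
      case True
      then have "fst y \<in> set ws" using y cs by (auto simp: colored_roots_def coxeter_word_def)
      then have "before (ws @ [s]) (fst y) s" unfolding before_def
        by (metis append.assoc append_Cons split_list)
      then show ?thesis using simple_euler_order[OF cs'] True by (auto simp: position_root_def)
    next
      case False
      then have b: "fst y \<in> pos" "fst y \<noteq> s" using y by (auto simp: colored_roots_def)
      let ?b = "fst y"
      have root: "?b \<in> \<Phi>" "s \<in> \<Phi>" "c' ?b \<in> \<Phi>" "c' s \<in> \<Phi>"
        using b pos_root s simple_root act_root_simple[of "ws @ [s]" ?b] act_root_simple[of "ws @ [s]" s] ws
          by auto
      have c's: "c' s = - proj_root c' s" using proj_root_s' refl_s by (simp add: act_minus act_c')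
      have "euler c' ?b s = inner (weight s) ?b"
        using euler_act_left[OF cs' root(2,1)] euler_proj_root[OF cs' root(1), of s] c's
          euler_minus_left[OF cs' neg_root[OF root(4)] root(1)] euler_minus_left[OF cs' root(4) root(1)]
        by simp
      moreover have "euler c' s ?b = - inner (weight s) (c' ?b)"
        using euler_act[OF cs' root(2,1)] euler_proj_root[OF cs' root(3), of s] c's
          euler_minus_left[OF cs' root(4) root(3)]
        by simp
      moreover have "inner (weight s) (c' ?b) = inner (weight s) (reflection s ?b)"
        using weight_act[of s ws] s ws by (simp add: act_c')
      ultimately show ?thesis
        using pos_weight[of ?b s] pos_weight[of "reflection s ?b" s] reflection_pos[OF s b] b s False
          euler_act[OF cs' root(1,2)] euler_act[OF cs' root(2,1)]
        by (simp add: position_root_def)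
    qed
    then show "0 \<le> euler c' (pr' y) (pr' (s, snd y))"
      "euler c' (pr' (s, snd y)) (pr' y) \<le> 0" by simp_all
  qed simp
  then show ?thesis using precedes_total[OF cs' y(1) sy] y(2) inner by auto
qed

text \<open>A root \<open>(s, k)\<close> opens block \<open>k + 1\<close> for \<open>c\<close>, and
  its image closes block \<open>k\<close> for \<open>c'\<close>. Against another root in block
  \<open>j\<close>, the conditions \<open>k + 1 \<le> j\<close> and \<open>k < j\<close> say the
  same.\<close>

private lemma precedes_rotate:
  assumes x: "x \<in> croots" "x \<noteq> (s, m)" and y: "y \<in> croots" "y \<noteq> (s, m)" and "x \<noteq> y"
  shows "precedes c' m (rot x) (rot y) \<longleftrightarrow> precedes c m x y"
proof -
  let ?i = "nonorthogonal c m x y"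
  have i': "nonorthogonal c' m (rot x) (rot y) \<longleftrightarrow> ?i"
    using inner_position_root_rotate x y by blast
  \<comment> \<open>For \<open>snd x = 0\<close> the new color is \<open>m\<close>, of level 0, so
    the level drops by one without exception.\<close>
  have level_same: "level m (snd x) = Suc (snd x) \<and> level m (snd (rot x)) = snd x"
    if "x \<in> croots" "x \<noteq> (s, m)" "fst x = s" for x
    using that by (cases x) (auto simp: colored_roots_def level_def rotate_root_def)
  have level_other: "snd (rot x) = snd x" if "fst x \<noteq> s" for x
    using that by (simp add: rotate_root_def)
  have first:
      "precedes c m x y \<longleftrightarrow> nonorthogonal c m x y \<and> Suc (snd x) \<le> level m (snd y)" (is ?A)
      "precedes c m y x \<longleftrightarrow> nonorthogonal c m x y \<and> level m (snd y) < Suc (snd x)" (is ?B)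
    if x: "x \<in> croots" "x \<noteq> (s, m)" "fst x = s" and y: "y \<in> croots" "fst y \<noteq> s" for x y
  proof -
    have *: "precedes c m x y" if "snd x = snd y" "nonorthogonal c m x y"
      using initial_precedes[OF y(1)] y(2) x that by (metis fst_conv prod.collapse)
    show ?A ?B using precedes_iff_level[OF *] level_same[OF x] by simp_all
  qed
  have last:
      "precedes c' m x y \<longleftrightarrow> nonorthogonal c' m x y \<and> level m (snd x) < level m (snd y)" (is ?A)
      "precedes c' m y x \<longleftrightarrow> nonorthogonal c' m x y \<and> level m (snd y) \<le> level m (snd x)" (is ?B)
    if x: "x \<in> croots" "fst x = s" and y: "y \<in> croots" "fst y \<noteq> s" for x y
  proof -
    have *: "precedes c' m y x" if "snd y = snd x" "nonorthogonal c' m y x"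
      using final_precedes[OF y(1)] y(2) x that by (metis fst_conv prod.collapse)
    show ?A ?B using precedes_iff_level[OF *] by (simp_all add: inner_commute)
  qed
  have other: "fst (rot x) \<noteq> s" if "x \<in> croots" "fst x \<noteq> s" for x
  proof -
    have "reflection s (fst x) \<noteq> s" if "snd x \<noteq> m"
    proof
      assume "reflection s (fst x) = s"
      then have "fst x = - s" using refl_s by (metis reflection_reflection)
      then show False using \<open>x \<in> croots\<close> that uminus_pos simple_pos s
        by (auto simp: colored_roots_def)
    qed
    then show ?thesis using that by (auto simp: rotate_root_def)
  qed
  have same: "fst (rot x) = s" if "fst x = s" for x
    using that by (simp add: rotate_root_def)
  consider "fst x = s" "fst y = s" | "fst x = s" "fst y \<noteq> s" | "fst x \<noteq> s" "fst y = s"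
    | "fst x \<noteq> s" "fst y \<noteq> s" by blast
  then show ?thesis
  proof cases
    case 1
    then have "snd x \<noteq> snd y" using \<open>x \<noteq> y\<close> by (simp add: prod_eq_iff)
    moreover have "snd (rot x) \<noteq> snd (rot y)"
      using same 1 rotate_root_eq_iff x y \<open>x \<noteq> y\<close> by (metis prod_eqI)
    ultimately show ?thesis
      using level_same[OF x 1(1)] level_same[OF y 1(2)] i' by (simp add: precedes_def)
  next
    case 2
    have "precedes c' m (rot x) (rot y) \<longleftrightarrow> ?i \<and> snd x < level m (snd y)"
      using last(1)[OF rotate_root_in[OF x(1)] same[OF 2(1)] rotate_root_in[OF y(1)] other[OF y(1) 2(2)]]
        i' level_same[OF x 2(1)] level_other[OF 2(2)] by simp
    then show ?thesis using first(1)[OF x 2(1) y(1) 2(2)] by auto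
  next
    case 3
    have "precedes c' m (rot x) (rot y) \<longleftrightarrow> ?i \<and> level m (snd x) \<le> snd y"
      using last(2)[OF rotate_root_in[OF y(1)] same[OF 3(2)] rotate_root_in[OF x(1)] other[OF x(1) 3(1)]]
        i' level_same[OF y 3(2)] level_other[OF 3(1)] by (simp add: inner_commute)
    then show ?thesis using first(2)[OF y 3(2) x(1) 3(1)] by (auto simp: inner_commute)
  next
    case 4
    then show ?thesis
      using i' level_other position_root_rotate_other[OF x(1)] position_root_rotate_other[OF y(1)]
        euler_rotate position_root_root[OF cs] x(1) y(1)
      by (simp add: precedes_def)
  qed
qed

private lemma act_position_roots_rotate:
  assumes "set xs \<subseteq> croots - {(s, m)}"
  shows "act (map (pr') (map (rot) xs)) v =
    reflection s (act (map (pr) xs) (reflection s v))"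
  using assms
proof (induction xs)
  case (Cons x xs)
  then have "reflection (pr' (rot x)) = reflection (reflection s (pr x))"
    using position_root_rotate[of x] reflection_minus_root by auto
  then show ?case
    using Cons
    by (simp add: list.map(2)[of "rot"] act_map_Cons reflection_refl_refl del: list.map)
qed (simp add: foldr.simps)

private lemma sorted_rotate:
  assumes "set xs \<subseteq> croots - {(s, m)}" "distinct xs"
  shows "ordered c' m (map (rot) xs) \<longleftrightarrow>
    ordered c m xs"
  using assms
proof (induction xs)
  case (Cons x xs)
  have "precedes c' m (rot y) (rot x) \<longleftrightarrow> precedes c m y x" if "y \<in> set xs" for y
    using precedes_rotate[of y x] Cons.prems that by auto
  then show ?case using Cons by auto
qed simp

private lemma rotate_list:
  assumes "set xs \<subseteq> croots"
  shows "distinct (map (rot) xs) \<longleftrightarrow> distinct xs"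
    and "set (map (rot) xs) \<subseteq> croots"
  using assms inj_on_subset[OF inj_rotate_root assms] rotate_root_in by (auto simp: distinct_map)

private lemma facet_rotate_other:
  assumes xs: "set xs \<subseteq> croots - {(s, m)}"
  shows "facet c' m (map (rot) xs) \<longleftrightarrow> facet c m xs"
proof -
  have sub: "set xs \<subseteq> croots" using xs by auto
  have "reflection s (act (map (pr) xs) (reflection s (c' v))) = v \<longleftrightarrow>
      act (map (pr) xs) (c (reflection s v)) = reflection s v" for v
  proof -
    have "reflection s (c' v) = c (reflection s v)" by (simp add: act_c act_c')
    then show ?thesis by (metis reflection_reflection)
  qed
  then have "(\<forall>v. reflection s (act (map (pr) xs) (reflection s (c' v))) = v) \<longleftrightarrow>
      (\<forall>v. act (map (pr) xs) (c v) = v)"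
    by (metis reflection_reflection)
  then show ?thesis
    unfolding facet_def act_position_roots_rotate[OF xs]
    using sorted_rotate[OF xs] rotate_list[OF sub] sub by (metis length_map)
qed

lemma initial_first: "x \<in> croots \<Longrightarrow> x \<noteq> (s, m) \<Longrightarrow> \<not> precedes c m x (s, m)"
proof (cases "snd x = m")
  case True
  assume x: "x \<in> croots" "x \<noteq> (s, m)"
  show ?thesis
  proof
    assume p: "precedes c m x (s, m)"
    then have "nonorthogonal c m (s, m) x"
      by (auto simp: precedes_def inner_commute)
    then show False using initial_precedes[of x] x True p precedes_asym by metis
  qed
qed (simp add: precedes_def level_def)

private lemma final_last: "x \<in> croots \<Longrightarrow> x \<noteq> (s, m - 1) \<Longrightarrow> \<not> precedes c' m (s, m - 1) x"
proof (cases "snd x = m - 1")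
  case True
  assume x: "x \<in> croots" "x \<noteq> (s, m - 1)"
  show ?thesis
  proof
    assume p: "precedes c' m (s, m - 1) x"
    then have "nonorthogonal c' m x (s, m - 1)"
      by (auto simp: precedes_def inner_commute)
    then show False using final_precedes[of x] x True p precedes_asym by metis
  qed
next
  case False
  assume x: "x \<in> croots" "x \<noteq> (s, m - 1)"
  have "level m (snd x) \<le> level m (m - 1)" using x m by (auto simp: level_def colored_roots_def)
  then show ?thesis using False by (auto simp: precedes_def)
qed

text \<open>Both products reduce to \<open>s X s\<close> followed by \<open>act ws\<close>, where
  \<open>X\<close> is the product of the other reflections: \<open>reflection (c' s)\<close> applied
  after \<open>c'\<close> cancels the letter \<open>s\<close> of \<open>c'\<close>.\<close>

private lemma facet_rotate_initial:
  assumes xs: "set xs \<subseteq> croots - {(s, m)}"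
  shows "facet c' m (map (rot) xs @ [(s, m - 1)]) \<longleftrightarrow> facet c m ((s, m) # xs)"
proof -
  have sub: "set xs \<subseteq> croots" using xs by auto
  have sm: "(s, m) \<in> croots" "(s, m - 1) \<in> croots"
    using s m simple_pos by (auto simp: colored_roots_def)
  have rot: "rot (s, m) = (s, m - 1)" using m by (simp add: rotate_root_def)
  have ne: "x \<in> set xs \<Longrightarrow> rot x \<noteq> (s, m - 1)" for x
    using rotate_root_eq_iff[of x "(s, m)"] sm xs rot by auto
  have "reflection (c' s) (c' v) = act ws v" for v
    by (simp only: reflection_act_act) (simp add: act_c')
  moreover have "pr' (s, m - 1) = c' s" "pr (s, m) = s"
    using m proj_root_s by (auto simp: position_root_def)
  ultimately have "act (map (pr') (map (rot) xs @ [(s, m - 1)])) (c' v) =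
      act (map (pr) ((s, m) # xs)) (c v)" for v
    using act_position_roots_rotate[OF xs, of "act ws v"]
    by (simp only: act_map_Cons act_map_snoc act_c)
  moreover have "\<not> precedes c' m (s, m - 1) (rot x)" if "x \<in> set xs" for x
    using final_last[OF rotate_root_in[of x]] ne[OF that] sub that by auto
  then have "ordered c' m (map (rot) xs @ [(s, m - 1)]) \<longleftrightarrow>
      ordered c' m (map (rot) xs)"
    by (simp add: sorted_wrt_append)
  moreover have "ordered c m ((s, m) # xs) \<longleftrightarrow>
      ordered c m xs"
    using initial_first xs by auto
  moreover have "distinct (map (rot) xs @ [(s, m - 1)]) \<longleftrightarrow> distinct ((s, m) # xs)"
  proof -
    have "(s, m - 1) \<notin> set (map (rot) xs)" using ne by (metis (no_types) image_iff image_set)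
    moreover have "(s, m) \<notin> set xs" using xs by blast
    ultimately show ?thesis using rotate_list(1)[OF sub] by simp
  qed
  moreover have "distinct ((s, m) # xs) \<Longrightarrow> distinct xs" by simp
  ultimately show ?thesis
    unfolding facet_def using sorted_rotate[OF xs] rotate_list(2)[OF sub] sub sm by auto
qed

lemma face_rotate:
  assumes X: "X \<subseteq> croots"
  shows "face c' m (rot ` X) \<longleftrightarrow> face c m X"
proof
  assume "face c m X"
  then obtain xs where xs: "facet c m xs" "X \<subseteq> set xs" by (auto simp: face_def)
  show "face c' m (rot ` X)"
  proof (cases "(s, m) \<in> set xs")
    case False
    then have "facet c' m (map (rot) xs)"
      using facet_rotate_other[of xs] xs by (auto simp: facet_def)
    then show ?thesis using xs(2) unfolding face_def by (intro exI conjI) auto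
  next
    case True
    let ?ys = "filter (\<lambda>x. x \<noteq> (s, m)) xs"
    have sub: "set ?ys \<subseteq> croots - {(s, m)}" using xs by (auto simp: facet_def)
    \<comment> \<open>Nothing precedes \<open>(s, m)\<close>, so it can be brought to the front of
      any facet containing it.\<close>
    have "facet c m ((s, m) # ?ys)"
    proof (rule facet_permute[OF cs xs(1)])
      show "ordered c m ((s, m) # ?ys)"
        using initial_first sub xs(1) by (auto simp: facet_def sorted_wrt_filter)
    qed (use xs True in \<open>auto simp: facet_def\<close>)
    then have "facet c' m (map (rot) ?ys @ [(s, m - 1)])"
      using facet_rotate_initial[OF sub] by blast
    moreover have "rot ` X \<subseteq> set (map (rot) ?ys @ [(s, m - 1)])"
      using xs(2) m by (auto simp: rotate_root_def)
    ultimately show ?thesis unfolding face_def by blast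
  qed
next
  assume "face c' m (rot ` X)"
  then obtain zs where zs: "facet c' m zs" "rot ` X \<subseteq> set zs" by (auto simp: face_def)
  have sm: "(s, m) \<in> croots" using s by (auto simp: colored_roots_def)
  have rot: "rot (s, m) = (s, m - 1)" using m by (simp add: rotate_root_def)
  have lift: "\<exists>xs. us = map (rot) xs \<and> set xs \<subseteq> croots"
    if "set us \<subseteq> croots" for us
  proof (intro exI conjI)
    let ?g = "inv_into (croots) (rot)"
    have "u \<in> croots \<Longrightarrow> ?g u \<in> croots \<and> rot (?g u) = u" for u
      using rotate_root_image by (metis inv_into_into f_inv_into_f)
    note g = this
    show "us = map (rot) (map ?g us)"
      unfolding map_map using g that by (intro map_idI[symmetric]) auto
    show "set (map ?g us) \<subseteq> croots" using g that by auto
  qed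
  show "face c m X"
  proof (cases "(s, m - 1) \<in> set zs")
    case False
    obtain xs where eq: "zs = map (rot) xs" "set xs \<subseteq> croots"
      using lift[of zs] zs(1) by (auto simp: facet_def)
    then have "(s, m) \<notin> set xs" using False rot by (metis image_eqI image_set)
    then have "facet c m xs" using facet_rotate_other[of xs] zs(1) eq by blast
    moreover have "X \<subseteq> set xs"
    proof
      fix x assume x: "x \<in> X"
      then have "rot x \<in> rot ` set xs" using zs(2) eq(1) by auto
      then show "x \<in> set xs" using rotate_root_eq_iff X x eq(2) by blast
    qed
    ultimately show ?thesis by (auto simp: face_def)
  next
    case True
    let ?us = "filter (\<lambda>x. x \<noteq> (s, m - 1)) zs"
    have "set ?us \<subseteq> croots" using zs(1) by (auto simp: facet_def)
    then obtain xs where eq: "?us = map (rot) xs" "set xs \<subseteq> croots"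
      using lift by blast
    have "(s, m) \<notin> set xs"
    proof
      assume "(s, m) \<in> set xs"
      then have "rot (s, m) \<in> set ?us" unfolding eq(1) set_map by (rule imageI)
      then have "(s, m - 1) \<in> set ?us" unfolding rot .
      then show False by simp
    qed
    then have sub: "set xs \<subseteq> croots - {(s, m)}" using eq by auto
    have "facet c' m (?us @ [(s, m - 1)])"
    proof (rule facet_permute[OF cs' zs(1)])
      show "ordered c' m (?us @ [(s, m - 1)])"
        using final_last zs(1) by (auto simp: facet_def sorted_wrt_append sorted_wrt_filter)
    qed (use zs True in \<open>auto simp: facet_def\<close>)
    then have "facet c m ((s, m) # xs)" using facet_rotate_initial[OF sub] eq by simp
    moreover have "X \<subseteq> set ((s, m) # xs)"
    proof
      fix x assume x: "x \<in> X"
      show "x \<in> set ((s, m) # xs)"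
      proof (cases "rot x = (s, m - 1)")
        case True
        then have "x = (s, m)" using rotate_root_eq_iff[of x "(s, m)"] rot sm X x by auto
        then show ?thesis by simp
      next
        case False
        then have "rot x \<in> set ?us" using zs(2) x by auto
        then have "rot x \<in> rot ` set xs" unfolding eq(1) by simp
        then have "x \<in> set xs" using rotate_root_eq_iff X x eq(2) by blast
        then show ?thesis by simp
      qed
    qed
    ultimately show ?thesis unfolding face_def by blast
  qed
qed

end

text \<open>Rotation through the letters of \<open>c\<close> applies \<open>c\<^sup>-\<^sup>1\<close> to the root, which cannot remain
  positive forever. So the color drops, and eventually it reaches \<open>m\<close>.\<close>

lemma rotation_induct:
  assumes "coxeter_word cs" "x \<in> colored_roots m" "0 < m"
    and simple: "\<And>cs q. coxeter_word cs \<Longrightarrow> q \<in> \<Delta> \<Longrightarrow> P cs (q, m)"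
    and rotate: "\<And>s ws x. coxeter_word (s # ws) \<Longrightarrow> x \<in> colored_roots m \<Longrightarrow>
      P (ws @ [s]) (rotate_root m s x) \<Longrightarrow> P (s # ws) x"
  shows "P cs x"
proof -
  have "P cs (b, k)" if "coxeter_word cs" "b \<in> pos" "k < m" for cs b k
    using that
  proof (induction k arbitrary: cs b rule: less_induct)
    case (less k)
    \<comment> \<open>Rotating through the prefix \<open>vs\<close> either meets the root of a
      letter, where the color drops and the outer induction (or \<open>simple\<close>, from color 0)
      takes over, or ends at \<open>act (rev vs) b\<close> with the color unchanged. The last
      premise covers the second outcome.\<close>
    have letters: "P (vs @ us) (b, k)"
      if "coxeter_word (vs @ us)" "b \<in> pos"
        "act (rev vs) b \<in> pos \<Longrightarrow> P (us @ vs) (act (rev vs) b, k)" for vs us b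
      using that
    proof (induction vs arbitrary: us b)
      case (Cons s vs)
      have cox: "coxeter_word (s # (vs @ us))" using Cons.prems by simp
      have s: "s \<in> \<Delta>" using cox by (auto simp: coxeter_word_def)
      have "P ((vs @ us) @ [s]) (rotate_root m s (b, k))"
      proof (cases "b = s")
        case True
        show ?thesis
        proof (cases "k = 0")
          case True
          then show ?thesis
            using simple[OF coxeter_word_rotate[OF cox] s] \<open>b = s\<close> by (simp add: rotate_root_def)
        next
          case False
          then show ?thesis
            using less.IH[of "k - 1"] coxeter_word_rotate[OF cox] \<open>b = s\<close> simple_pos[OF s] less.prems
            by (simp add: rotate_root_def)
        qed
      next
        case False
        have "P (vs @ (us @ [s])) (reflection s b, k)"
          using Cons.prems coxeter_word_rotate[OF cox] reflection_pos[OF s _ False]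
          by (intro Cons.IH) auto
        then show ?thesis using False less.prems by (simp add: rotate_root_def)
      qed
      then show ?case
        using rotate[OF cox, of "(b, k)"] Cons.prems less.prems by (simp add: colored_roots_def)
    qed simp
    obtain j where "(act (rev cs) ^^ j) b \<notin> pos"
      using coxeter_orbit_not_pos[of "rev cs" b] less.prems by auto
    then show "P cs (b, k)"
      using \<open>b \<in> pos\<close>
    proof (induction j arbitrary: b)
      case (Suc j)
      show ?case
      proof (rule letters[of cs "[]", simplified])
        assume "act (rev cs) b \<in> pos"
        then show "P cs (act (rev cs) b, k)" using Suc by (simp add: funpow_swap1)
      qed (use less.prems Suc in auto)
    qed simp
  qed
  then show ?thesis using assms(1,2) simple by (auto simp: colored_roots_def)
qed

text \<open>Applied to a maximal parabolic subsystem, this supplies the facet that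
  \<open>face_initial_if\<close> extends by \<open>(s, m)\<close>.\<close>

lemma face_singleton:
  assumes "coxeter_word cs" "x \<in> colored_roots m" "0 < m"
  shows "face (act cs) m {x}"
proof (rule rotation_induct[OF assms, of "\<lambda>cs x. face (act cs) m {x}"])
  fix cs q assume cs: "coxeter_word cs" "q \<in> \<Delta>"
  then have "facet (act cs) m (map (\<lambda>q. (q, m)) cs)" "{(q, m)} \<subseteq> set (map (\<lambda>q. (q, m)) cs)"
    using facet_simple by (auto simp: coxeter_word_def)
  then show "face (act cs) m {(q, m)}" unfolding face_def by blast
next
  fix s ws x
  assume *: "coxeter_word (s # ws)" "x \<in> colored_roots m" "face (act (ws @ [s])) m {rotate_root m s x}"
  then show "face (act (s # ws)) m {x}" using face_rotate[OF *(1) assms(3), of "{x}"] by simp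
qed

end

section \<open>The faces through a simple root of color \<open>m\<close>\<close>

lemma act_conjugate: "act (us @ q # rev us) = reflection (act us q)"
  by (simp add: fun_eq_iff reflection_act)

context simple_root_system
begin

lemma ex_coxeter_word: "\<exists>cs. coxeter_word cs"
  unfolding coxeter_word_def using finite_distinct_list[OF finite_simple] by blast

lemma simple_notin_span: "a \<in> \<Delta> \<Longrightarrow> a \<notin> span (\<Delta> - {a})"
  using independent_simple by (auto simp: dependent_def)

lemma weight_span: "a \<in> \<Delta> \<Longrightarrow> x \<in> span (\<Delta> - {a}) \<Longrightarrow> inner (weight a) x = 0"
  by (erule span_induct_alt) (auto simp: inner_add_right weight_other)

lemma parabolic_simple_root_system:
  assumes s: "s \<in> \<Delta>"
  shows "simple_root_system (\<Phi> \<inter> span (\<Delta> - {s})) (\<Delta> - {s})"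
proof
  let ?J = "span (\<Delta> - {s})"
  have refl: "reflection a b \<in> ?J" if "a \<in> ?J" "b \<in> ?J" for a b
    using act_in_span[of "[a]"] that by simp
  show "root_system (\<Phi> \<inter> ?J)"
    unfolding root_system_def
  proof (intro conjI ballI)
    show "finite (\<Phi> \<inter> ?J)" using finite_roots by simp
    show "0 \<notin> \<Phi> \<inter> ?J" using zero_not_root by simp
    fix a assume a: "a \<in> \<Phi> \<inter> ?J"
    have "- a \<in> ?J" using a span_neg by blast
    moreover have "\<Phi> \<inter> span {a} = {a, - a}" using root_system a by (simp add: root_system_def)
    ultimately show "\<Phi> \<inter> ?J \<inter> span {a} = {a, - a}" using a by auto
    have sub: "reflection a ` (\<Phi> \<inter> ?J) \<subseteq> \<Phi> \<inter> ?J" using a refl reflection_root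
      by auto
    show "reflection a ` (\<Phi> \<inter> ?J) = \<Phi> \<inter> ?J"
    proof
      show "\<Phi> \<inter> ?J \<subseteq> reflection a ` (\<Phi> \<inter> ?J)"
        using sub by (metis image_eqI image_subset_iff reflection_reflection subsetI)
    qed (rule sub)
  qed
  show "simple_system (\<Phi> \<inter> ?J) (\<Delta> - {s})"
    unfolding simple_system_def
  proof (intro conjI ballI)
    show "\<Delta> - {s} \<subseteq> \<Phi> \<inter> ?J" using simple_root by (auto intro: span_base)
    show "independent (\<Delta> - {s})" using independent_simple independent_mono by blast
    fix b assume b: "b \<in> \<Phi> \<inter> ?J"
    have *: "x \<in> nonneg_combinations (\<Delta> - {s})" if "x \<in> ?J" "x \<in> nonneg_combinations \<Delta>" for x
    proof -
      have x: "x \<in> span \<Delta>" "\<forall>d\<in>\<Delta>. 0 \<le> inner (weight d) x" using that nonneg_combination_iff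
        by auto
      have "x = (\<Sum>d\<in>\<Delta>. coefficient d x *\<^sub>R d)"
        using span_combination x by blast
      also have "\<dots> = (\<Sum>d\<in>\<Delta> - {s}. coefficient d x *\<^sub>R d)"
        using weight_span[OF s that(1)] by (subst sum.remove[OF finite_simple s]) simp
      finally show ?thesis
        unfolding nonneg_combinations_def using x
        by (intro CollectI exI[of _ "\<lambda>d. coefficient d x"]) auto
    qed
    show "b \<in> nonneg_combinations (\<Delta> - {s}) \<or> - b \<in> nonneg_combinations (\<Delta> - {s})"
      using *[of b] *[of "- b"] b span_neg[of b] simple_system by (auto simp: simple_system_def)
  qed
qed

text \<open>The orbits of a Coxeter element show every root to be an image of a simple root up to
  sign, so its reflection is conjugate to a letter.\<close>

lemma reflection_in_words:
  assumes "b \<in> \<Phi>"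
  shows "\<exists>ws. set ws \<subseteq> \<Delta> \<and> act ws = reflection b"
proof -
  have *: "\<exists>ws. set ws \<subseteq> \<Delta> \<and> act ws = reflection b" if b: "b \<in> pos" for b
  proof -
    obtain cs where cs: "coxeter_word cs" using ex_coxeter_word by blast
    obtain q k where q: "q \<in> \<Delta>" "b = (act cs ^^ k) (proj_root (act cs) q)"
      using pos_orbit[OF cs b] by metis
    obtain xs ys where split: "cs = xs @ q # ys" using coxeter_word_split[OF cs q(1)] by blast
    let ?us = "concat (replicate k cs) @ xs"
    have "b = act ?us q" using q(2) proj_root_eq[of xs q ys] cs split by (simp add: act_pow)
    then have "act (?us @ q # rev ?us) = reflection b" by (simp only: act_conjugate)
    moreover have "set (?us @ q # rev ?us) \<subseteq> \<Delta>"
      using cs split q(1) by (auto simp: coxeter_word_def)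
    ultimately show ?thesis by blast
  qed
  show ?thesis
  proof (cases "b \<in> pos")
    case False
    then have "- b \<in> pos" using not_pos_iff assms by blast
    then show ?thesis using * reflection_minus_root by metis
  qed (use * in blast)
qed

context
  fixes s ws and m :: nat
  assumes cs: "coxeter_word (s # ws)" and m: "0 < m"
  notes foldr.simps [simp del] and foldr_append [simp del]
begin

private abbreviation "d \<equiv> act (s # ws)"

private abbreviation "V \<equiv> span (\<Delta> - {s})"

private lemma act_initial: "d v = reflection s (act ws v)"
  by (simp add: foldr.simps)

private lemma s_simple: "s \<in> \<Delta>" and set_ws: "set ws = \<Delta> - {s}"
  using cs by (auto simp: coxeter_word_def)

interpretation J: simple_root_system "\<Phi> \<inter> V" "\<Delta> - {s}"
  by (rule parabolic_simple_root_system[OF s_simple])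

private lemma coxeter_word_J: "J.coxeter_word ws"
  using cs by (auto simp: coxeter_word_def J.coxeter_word_def)

private lemma proj_root_J: "q \<in> \<Delta> - {s} \<Longrightarrow> proj_root d q = reflection s (J.proj_root (act ws) q)"
proof -
  assume "q \<in> \<Delta> - {s}"
  then obtain xs ys where "ws = xs @ q # ys" using set_ws by (metis split_list)
  then show ?thesis
    using proj_root_eq[of "s # xs" q ys] J.proj_root_eq[of xs q ys] cs coxeter_word_J
    by (simp add: foldr.simps(2)[of reflection s xs])
qed

private lemma pos_J: "J.pos = pos \<inter> V"
proof -
  have "b \<in> J.pos \<longleftrightarrow> b \<in> pos" if b: "b \<in> \<Phi>" "b \<in> V" for b
  proof -
    \<comment> \<open>As vectors \<open>J.weight d\<close> and \<open>weight d\<close> may differ;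
      their pairings with the smaller span agree.\<close>
    have eq: "inner (J.weight d) b = inner (weight d) b" if d: "d \<in> \<Delta> - {s}" for d
    proof -
      have "inner (J.weight d - weight d) a = 0" if "a \<in> \<Delta> - {s}" for a
        using d that by (cases "a = d")
          (auto simp: inner_diff_left J.weight_same weight_same J.weight_other weight_other)
      from J.orthogonal_span_simple[OF this b(2)] show ?thesis by (simp add: inner_diff_left)
    qed
    show ?thesis
      using b J.pos_iff[of b] pos_iff[of b] eq weight_span[OF s_simple b(2)] by force
  qed
  then show ?thesis using pos_root J.pos_root by blast
qed

private lemma colored_roots_J: "J.colored_roots m = {x \<in> colored_roots m. fst x \<in> V}"
  using simple_notin_span[OF s_simple]
  by (auto simp: colored_roots_def J.colored_roots_def pos_J intro: span_base)

private lemma position_root_J: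
  "x \<in> J.colored_roots m \<Longrightarrow>
    position_root d m x = reflection s (J.position_root (act ws) m x)"
proof (cases "snd x = m")
  case True
  assume "x \<in> J.colored_roots m"
  then have "fst x \<in> \<Delta> - {s}" using True by (auto simp: J.colored_roots_def)
  from proj_root_J[OF this] show ?thesis using True by (simp add: position_root_def J.position_root_def)
qed (simp add: position_root_def J.position_root_def act_initial)

text \<open>The two forms invert \<open>1 - act ws\<close> and \<open>1 - s (act ws)\<close>. A
  preimage fixed by \<open>s\<close> serves both.\<close>

private lemma euler_J:
  assumes "a \<in> \<Phi> \<inter> V" "b \<in> \<Phi> \<inter> V"
  shows "euler d (reflection s a) (reflection s b) = euler (act ws) a b"
proof -
  obtain u where u: "a = u - act ws u"
    using J.coxeter_primitive[OF coxeter_word_J assms(1)] by blast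
  \<comment> \<open>\<open>weight s\<close> is fixed by \<open>act ws\<close>, so subtracting a
    multiple of it keeps \<open>u\<close> a preimage of \<open>a\<close>. This multiple makes the
    result orthogonal to \<open>s\<close>.\<close>
  define v where "v = u - (inner u s / inner (weight s) s) *\<^sub>R weight s"
  have w: "inner (weight s) s \<noteq> 0" using weight_simple_pos[OF s_simple] by simp
  have "act ws (weight s) = weight s" using act_weight[OF s_simple] set_ws by auto
  then have a: "a = v - act ws v" using u by (simp add: v_def act_diff act_scaleR)
  have "inner v s = 0" using w by (simp add: v_def inner_diff_left)
  then have vs: "reflection s v = v" by (rule reflection_fix)
  have "euler (act ws) a b = inner v b"
    using J.euler_eq[OF coxeter_word_J] assms a by auto
  moreover have "reflection s a = v - d v"
    using a vs by (simp add: linear_diff[OF linear_reflection] act_initial)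
  moreover have "reflection s b \<in> span \<Delta>"
    using assms reflection_root simple_root s_simple root_in_span by blast
  ultimately have "euler d (reflection s a) (reflection s b) = inner v (reflection s b)"
    using euler_eq[OF cs] by metis
  then show ?thesis
    using \<open>euler (act ws) a b = inner v b\<close> vs by (metis inner_reflection)
qed

private lemma precedes_J:
  assumes "x \<in> J.colored_roots m" "y \<in> J.colored_roots m"
  shows "precedes d m x y \<longleftrightarrow> J.precedes (act ws) m x y"
proof -
  have "J.position_root (act ws) m x \<in> \<Phi> \<inter> V"
    "J.position_root (act ws) m y \<in> \<Phi> \<inter> V"
    using J.position_root_root[OF coxeter_word_J] assms by blast+
  then show ?thesis
    unfolding precedes_def J.precedes_def position_root_J[OF assms(1)] position_root_J[OF assms(2)]
    by (simp only: inner_reflection euler_J)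
qed

private lemma act_position_roots_J:
  "set xs \<subseteq> J.colored_roots m \<Longrightarrow>
    act (map (position_root d m) xs) v =
      reflection s (act (map (J.position_root (act ws) m) xs) (reflection s v))"
proof (induction xs)
  case (Cons x xs)
  then have "act (map (position_root d m) xs) v =
      reflection s (act (map (J.position_root (act ws) m) xs) (reflection s v))" by auto
  moreover have "position_root d m x = reflection s (J.position_root (act ws) m x)"
    using Cons.prems by (intro position_root_J) simp
  ultimately show ?case by (simp only: act_map_Cons reflection_refl_refl)
qed (simp add: foldr.simps)

private lemma proj_root_initial: "proj_root d s = s"
  using proj_root_eq[of "[]" s ws] cs by (simp add: foldr.simps(1))

text \<open>A facet of the parabolic subsystem extends by \<open>(s, m)\<close>: its reflections for
  \<open>d\<close> are the \<open>s\<close>-conjugates of those for \<open>ws\<close>, and the outer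
  letters cancel against the new \<open>s\<close> and the first letter of \<open>d\<close>.\<close>

private lemma face_initial_if:
  assumes x: "x \<in> colored_roots m" "fst x \<in> V"
  shows "face d m {(s, m), x}"
proof -
  obtain ys where ys: "J.facet (act ws) m ys" "x \<in> set ys"
    using J.face_singleton[OF coxeter_word_J, of x m] x m colored_roots_J by (auto simp: J.face_def)
  have sub: "set ys \<subseteq> J.colored_roots m" using ys by (simp add: J.facet_def)
  have sm: "(s, m) \<notin> set ys" using sub colored_roots_J simple_notin_span[OF s_simple] by auto
  have "facet d m ((s, m) # ys)"
    unfolding facet_def
  proof (intro conjI allI)
    show "distinct ((s, m) # ys)" using ys sm by (simp add: J.facet_def)
    show "set ((s, m) # ys) \<subseteq> colored_roots m" using sub colored_roots_J s_simple
      by (auto simp: colored_roots_def)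
    have "card \<Delta> = Suc (card (\<Delta> - {s}))" using card.remove[OF finite_simple s_simple] .
    then show "length ((s, m) # ys) = card \<Delta>" using ys by (simp add: J.facet_def)
    have "precedes d m y x \<longleftrightarrow> J.precedes (act ws) m y x"
      if "x \<in> set ys" "y \<in> set ys" for x y
      using that sub by (intro precedes_J) auto
    moreover have "J.ordered (act ws) m ys"
      using ys(1) by (simp only: J.facet_def)
    ultimately have "ordered d m ys"
      by (simp add: sorted_wrt_iff_nth_less)
    moreover have "\<not> precedes d m y (s, m)" if "y \<in> set ys" for y
      using that sub sm colored_roots_J by (intro initial_first[OF cs m]) auto
    ultimately show "ordered d m ((s, m) # ys)" by simp
    fix v
    have "act (map (position_root d m) ((s, m) # ys)) (d v) =
        reflection s (act (map (position_root d m) ys) (d v))"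
      using proj_root_initial by (simp only: act_map_Cons position_root_def fst_conv snd_conv if_True simp_thms)
    also have "\<dots> = act (map (J.position_root (act ws) m) ys) (act ws v)"
      unfolding act_position_roots_J[OF sub] by (simp add: act_initial)
    finally show "act (map (position_root d m) ((s, m) # ys)) (d v) = v"
      using ys by (simp add: J.facet_def)
  qed
  then show ?thesis using ys(2) unfolding face_def by (intro exI[of _ "(s, m) # ys"]) auto
qed

text \<open>The remaining reflections of a facet through \<open>s\<^sup>(\<^sup>m\<^sup>)\<close> multiply to a Coxeter element of
  the maximal parabolic subgroup. Their roots span the space that it moves, and as there are only
  \<open>n - 1\<close> of them, they lie in it.\<close>

private lemma parabolic_if_face_initial:
  assumes "face d m {(s, m), x}" "x \<noteq> (s, m)"
  shows "fst x \<in> V"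
proof -
  let ?c = d
  obtain xs where xs: "facet ?c m xs" "(s, m) \<in> set xs" "x \<in> set xs"
    using assms by (auto simp: face_def)
  define ys where "ys = filter (\<lambda>x. x \<noteq> (s, m)) xs"
  have F: "facet ?c m ((s, m) # ys)"
  proof (rule facet_permute[OF cs xs(1)])
    have "\<not> precedes ?c m y (s, m)" if "y \<in> set ys" for y
      using that xs(1) by (intro initial_first[OF cs m]) (auto simp: ys_def facet_def)
    then show "ordered ?c m ((s, m) # ys)"
      using xs(1) by (auto simp: ys_def facet_def sorted_wrt_filter)
  qed (use xs in \<open>auto simp: ys_def facet_def\<close>)
  have x: "x \<in> set ys" "x \<in> colored_roots m" using xs assms(2) by (auto simp: ys_def facet_def)
  let ?g = "\<lambda>y. reflection s (position_root ?c m y)"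
  let ?U = "span (?g ` set ys)"
  have conj: "act (map ?g ys) v = reflection s (act (map (position_root ?c m) ys) (reflection s v))" for v
  proof (induction ys)
    case (Cons y ys)
    then show ?case by (simp only: act_map_Cons reflection_refl_refl)
  qed (simp add: foldr.simps)
  have prod: "act (map ?g ys) (act ws v) = v" for v
  proof -
    have "act (map (position_root ?c m) ((s, m) # ys)) (?c v) = v" using F by (simp only: facet_def)
    then have "reflection s (act (map (position_root ?c m) ys) (?c v)) = v"
      using proj_root_initial by (simp only: act_map_Cons position_root_def fst_conv snd_conv if_True simp_thms)
    then show ?thesis unfolding conj by (simp add: act_initial)
  qed
  have moved: "act ws v - v \<in> ?U" for v
    using diff_act_in_span[of "act ws v" "map ?g ys"] prod by simp
  \<comment> \<open>Each inversion of \<open>ws\<close> is a vector moved by \<open>act ws\<close>,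
    and it differs from its letter by a combination of earlier letters. So the letters enter
    \<open>?U\<close> one after the other.\<close>
  have "set (take i ws) \<subseteq> ?U" for i
  proof (induction i)
    case (Suc i)
    show ?case
    proof (cases "i < length ws")
      case True
      define q where "q = ws ! i"
      have split: "ws = take i ws @ q # drop (Suc i) ws" using id_take_nth_drop[OF True] by (simp add: q_def)
      have "J.coxeter_word (take i ws @ q # drop (Suc i) ws)" using coxeter_word_J split by simp
      from J.proj_root_eq[OF this] have "act (take i ws) q = - (act ws (J.weight q) - J.weight q)"
        using split by (simp add: J.proj_root_def)
      then have "act (take i ws) q \<in> ?U" using moved span_neg by metis
      moreover have "q - act (take i ws) q \<in> ?U"
        using diff_act_in_span[of q "take i ws"] Suc by (meson span_minimal subsetD subspace_span)
      ultimately have "(q - act (take i ws) q) + act (take i ws) q \<in> ?U" by (rule span_add[rotated])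
      then show ?thesis using Suc True by (simp add: take_Suc_conv_app_nth q_def)
    qed (use Suc in simp)
  qed simp
  from this[of "length ws"] have "\<Delta> - {s} \<subseteq> ?U" using set_ws by simp
  then have sub: "V \<subseteq> ?U" by (meson span_minimal subspace_span)
  have "dim ?U \<le> card (?g ` set ys)" using dim_le_card[of ?U "?g ` set ys"] by simp
  also have "\<dots> \<le> length ys" by (metis card_image_le card_length finite_set le_trans)
  also have "\<dots> = card (\<Delta> - {s})" using F card.remove[OF finite_simple s_simple]
    by (simp add: facet_def)
  also have "\<dots> = dim (V)"
    using J.independent_simple by (simp add: dim_span dim_eq_card_independent)
  finally have "V = ?U"
    using subspace_dim_equal[OF subspace_span subspace_span sub] by blast
  then have gx: "?g x \<in> V" using x(1) by (simp add: span_base)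
  show ?thesis
  proof (cases "snd x = m")
    case True
    then have "fst x \<in> \<Delta> - {s}" using x(2) assms(2) by (auto simp: colored_roots_def)
    then show ?thesis by (rule span_base)
  next
    case False
    then have "act ws (fst x) \<in> V" using gx by (simp add: position_root_def act_initial)
    from act_in_span[OF _ this, of "rev ws"] set_ws show ?thesis by (simp add: span_superset)
  qed
qed

lemma face_initial_iff:
  "x \<in> colored_roots m \<Longrightarrow>
    x \<noteq> (s, m) \<and> face d m {(s, m), x} \<longleftrightarrow> fst x \<in> span (\<Delta> - {s})"
  using face_initial_if parabolic_if_face_initial simple_notin_span[OF s_simple] by (metis fst_conv)

end

text \<open>Rotating away the letters in front of \<open>s\<close> makes it initial. Each such
  letter \<open>t\<close> fixes \<open>(s, m)\<close> and maps the span of the simple roots other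
  than \<open>s\<close> to itself.\<close>

lemma face_simple_iff:
  assumes "coxeter_word cs" "s \<in> \<Delta>" "x \<in> colored_roots m" "0 < m"
  shows "x \<noteq> (s, m) \<and> face (act cs) m {(s, m), x} \<longleftrightarrow> fst x \<in> span (\<Delta> - {s})"
proof -
  have "x \<noteq> (s, m) \<and> face (act (us @ s # vs)) m {(s, m), x} \<longleftrightarrow> fst x \<in> span (\<Delta> - {s})"
    if "coxeter_word (us @ s # vs)" "x \<in> colored_roots m" for us vs x
    using that
  proof (induction us arbitrary: vs x)
    case Nil
    then show ?case using face_initial_iff[of s vs m x] assms(4) by (simp only: append_Nil)
  next
    case (Cons t us)
    have t: "t \<in> \<Delta>" "t \<noteq> s" using Cons.prems by (auto simp: coxeter_word_def)
    let ?x = "rotate_root m t x"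
    have sm: "(s, m) \<in> colored_roots m" using assms(2) by (simp add: colored_roots_def)
    have cox: "coxeter_word (t # (us @ s # vs))" using Cons.prems by simp
    have rot: "rotate_root m t (s, m) = (s, m)" using t by (simp add: rotate_root_def)
    have "face (act (t # (us @ s # vs))) m {(s, m), x} \<longleftrightarrow> face (act ((us @ s # vs) @ [t])) m {(s, m), ?x}"
      using face_rotate[OF cox assms(4), of "{(s, m), x}"] rot Cons.prems(2) sm by simp
    moreover have "x = (s, m) \<longleftrightarrow> ?x = (s, m)"
      using rotate_root_eq_iff[OF cox assms(4) Cons.prems(2) sm] rot by metis
    moreover have "fst ?x \<in> span (\<Delta> - {s}) \<longleftrightarrow> fst x \<in> span (\<Delta> - {s})"
    proof -
      have tJ: "t \<in> span (\<Delta> - {s})" using t by (intro span_base) simp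
      have "reflection t b \<in> span (\<Delta> - {s})" if "b \<in> span (\<Delta> - {s})" for b
        using act_in_span[of "[t]"] tJ that by simp
      then have "reflection t (fst x) \<in> span (\<Delta> - {s}) \<longleftrightarrow> fst x \<in> span (\<Delta> - {s})"
        by (metis reflection_reflection)
      then show ?thesis using tJ by (auto simp: rotate_root_def)
    qed
    moreover have "?x \<noteq> (s, m) \<and> face (act (us @ s # (vs @ [t]))) m {(s, m), ?x} \<longleftrightarrow> fst ?x \<in> span (\<Delta> - {s})"
      using coxeter_word_rotate[OF cox] rotate_root_in[OF cox assms(4) Cons.prems(2)]
      by (intro Cons.IH) simp_all
    ultimately show ?case by (simp only: append_Cons append_assoc append_Nil)
  qed
  then show ?thesis using coxeter_word_split[OF assms(1,2)] assms(1,3) by metis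
qed

end

section \<open>The word \<open>c w\<^sub>\<circ>\<^sup>m(c)\<close>\<close>

lemma inversions_append: "inversions (us @ vs) = inversions us @ map (act us) (inversions vs)"
proof (induction vs rule: rev_induct)
  case (snoc a vs)
  then show ?case using inversions_snoc[of "us @ vs" a] by (simp add: inversions_snoc)
qed simp

lemma act_in_inversions: "act us b \<in> set (inversions (us @ b # vs))"
  using set_inversions_append[of "us @ [b]" vs] by (simp add: inversions_snoc)

lemma act_eq_if_map_reflection_eq:
  "map reflection us = map reflection vs \<Longrightarrow> act us = act vs"
proof (induction us arbitrary: vs)
  case (Cons a us)
  then obtain b vs' where "vs = b # vs'" "reflection a = reflection b" "map reflection us = map reflection vs'"
    by (cases vs) auto
  then show ?case using Cons.IH[of vs'] by simp
qed simp

lemma nths_inter_lessThan: "nths xs (I \<inter> {..<length xs}) = nths xs I"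
proof -
  have "filter (\<lambda>p. snd p \<in> I \<inter> {..<length xs}) (zip xs [0..<length xs]) =
      filter (\<lambda>p. snd p \<in> I) (zip xs [0..<length xs])"
    by (rule filter_cong) (auto dest!: set_zip_rightD)
  then show ?thesis by (simp only: nths_def)
qed

lemma length_nths_compl: "length (nths xs I) + length (nths xs (- I)) = length xs"
  by (induction xs rule: rev_induct) (auto simp: nths_append nths_singleton)

definition color_step :: "'v::euclidean_space \<Rightarrow> 'v \<times> nat \<Rightarrow> 'v \<times> nat" where
  "color_step a x = (if fst x = a then (fst x, Suc (snd x)) else (reflection a (fst x), snd x))"

definition colored_inv :: "'v::euclidean_space list \<Rightarrow> ('v \<times> nat) list" where
  "colored_inv ws = map (\<lambda>i. foldr color_step (take i ws) (ws ! i, 0)) [0..<length ws]"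

lemma colored_inv_Nil [simp]: "colored_inv [] = []"
  by (simp add: colored_inv_def)

lemma colored_inv_snoc: "colored_inv (ws @ [a]) = colored_inv ws @ [foldr color_step ws (a, 0)]"
  by (auto simp: colored_inv_def nth_append)

lemma colored_inv_append:
  "colored_inv (us @ vs) = colored_inv us @ map (foldr color_step us) (colored_inv vs)"
proof (induction vs rule: rev_induct)
  case (snoc a vs)
  then show ?case using colored_inv_snoc[of "us @ vs" a] by (simp add: colored_inv_snoc)
qed simp

text \<open>Where \<open>reflection a\<close> would turn \<open>a\<close> into \<open>- a\<close>,
  \<open>color_step\<close> keeps it and raises the color, so the two actions differ by signs
  only.\<close>

lemma fst_foldr_color_step:
  "0 \<notin> set ws \<Longrightarrow> fst (foldr color_step ws x) = act ws (fst x) \<or> fst (foldr color_step ws x) = - act ws (fst x)"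
proof (induction ws)
  case (Cons a ws)
  have "reflection a (- y) = - reflection a y" for y
    by (rule linear_neg[OF linear_reflection])
  then show ?case
    using Cons reflection_self[of a]
    by (auto simp: color_step_def) (metis minus_minus)+
qed simp

lemma map_reflection_colored_inv:
  assumes "0 \<notin> set ws"
  shows "map (\<lambda>x. reflection (act us (fst x))) (colored_inv ws) = map (\<lambda>b. reflection (act us b)) (inversions ws)"
  using assms
proof (induction ws rule: rev_induct)
  case (snoc a ws)
  have "reflection (act us (fst (foldr color_step ws (a, 0)))) = reflection (act us (act ws a))"
    using fst_foldr_color_step[of ws "(a, 0)"] snoc.prems reflection_minus_root[of "act us (act ws a)"]
    by (auto simp: act_minus)
  then show ?case using snoc by (simp add: colored_inv_snoc inversions_snoc)
qed simp

text \<open>A word is reduced iff no letter undoes a later one.\<close>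

definition no_return :: "'v::euclidean_space list \<Rightarrow> bool" where
  "no_return ws \<longleftrightarrow> (\<forall>xs a ys b zs. ws = xs @ a # ys @ b # zs \<longrightarrow> act ys b \<noteq> a)"

lemma no_return_append: "no_return (us @ vs) \<Longrightarrow> no_return us \<and> no_return vs"
  unfolding no_return_def by (metis append.assoc append_Cons)

lemma no_return_Cons: "no_return (a # ws) \<Longrightarrow> no_return ws"
  using no_return_append[of "[a]" ws] by simp

context simple_root_system
begin

lemma simple_word_nonzero: "set ws \<subseteq> \<Delta> \<Longrightarrow> 0 \<notin> set ws"
  using simple_nonzero by blast

lemma no_return_if_inversions_pos:
  assumes "set ws \<subseteq> \<Delta>" "set (inversions ws) \<subseteq> pos"
  shows "no_return ws"
  unfolding no_return_def
proof (intro allI impI)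
  fix xs a ys b zs
  assume ws: "ws = xs @ a # ys @ b # zs"
  have "act xs a \<in> pos"
    using assms(2) act_in_inversions[of xs a] ws by blast
  moreover have "act (xs @ a # ys) b \<in> pos"
    using assms(2) act_in_inversions[of "xs @ a # ys" b zs] ws by auto
  moreover have "act (xs @ a # ys) b = - act xs a" if "act ys b = a"
    using that reflection_self[of a] simple_nonzero[of a] assms(1) ws by (simp add: act_minus)
  ultimately show "act ys b \<noteq> a" using uminus_pos by metis
qed

lemma first_sign_change:
  "set ws \<subseteq> \<Delta> \<Longrightarrow> b \<in> pos \<Longrightarrow> act ws b \<notin> pos \<Longrightarrow> \<exists>ys a zs. ws = ys @ a # zs \<and> act zs b = a"
proof (induction ws)
  case (Cons a ws)
  show ?case
  proof (cases "act ws b \<in> pos")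
    case True
    then have "act ws b = a" using reflection_pos[of a "act ws b"] Cons.prems by auto
    then show ?thesis by (metis append_Nil)
  next
    case False
    then obtain ys c zs where "ws = ys @ c # zs" "act zs b = c" using Cons by auto
    then show ?thesis by (metis append_Cons)
  qed
qed simp

text \<open>Once \<open>act ws b\<close> is negative, its negative moves on by reflections. A second
  rise of the color would need it to equal a further letter, a return that \<open>no_return\<close>
  excludes.\<close>

lemma foldr_color_step:
  assumes "set ws \<subseteq> \<Delta>" "no_return ws" "b \<in> pos"
  shows "foldr color_step ws (b, k) = (if act ws b \<in> pos then (act ws b, k) else (- act ws b, Suc k))"
  using assms(1,2)
proof (induction ws)
  case Nil
  then show ?case using assms(3) by simp
next
  case (Cons a ws)
  have a: "a \<in> \<Delta>" and ws: "set ws \<subseteq> \<Delta>" using Cons.prems by auto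
  have IH: "foldr color_step ws (b, k) = (if act ws b \<in> pos then (act ws b, k) else (- act ws b, Suc k))"
    using Cons.IH ws no_return_Cons[OF Cons.prems(2)] by blast
  have root: "act ws b \<in> \<Phi>" using act_root_simple ws pos_root assms(3) by blast
  show ?case
  proof (cases "act ws b \<in> pos")
    case True
    then have "foldr color_step (a # ws) (b, k) = color_step a (act ws b, k)" using IH by simp
    then show ?thesis
      using True reflection_pos[OF a, of "act ws b"] reflection_self[OF simple_nonzero[OF a]]
        uminus_pos[OF simple_pos[OF a]]
      by (simp add: color_step_def[of a])
  next
    case False
    then obtain ys c zs where split: "ws = ys @ c # zs" "act zs b = c"
      using first_sign_change ws assms(3) by blast
    then have "act ws b = - act ys c"
      using reflection_self[of c] simple_nonzero[of c] ws by (simp add: act_minus)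
    moreover have "act ys c \<noteq> a"
      using Cons.prems(2) split(1) unfolding no_return_def by (metis append_Nil)
    ultimately have ne: "- act ws b \<noteq> a" by simp
    moreover have "- act ws b \<in> pos" using False not_pos_iff root by blast
    ultimately have "reflection a (- act ws b) \<in> pos" using reflection_pos[OF a] by blast
    moreover have "reflection a (- act ws b) = - reflection a (act ws b)"
      by (rule linear_neg[OF linear_reflection])
    moreover have "foldr color_step (a # ws) (b, k) = color_step a (- act ws b, Suc k)"
      using IH False by simp
    ultimately show ?thesis
      using ne uminus_pos[of "- reflection a (act ws b)"] by (simp add: color_step_def[of a])
  qed
qed

definition longest_word :: "'v list \<Rightarrow> bool" where
  "longest_word ws \<longleftrightarrow> set ws \<subseteq> \<Delta> \<and> (\<forall>b\<in>pos. act ws b \<notin> pos)"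

lemma longest_word_minus:
  assumes "longest_word ws" "b \<in> pos"
  shows "- act ws b \<in> pos"
  using assms not_pos_iff act_root_simple pos_root by (auto simp: longest_word_def)

lemma longest_word_act_act:
  assumes "longest_word us" "longest_word vs"
  shows "act us (act vs x) = x"
proof -
  have "act (us @ vs) x = x"
  proof (rule act_eq_id)
    show "set (us @ vs) \<subseteq> \<Delta>" using assms by (auto simp: longest_word_def)
    fix b assume "b \<in> pos"
    then have "- act us (- act vs b) \<in> pos" using assms longest_word_minus by blast
    then show "act (us @ vs) b \<in> pos" by (simp add: act_minus)
  qed
  then show ?thesis by simp
qed

lemma longest_word_unique: "longest_word us \<Longrightarrow> longest_word vs \<Longrightarrow> act us = act vs"
  by (metis ext longest_word_act_act)

lemma longest_word_if_inv_set: 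
  assumes "set ws \<subseteq> \<Delta>" "inv_set ws = pos"
  shows "longest_word ws"
  unfolding longest_word_def
proof (intro conjI ballI notI)
  fix b assume b: "b \<in> pos" "act ws b \<in> pos"
  then have "act ws b \<in> inv_set ws" using assms by simp
  then show False using b by (simp add: inv_set_def)
qed (rule assms)

lemma longest_word_sorting_list: "coxeter_word cs \<Longrightarrow> cs \<noteq> [] \<Longrightarrow> longest_word (sorting_list cs)"
  using set_sorting_list act_sorting_list_not_pos by (simp add: longest_word_def)

text \<open>Reflection in a simple root keeps all other positive roots positive, and
  \<open>- w_o\<close> transfers this property to its image \<open>b\<close>. If \<open>b\<close>
  were not simple, some simple \<open>d\<close> would have \<open>inner b d > 0\<close>, and
  \<open>reflection b d\<close> would get a negative coefficient at a simple root in the support of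
  \<open>b\<close> other than \<open>d\<close>.\<close>

lemma longest_word_simple:
  assumes w: "longest_word ws" and a: "a \<in> \<Delta>"
  shows "- act ws a \<in> \<Delta>"
proof -
  let ?b = "- act ws a"
  have b: "?b \<in> pos" using longest_word_minus w simple_pos a by blast
  have keep: "reflection ?b d \<in> pos" if d: "d \<in> pos" "d \<noteq> ?b" for d
  proof -
    have "- act ws d \<in> pos" using longest_word_minus w d by blast
    moreover have "- act ws d \<noteq> a" using d longest_word_act_act[OF w w, of d] by (auto simp: act_minus)
    ultimately have "reflection a (- act ws d) \<in> pos" using reflection_pos[OF a] by blast
    then have "- act ws (reflection a (- act ws d)) \<in> pos" using longest_word_minus w by blast
    moreover have "reflection ?b d = reflection (act ws a) (act ws (act ws d))"
      using longest_word_act_act[OF w w] reflection_minus_root by metis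
    ultimately show ?thesis
      by (simp add: reflection_act_act act_minus linear_neg[OF linear_reflection])
  qed
  have bb: "?b = (\<Sum>d\<in>\<Delta>. coefficient d ?b *\<^sub>R d)"
    using span_combination root_in_span pos_root b by blast
  have "0 < inner ?b ?b" using b pos_root root_nonzero inner_gt_zero_iff by blast
  also have "inner ?b ?b = (\<Sum>d\<in>\<Delta>. coefficient d ?b * inner ?b d)"
    by (subst (2) bb) (simp only: inner_sum_right inner_scaleR_right)
  finally obtain d where d: "d \<in> \<Delta>" "0 < coefficient d ?b * inner ?b d"
    by (metis (no_types, lifting) not_le sum_nonpos)
  have "0 < inner ?b d"
    using d pos_weight[OF b d(1)] inner_simple_pos[OF d(1)]
    by (metis divide_nonneg_pos mult_nonneg_nonneg zero_less_mult_pos less_le mult_zero_left zero_le_numeral)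
  have "?b = d"
  proof (rule ccontr)
    assume ne: "?b \<noteq> d"
    have "?b \<notin> span {d}"
    proof
      assume "?b \<in> span {d}"
      then have "?b = - d" using root_line[OF simple_root[OF d(1)]] b pos_root ne by blast
      then show False using b uminus_pos simple_pos[OF d(1)] by metis
    qed
    have "\<exists>e\<in>\<Delta> - {d}. inner (weight e) ?b \<noteq> 0"
    proof (rule ccontr)
      assume "\<not> ?thesis"
      then have "?b = (\<Sum>e\<in>\<Delta>. if e = d then coefficient d ?b *\<^sub>R d else 0)"
        by (subst bb) (intro sum.cong, auto)
      also have "\<dots> \<in> span {d}"
        using d(1) finite_simple by (auto intro: span_neg span_scale span_base)
      finally show False using \<open>?b \<notin> span {d}\<close> by blast
    qed
    then obtain e where e: "e \<in> \<Delta>" "e \<noteq> d" "0 < inner (weight e) ?b"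
      using pos_weight[OF b] by (metis DiffE insertI1 less_le)
    have "inner (weight e) (reflection ?b d) < 0"
    proof -
      have "0 < inner d ?b" using \<open>0 < inner ?b d\<close> by (simp only: inner_commute)
      then have "0 < (2 * inner d ?b / inner ?b ?b) * inner (weight e) ?b"
        using e(3) \<open>0 < inner ?b ?b\<close> by (intro mult_pos_pos divide_pos_pos) simp_all
      then show ?thesis
        unfolding reflection_def inner_diff_right inner_scaleR_right using e d(1) weight_other by simp
    qed
    moreover have "reflection ?b d \<in> pos" using keep[OF simple_pos[OF d(1)]] ne by blast
    ultimately show False using pos_weight[of "reflection ?b d" e] e by simp
  qed
  then show ?thesis using d by simp
qed

section \<open>Powers of the longest element and their colored inversions\<close>

definition twist_word :: "'v list \<Rightarrow> 'v list" where
  "twist_word ws = map (\<lambda>a. - act ws a) ws"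

definition power_word :: "'v list \<Rightarrow> nat \<Rightarrow> 'v list" where
  "power_word ws k = concat (map (\<lambda>i. if even i then ws else twist_word ws) [0..<k])"

lemma power_word_Suc:
  "power_word ws (Suc k) = power_word ws k @ (if even k then ws else twist_word ws)"
  by (simp add: power_word_def)

context
  fixes ws
  assumes longest: "longest_word ws" and inversions: "set (inversions ws) \<subseteq> pos"
begin

private lemma letters_simple: "set ws \<subseteq> \<Delta>"
  using longest by (simp add: longest_word_def)

private lemma act_ws_act_ws [simp]: "act ws (act ws x) = x"
  using longest_word_act_act longest by blast

private abbreviation "neg \<equiv> \<lambda>a. - act ws a"

private lemma act_twisted: "act (map neg us) x = act ws (act us (act ws x))"
proof (induction us arbitrary: x)
  case (Cons a us)
  have "reflection (- act ws a) (act ws y) = act ws (reflection a y)" for y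
    by (simp add: reflection_minus_root reflection_act_act)
  then show ?case using Cons by simp
qed simp

lemma set_twist_word: "set (twist_word ws) \<subseteq> \<Delta>"
  using longest_word_simple[OF longest] letters_simple by (auto simp: twist_word_def)

lemma act_twist_word: "act (twist_word ws) = act ws"
  by (rule ext) (simp only: twist_word_def act_twisted act_ws_act_ws)

private lemma no_return_ws: "no_return ws"
  using no_return_if_inversions_pos letters_simple inversions by blast

private lemma no_return_twist: "no_return (twist_word ws)"
  unfolding no_return_def twist_word_def
proof (intro allI impI)
  fix xs a ys b zs
  assume "map neg ws = xs @ a # ys @ b # zs"
  then obtain xs' a' ys' b' zs' where split: "ws = xs' @ a' # ys' @ b' # zs'"
      "a = - act ws a'" "b = - act ws b'" "ys = map neg ys'"
    unfolding map_eq_append_conv Cons_eq_map_conv append_eq_map_conv by blast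
  then have "act ys' b' \<noteq> a'" using no_return_ws unfolding no_return_def by blast
  moreover have "act ys b = - act ws (act ys' b')" unfolding split(3,4)
    by (simp only: act_twisted act_minus act_ws_act_ws)
  ultimately show "act ys b \<noteq> a" using split by (metis act_ws_act_ws neg_equal_iff_equal)
qed

private lemma foldr_color_step_ws:
  "b \<in> pos \<Longrightarrow> foldr color_step ws (b, k) = (- act ws b, Suc k)"
  using foldr_color_step[OF letters_simple no_return_ws] longest by (simp add: longest_word_def)

private lemma foldr_color_step_twist:
  "b \<in> pos \<Longrightarrow> foldr color_step (twist_word ws) (b, k) = (- act ws b, Suc k)"
  using foldr_color_step[OF set_twist_word no_return_twist] longest
    by (simp add: longest_word_def act_twist_word)

lemma set_power_word: "set (power_word ws k) \<subseteq> \<Delta>"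
  by (induction k) (use letters_simple set_twist_word in \<open>auto simp: power_word_def\<close>)

lemma act_power_word: "act (power_word ws k) = act ws ^^ k"
proof (induction k)
  case (Suc k)
  then show ?case
    by (simp add: power_word_Suc act_twist_word fun_eq_iff funpow_swap1)
qed (simp add: power_word_def fun_eq_iff)

private lemma foldr_color_step_power:
  "b \<in> pos \<Longrightarrow> foldr color_step (power_word ws k) (b, l) = (if even k then b else - act ws b, l + k)"
proof (induction k arbitrary: b l)
  case (Suc k)
  have "- act ws b \<in> pos" using longest_word_minus longest Suc.prems by blast
  then show ?case
    using Suc foldr_color_step_ws foldr_color_step_twist by (simp add: power_word_Suc act_minus)
qed (simp add: power_word_def)

private lemma colored_inv_reduced:
  assumes "set us \<subseteq> \<Delta>" "no_return us" "set (inversions us) \<subseteq> pos"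
  shows "colored_inv us = map (\<lambda>b. (b, 0)) (inversions us)"
  using assms
proof (induction us rule: rev_induct)
  case (snoc a us)
  then have "act us a \<in> pos" "no_return us" using no_return_append by (auto simp: inversions_snoc)
  then show ?case
    using snoc foldr_color_step[of us a 0] simple_pos[of a] by (simp add: colored_inv_snoc inversions_snoc)
qed simp

private lemma inversions_twist: "inversions (twist_word ws) = map neg (inversions ws)"
proof -
  have "inversions (map neg us) = map neg (inversions us)" for us
    by (induction us rule: rev_induct)
      (simp_all add: inversions_snoc act_twisted act_minus)
  then show ?thesis by (simp add: twist_word_def)
qed

text \<open>Every block raises all colors by one and sends \<open>b\<close> to
  \<open>- act ws b\<close>, an involution. On odd blocks this undoes the twist of the letters, so
  each block shows the same inversion sequence.\<close>

lemma colored_inv_power_word: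
  "colored_inv (power_word ws k) = concat (map (\<lambda>j. map (\<lambda>b. (b, j)) (inversions ws)) [0..<k])"
proof (induction k)
  case (Suc k)
  have pos: "b \<in> pos" "- act ws b \<in> pos" if "b \<in> set (inversions ws)" for b
    using that inversions longest_word_minus longest by auto
  have "map (foldr color_step (power_word ws k)) (colored_inv (if even k then ws else twist_word ws)) =
      map (\<lambda>b. (b, k)) (inversions ws)"
  proof (cases "even k")
    case True
    then show ?thesis
      using colored_inv_reduced[OF letters_simple no_return_ws inversions] pos foldr_color_step_power by simp
  next
    case False
    have "set (inversions (twist_word ws)) \<subseteq> pos" using pos by (auto simp: inversions_twist)
    from colored_inv_reduced[OF set_twist_word no_return_twist this] show ?thesis
      using False pos foldr_color_step_power by (simp add: inversions_twist act_minus)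
  qed
  then show ?case using Suc by (simp add: power_word_Suc colored_inv_append)
qed (simp add: power_word_def)

lemma length_power_word: "length (power_word ws k) = k * length ws"
  by (induction k) (simp_all add: power_word_def twist_word_def)

end

lemma labels_eq_colored_inv:
  assumes "coxeter_word cs" "cs \<noteq> []"
  shows "labels cs m = map (\<lambda>q. (q, m)) cs @ colored_inv (power_word (sorting_list cs) m)"
  using colored_inv_power_word[OF longest_word_sorting_list[OF assms]] set_inversions_sorting_list[OF assms]
  by (simp add: labels_upto_def)

text \<open>Stated for reflections because colored and plain inversions agree up to sign
  only.\<close>

lemma map_reflection_labels:
  assumes cs: "coxeter_word cs" "cs \<noteq> []"
  shows "map (\<lambda>x. reflection (position_root (act cs) m x)) (labels cs m) =
    map reflection (inversions (cs @ power_word (sorting_list cs) m))"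
proof -
  let ?w = "power_word (sorting_list cs) m"
  have longest: "longest_word (sorting_list cs)" "set (inversions (sorting_list cs)) \<subseteq> pos"
    using longest_word_sorting_list[OF cs] set_inversions_sorting_list[OF cs] by simp_all
  have "snd x < m" if "x \<in> set (colored_inv ?w)" for x
    using that colored_inv_power_word[OF longest] by auto
  then have "map (\<lambda>x. reflection (position_root (act cs) m x)) (colored_inv ?w) =
      map (\<lambda>x. reflection (act cs (fst x))) (colored_inv ?w)"
    by (auto simp: position_root_def)
  also have "\<dots> = map (\<lambda>b. reflection (act cs b)) (inversions ?w)"
    using simple_word_nonzero[OF set_power_word[OF longest]] by (rule map_reflection_colored_inv)
  finally show ?thesis
    by (simp add: labels_eq_colored_inv[OF cs] inversions_append inversions_coxeter_word[OF cs(1)] position_root_def)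
qed

text \<open>Counting letters matches \<open>card \<Delta>\<close> deleted positions with a
  complement of length \<open>m * card pos\<close>, and \<open>act_nths_compl\<close> turns the
  product of the complement into the product of the deleted reflections.\<close>

lemma face_iff_word:
  fixes m :: nat
  assumes cs: "coxeter_word cs" "cs \<noteq> []"
  defines "Q \<equiv> cs @ power_word (sorting_list cs) m"
  shows "face (act cs) m X \<longleftrightarrow>
    (\<exists>I \<subseteq> {..<length Q}. length (nths Q (- I)) = m * card pos \<and>
      act (nths Q (- I)) = act (sorting_list cs) ^^ m \<and> X \<subseteq> (\<lambda>i. labels cs m ! i) ` I)"
    (is "_ \<longleftrightarrow> ?R")
proof -
  let ?w = "power_word (sorting_list cs) m"
  let ?L = "labels cs m" and ?w0 = "act (sorting_list cs)" and ?t = "position_root (act cs) m"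
  have longest: "longest_word (sorting_list cs)" "set (inversions (sorting_list cs)) \<subseteq> pos"
    using longest_word_sorting_list[OF cs] set_inversions_sorting_list[OF cs] by simp_all
  have len: "length Q = card \<Delta> + m * card pos" "length ?L = length Q"
  proof -
    have "length cs = card \<Delta>" using cs distinct_card[of cs] by (simp add: coxeter_word_def)
    then show "length Q = card \<Delta> + m * card pos"
      using length_power_word[OF longest] length_sorting_list[OF cs] by (simp add: Q_def)
    show "length ?L = length Q" by (simp add: labels_eq_colored_inv[OF cs] Q_def colored_inv_def)
  qed
  have card: "length (nths ?L I) = card \<Delta> \<longleftrightarrow> length (nths Q (- I)) = m * card pos" for I
  proof -
    have "length (nths ?L I) = length (nths Q I)" using len by (simp add: length_nths)
    moreover have "length (nths Q I) + length (nths Q (- I)) = card \<Delta> + m * card pos"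
      using length_nths_compl[of Q I] len by simp
    ultimately show ?thesis by (metis add_left_cancel add_right_cancel)
  qed
  have prod: "(\<forall>v. act (map ?t (nths ?L I)) (act cs v) = v) \<longleftrightarrow>
      act (nths Q (- I)) = ?w0 ^^ m" for I
  proof -
    have "map reflection (map ?t (nths ?L I)) = map reflection (nths (inversions Q) I)"
      using map_reflection_labels[OF cs, of m] unfolding Q_def
      by (simp only: map_map o_def nths_map[symmetric])
    then have eq: "act (map ?t (nths ?L I)) = act (nths (inversions Q) I)"
      by (rule act_eq_if_map_reflection_eq)
    have "act (nths Q (- I)) v = act (nths (inversions Q) I) (act cs ((?w0 ^^ m) v))" for v
      unfolding act_nths_compl using act_power_word[OF longest, of m] by (simp add: Q_def)
    then have "act (nths Q (- I)) = ?w0 ^^ m \<longleftrightarrow>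
        (\<forall>v. act (nths (inversions Q) I) (act cs ((?w0 ^^ m) v)) = (?w0 ^^ m) v)"
      by (simp add: fun_eq_iff)
    \<comment> \<open>\<open>w_o^m\<close> is invertible, so its values run through all
      vectors.\<close>
    also have "\<dots> \<longleftrightarrow> (\<forall>v. act (nths (inversions Q) I) (act cs v) = v)"
      by (metis act_act_rev act_pow)
    finally show ?thesis using eq by simp
  qed
  have "set (nths ?L I) = (\<lambda>i. ?L ! i) ` I" if "I \<subseteq> {..<length Q}" for I
    using that len by (auto simp: set_nths)
  then have img: "X \<subseteq> set (nths ?L I) \<longleftrightarrow> X \<subseteq> (\<lambda>i. ?L ! i) ` I" if "I \<subseteq> {..<length Q}" for I
    using that by simp
  show ?thesis
  proof
    assume "face (act cs) m X"
    then obtain I where I: "length (nths ?L I) = card \<Delta>" "X \<subseteq> set (nths ?L I)"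
      "\<forall>v. act (map ?t (nths ?L I)) (act cs v) = v"
      unfolding face_iff_labels[OF cs] by blast
    let ?I = "I \<inter> {..<length Q}"
    have eq: "nths ?L ?I = nths ?L I" using nths_inter_lessThan[of ?L I] len by simp
    show ?R
      using I card[of ?I] prod[of ?I] img[of ?I] unfolding eq by blast
  next
    assume ?R
    then show "face (act cs) m X"
      unfolding face_iff_labels[OF cs] using card prod img by blast
  qed
qed

end

section \<open>Coxeter systems with a root system\<close>

locale coxeter_root_system =
  fixes W :: "('a, 'b) monoid_scheme" (structure) and S :: "'a set"
    and \<rho> :: "'a \<Rightarrow> 'v::euclidean_space \<Rightarrow> 'v" and \<Phi> :: "'v set" and \<alpha> :: "'a \<Rightarrow> 'v"
  assumes coxeter: "coxeter_system W S" and roots: "root_system_of W S \<rho> \<Phi> \<alpha>"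

sublocale coxeter_root_system \<subseteq> group W
  using coxeter by (simp add: coxeter_system_def)

sublocale coxeter_root_system \<subseteq> R: simple_root_system \<Phi> "\<alpha> ` S"
  by unfold_locales (use roots in \<open>auto simp: root_system_of_def\<close>)

context coxeter_root_system
begin

lemma generators_carrier: "S \<subseteq> carrier W"
  and generate_generators: "generate W S = carrier W"
  and generator_square: "s \<in> S \<Longrightarrow> s \<otimes> s = \<one>"
  using coxeter by (auto simp: coxeter_system_def)

lemma inj_on_simple: "inj_on \<alpha> S"
  and rho_generator: "s \<in> S \<Longrightarrow> \<rho> s = reflection (\<alpha> s)"
  and faithful: "faithful_action W UNIV \<rho>"
  using roots by (auto simp: root_system_of_def)

lemma rho_mult:
  assumes "x \<in> carrier W" "y \<in> carrier W"
  shows "\<rho> (x \<otimes> y) v = \<rho> x (\<rho> y v)"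
proof -
  interpret faithful_action W UNIV \<rho> by (rule faithful)
  interpret h: group_hom W "BijGroup UNIV" \<rho> by (rule group_hom)
  have "\<rho> x \<in> Bij UNIV" "\<rho> y \<in> Bij UNIV"
    using h.hom_closed assms by (simp_all add: BijGroup_def)
  then show ?thesis
    using h.hom_mult[OF assms] by (simp add: BijGroup_def compose_def)
qed

lemma rho_one: "\<rho> \<one> v = v"
proof -
  interpret faithful_action W UNIV \<rho> by (rule faithful)
  interpret h: group_hom W "BijGroup UNIV" \<rho> by (rule group_hom)
  show ?thesis using h.hom_one by (simp add: BijGroup_def)
qed

lemma rho_eq_iff: "x \<in> carrier W \<Longrightarrow> y \<in> carrier W \<Longrightarrow> \<rho> x = \<rho> y \<longleftrightarrow> x = y"
  using faithful_action.faithful[OF faithful] by (auto dest: inj_onD)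

lemma word_prod_Nil [simp]: "word_prod W [] = \<one>"
  and word_prod_Cons [simp]: "word_prod W (s # ws) = s \<otimes> word_prod W ws"
  by (simp_all add: word_prod_def)

lemma word_prod_closed [simp]: "set ws \<subseteq> S \<Longrightarrow> word_prod W ws \<in> carrier W"
  using generators_carrier by (induction ws) auto

lemma word_prod_append:
  "set us \<subseteq> S \<Longrightarrow> set vs \<subseteq> S \<Longrightarrow> word_prod W (us @ vs) = word_prod W us \<otimes> word_prod W vs"
  using generators_carrier by (induction us) (auto simp: m_assoc)

lemma rho_word_prod: "set ws \<subseteq> S \<Longrightarrow> \<rho> (word_prod W ws) = act (map \<alpha> ws)"
proof (induction ws)
  case (Cons s ws)
  then show ?case using generators_carrier by (auto simp: rho_mult rho_generator fun_eq_iff)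
qed (simp add: rho_one fun_eq_iff)

text \<open>Faithfulness of \<open>\<rho>\<close> moves questions about group elements to words of
  reflections.\<close>

lemma word_prod_eq_iff:
  "set us \<subseteq> S \<Longrightarrow> set vs \<subseteq> S \<Longrightarrow>
    word_prod W us = word_prod W vs \<longleftrightarrow> act (map \<alpha> us) = act (map \<alpha> vs)"
  using rho_eq_iff rho_word_prod word_prod_closed by metis

lemma inv_generator: "s \<in> S \<Longrightarrow> inv s = s"
  using generator_square generators_carrier by (intro inv_equality) auto

lemma ex_word_generate:
  assumes "A \<subseteq> S" "w \<in> generate W A"
  obtains ws where "set ws \<subseteq> A" "word_prod W ws = w"
proof -
  have "\<exists>ws. set ws \<subseteq> A \<and> word_prod W ws = w"
    using assms(2)
  proof (induction rule: generate.induct)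
    case one
    then show ?case by (intro exI[of _ "[]"]) simp
  next
    case (incl h)
    then show ?case using assms(1) generators_carrier by (intro exI[of _ "[h]"]) auto
  next
    case (inv h)
    then have "h \<in> S" "h \<in> carrier W" using assms(1) generators_carrier by auto
    then show ?case using inv inv_generator by (intro exI[of _ "[h]"]) simp
  next
    case (eng g h)
    then obtain us vs where "set us \<subseteq> A" "set vs \<subseteq> A" "word_prod W us = g" "word_prod W vs = h"
      by auto
    then show ?case using word_prod_append[of us vs] assms(1) by (intro exI[of _ "us @ vs"]) auto
  qed
  then show ?thesis using that by blast
qed

lemma word_prod_generate: "A \<subseteq> S \<Longrightarrow> set ws \<subseteq> A \<Longrightarrow> word_prod W ws \<in> generate W A"
  by (induction ws) (auto intro: generate.one generate.eng generate.incl)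

lemma ex_word: 
  assumes "w \<in> carrier W"
  obtains ws where "set ws \<subseteq> S" "word_prod W ws = w"
  using ex_word_generate[of S w] assms generate_generators by blast

lemma lift_word:
  assumes "A \<subseteq> S" "set vs \<subseteq> \<alpha> ` A"
  obtains ws where "set ws \<subseteq> A" "map \<alpha> ws = vs"
proof -
  have "vs = map \<alpha> (map (inv_into A \<alpha>) vs)" "set (map (inv_into A \<alpha>) vs) \<subseteq> A"
    using assms(2) by (auto simp: f_inv_into_f inv_into_into subset_iff intro!: map_idI[symmetric])
  then show ?thesis using that by metis
qed

lemma map_simple_subset: "set ws \<subseteq> S \<Longrightarrow> set (map \<alpha> ws) \<subseteq> \<alpha> ` S"
  by auto

text \<open>The number of inversions depends on the element only and bounds the length of its words
  from below; positive inversions make it equal to the length. Conversely, an inversion that is not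
  positive permits a deletion.\<close>

lemma reduced_word_iff:
  "reduced_word W S ws w \<longleftrightarrow>
    set ws \<subseteq> S \<and> word_prod W ws = w \<and> set (inversions (map \<alpha> ws)) \<subseteq> R.pos"
proof -
  have "length ws = cox_length W S w \<longleftrightarrow> set (inversions (map \<alpha> ws)) \<subseteq> R.pos"
    if ws: "set ws \<subseteq> S" "word_prod W ws = w"
  proof
    assume len: "length ws = cox_length W S w"
    show "set (inversions (map \<alpha> ws)) \<subseteq> R.pos"
    proof (rule R.minimal_inversions_pos[OF map_simple_subset[OF ws(1)]])
      fix vs assume vs: "set vs \<subseteq> \<alpha> ` S" "act vs = act (map \<alpha> ws)"
      then obtain us where us: "set us \<subseteq> S" "map \<alpha> us = vs" using lift_word[of S vs] by blast
      then have "word_prod W us = w" using vs ws word_prod_eq_iff[of us ws] by simp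
      then have "cox_length W S w \<le> length us"
        unfolding cox_length_def using us by (intro Least_le) blast
      then show "length (map \<alpha> ws) \<le> length vs" using us len by auto
    qed
  next
    assume inv: "set (inversions (map \<alpha> ws)) \<subseteq> R.pos"
    have "length ws \<le> length us" if us: "set us \<subseteq> S" "word_prod W us = w" for us
    proof -
      have "act (map \<alpha> us) = act (map \<alpha> ws)" using us ws word_prod_eq_iff[of us ws] by simp
      then have "R.inv_set (map \<alpha> us) = R.inv_set (map \<alpha> ws)" by (rule R.inv_set_cong)
      moreover have "card (R.inv_set (map \<alpha> ws)) = length ws"
        using R.inversions_pos[OF map_simple_subset[OF ws(1)] inv] by (simp add: distinct_card)
      ultimately show ?thesis using R.card_inv_set_le[OF map_simple_subset[OF us(1)]] by simp
    qed
    then show "length ws = cox_length W S w"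
      unfolding cox_length_def using ws by (intro Least_equality[symmetric]) auto
  qed
  then show ?thesis by (auto simp: reduced_word_def)
qed

lemma ex_reduced_word:
  assumes "w \<in> carrier W"
  obtains ws where "reduced_word W S ws w"
proof -
  have "\<exists>n ws. set ws \<subseteq> S \<and> length ws = n \<and> word_prod W ws = w" using ex_word assms
    by metis
  then have "\<exists>ws. set ws \<subseteq> S \<and> length ws = cox_length W S w \<and> word_prod W ws = w"
    unfolding cox_length_def by (rule LeastI_ex)
  then show ?thesis using that by (auto simp: reduced_word_def)
qed

lemma cox_length_eq:
  assumes ws: "set ws \<subseteq> S" "word_prod W ws = w"
  shows "cox_length W S w = card (R.inv_set (map \<alpha> ws))"
proof -
  have "w \<in> carrier W" using ws by auto
  then obtain vs where vs: "reduced_word W S vs w" using ex_reduced_word by blast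
  then have v: "set vs \<subseteq> S" "word_prod W vs = w" "set (inversions (map \<alpha> vs)) \<subseteq> R.pos"
    using reduced_word_iff by auto
  have "R.inv_set (map \<alpha> ws) = R.inv_set (map \<alpha> vs)"
    using ws v word_prod_eq_iff[of ws vs] by (intro R.inv_set_cong) simp
  also have "card \<dots> = length vs"
    using R.inversions_pos[OF map_simple_subset[OF v(1)] v(3)] by (simp add: distinct_card)
  finally show ?thesis using vs by (simp add: reduced_word_def)
qed

text \<open>Length counts inversions, so the maximum is reached exactly when all positive roots are
  inverted, and this determines the element.\<close>

lemma longest_element_eq:
  assumes ws: "set ws \<subseteq> S" "R.inv_set (map \<alpha> ws) = R.pos"
  shows "longest_element W S = word_prod W ws" "cox_length W S (word_prod W ws) = card R.pos"
proof -
  show len: "cox_length W S (word_prod W ws) = card R.pos" using cox_length_eq ws by metis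
  show "longest_element W S = word_prod W ws"
    unfolding longest_element_def
  proof (rule the_equality)
    have "cox_length W S v \<le> card R.pos" if v: "v \<in> carrier W" for v
    proof -
      obtain vs where "set vs \<subseteq> S" "word_prod W vs = v" using ex_word[OF v] by blast
      then have "cox_length W S v = card (R.inv_set (map \<alpha> vs))" by (rule cox_length_eq)
      moreover have "R.inv_set (map \<alpha> vs) \<subseteq> R.pos" by (simp add: R.inv_set_def)
      ultimately show ?thesis using card_mono[OF R.finite_pos] by simp
    qed
    then show "word_prod W ws \<in> carrier W \<and>
        (\<forall>v\<in>carrier W. cox_length W S v \<le> cox_length W S (word_prod W ws))"
      using ws len by simp
    fix w assume w: "w \<in> carrier W \<and> (\<forall>v\<in>carrier W. cox_length W S v \<le> cox_length W S w)"
    then obtain vs where vs: "set vs \<subseteq> S" "word_prod W vs = w" using ex_word[of w] by blast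
    have "card R.pos \<le> card (R.inv_set (map \<alpha> vs))"
      using w word_prod_closed[OF ws(1)] len cox_length_eq[OF vs] by fastforce
    then have "R.inv_set (map \<alpha> vs) = R.pos"
      using R.finite_pos by (intro card_seteq) (auto simp: R.inv_set_def)
    then have "act (map \<alpha> vs) = act (map \<alpha> ws)"
      using R.longest_word_unique[OF R.longest_word_if_inv_set R.longest_word_if_inv_set,
          of "map \<alpha> vs" "map \<alpha> ws"] ws vs map_simple_subset by simp
    then show "w = word_prod W ws" using word_prod_eq_iff[of vs ws] vs ws by simp
  qed
qed

definition coxeter_list :: "'a list \<Rightarrow> bool" where
  "coxeter_list cs \<longleftrightarrow> distinct cs \<and> set cs = S"

lemma coxeter_word_map: "set cs \<subseteq> S \<Longrightarrow> R.coxeter_word (map \<alpha> cs) \<longleftrightarrow> coxeter_list cs"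
  using inj_on_simple inj_on_image_eq_iff[OF inj_on_simple, of "set cs" S] inj_on_subset
  by (auto simp: R.coxeter_word_def coxeter_list_def distinct_map)

lemma coxeter_listD: "coxeter_list cs \<Longrightarrow> set cs \<subseteq> S" "coxeter_list cs \<Longrightarrow> R.coxeter_word (map \<alpha> cs)"
  using coxeter_word_map by (auto simp: coxeter_list_def)

lemma coxeter_list_reduced: "coxeter_list cs \<Longrightarrow> reduced_word W S cs (word_prod W cs)"
  using R.inversions_coxeter_word R.proj_root_pos coxeter_listD by (force simp: reduced_word_iff)

lemma coxeter_elements_eq: "coxeter_elements W S = word_prod W ` {cs. coxeter_list cs}"
  by (auto simp: coxeter_elements_def coxeter_list_def)

text \<open>A word for a Coxeter element uses every letter \<open>s\<close>, since otherwise the element would fix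
  the weight of the root of \<open>s\<close>.\<close>

lemma reduced_word_coxeter_list:
  assumes c: "c \<in> coxeter_elements W S" and ws: "reduced_word W S ws c"
  shows "coxeter_list ws"
proof -
  obtain cs where cs: "coxeter_list cs" "word_prod W cs = c" using c by (auto simp: coxeter_elements_eq)
  have w: "set ws \<subseteq> S" "word_prod W ws = c" using ws by (auto simp: reduced_word_def)
  have act: "act (map \<alpha> cs) = act (map \<alpha> ws)"
    using w cs coxeter_listD(1)[OF cs(1)] word_prod_eq_iff[of cs ws] by simp
  have "S \<subseteq> set ws"
  proof
    fix s assume s: "s \<in> S"
    show "s \<in> set ws"
    proof (rule ccontr)
      assume "s \<notin> set ws"
      then have "set (map \<alpha> ws) \<subseteq> \<alpha> ` S - {\<alpha> s}" using w(1) s inj_on_simple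
        by (auto dest: inj_onD)
      then have "act (map \<alpha> ws) (R.weight (\<alpha> s)) = R.weight (\<alpha> s)"
        using R.act_weight s by blast
      then have "R.proj_root (act (map \<alpha> cs)) (\<alpha> s) = 0" using act by (simp add: R.proj_root_def)
      then show False
        using R.proj_root_root[OF coxeter_listD(2)[OF cs(1)], of "\<alpha> s"] R.zero_not_root s by auto
    qed
  qed
  then have "set ws = S" using w(1) by auto
  moreover have "length ws = length cs"
    using ws coxeter_list_reduced[OF cs(1)] cs(2) by (simp add: reduced_word_def)
  ultimately have "card (set ws) = length ws"
    using cs(1) distinct_card[of cs] by (simp add: coxeter_list_def)
  then show ?thesis using \<open>set ws = S\<close> by (simp add: coxeter_list_def card_distinct)
qed

context
  fixes cs
  assumes cs: "coxeter_list cs" and nonempty: "S \<noteq> {}"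
begin

private abbreviation ds where
  "ds \<equiv> map \<alpha> cs"

private lemma ds: "R.coxeter_word ds" "ds \<noteq> []"
  using coxeter_listD[OF cs] nonempty cs by (auto simp: coxeter_list_def)

private abbreviation word_at where
  "word_at \<equiv> map (\<lambda>i. cs ! (i mod length cs))"

private definition positions :: "nat list" where
  "positions = sorted_list_of_set (R.sorting_positions ds)"

private definition w0_word :: "'a list" where
  "w0_word = word_at positions"

private lemma letters: "set (word_at qs) \<subseteq> S"
  "map \<alpha> (word_at qs) = map (letter ds) qs"
proof -
  have "cs \<noteq> []" using ds by simp
  then have "i mod length cs < length cs" for i by simp
  then show "set (word_at qs) \<subseteq> S"
    "map \<alpha> (word_at qs) = map (letter ds) qs"
    using cs by (auto simp: letter_def coxeter_list_def)
qed

private lemma w0_word: "set w0_word \<subseteq> S" "map \<alpha> w0_word = R.sorting_list ds"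
  using letters[of positions] by (simp_all add: w0_word_def R.sorting_list_def positions_def)

private lemma inv_set_w0: "R.inv_set (map \<alpha> w0_word) = R.pos"
  using R.set_inversions_sorting_list[OF ds] R.inversions_pos[OF R.set_sorting_list[OF ds]] w0_word(2) by simp

private lemma w0: "longest_element W S = word_prod W w0_word"
  "cox_length W S (word_prod W w0_word) = card R.pos"
  using longest_element_eq[OF w0_word(1) inv_set_w0] .

private lemma longest_subword_iff:
  "longest_subword W S cs qs \<longleftrightarrow> sorted_wrt (<) qs \<and>
    reduced_word W S (word_at qs) (word_prod W w0_word)"
  by (simp add: longest_subword_def w0)

private lemma sorting_word: "sorting_word W S cs = w0_word"
proof -
  let ?P = "\<lambda>ps. longest_subword W S cs ps \<and>
      (\<forall>qs. longest_subword W S cs qs \<longrightarrow> ps = qs \<or> (ps, qs) \<in> lexord less_than)"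
  have P: "?P positions"
  proof (intro conjI allI impI)
    have "reduced_word W S w0_word (word_prod W w0_word)"
      using w0_word R.set_inversions_sorting_list[OF ds] by (simp add: reduced_word_iff)
    then show "longest_subword W S cs positions"
      using strict_sorted_list_of_set by (auto simp: longest_subword_iff positions_def w0_word_def)
    fix qs assume qs: "longest_subword W S cs qs"
    then have "length qs = card R.pos" using w0(2) by (simp add: longest_subword_iff reduced_word_def)
    moreover have "set (inversions (map (letter ds) qs)) \<subseteq> R.pos"
      using qs letters(2)[of qs] by (simp only: longest_subword_iff reduced_word_iff)
    ultimately show "positions = qs \<or> (positions, qs) \<in> lexord less_than"
      using R.sorting_positions_least[OF ds] qs by (simp add: longest_subword_iff positions_def)
  qed
  have "(THE ps. ?P ps) = positions"
  proof (rule the_equality[of ?P, OF P])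
    fix ps assume ps: "?P ps"
    have "asym less_than" by (auto intro!: asymI)
    then show "ps = positions" using P ps lexord_asymmetric[of less_than ps positions] by blast
  qed
  then show ?thesis by (simp add: sorting_word_def w0_word_def)
qed

private lemma longest_word: "R.longest_word (map \<alpha> w0_word)"
  using R.longest_word_if_inv_set map_simple_subset[OF w0_word(1)] inv_set_w0 by blast

text \<open>\<open>w_o t w_o\<close> acts as the reflection in \<open>- w_o(\<alpha> t)\<close>, a
  simple root by \<open>longest_word_simple\<close>; faithfulness identifies it with a
  generator.\<close>

private lemma twist: "set (twist W S w0_word) \<subseteq> S" "map \<alpha> (twist W S w0_word) = R.twist_word (map \<alpha> w0_word)"
proof -
  let ?w = "word_prod W w0_word" and ?a = "act (map \<alpha> w0_word)"
  have w: "?w \<in> carrier W" "\<rho> ?w = ?a" using w0_word(1) rho_word_prod by auto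
  have tw: "?w \<otimes> t \<otimes> ?w \<in> S \<and> \<alpha> (?w \<otimes> t \<otimes> ?w) = - ?a (\<alpha> t)" if t: "t \<in> S" for t
  proof -
    have "- ?a (\<alpha> t) \<in> \<alpha> ` S" using R.longest_word_simple[OF longest_word] t by blast
    then obtain u where u: "u \<in> S" "\<alpha> u = - ?a (\<alpha> t)" by (metis image_iff)
    have car: "t \<in> carrier W" "u \<in> carrier W" using t u generators_carrier by auto
    have "\<rho> (?w \<otimes> t \<otimes> ?w) = \<rho> u"
    proof
      fix v
      have "\<rho> u v = reflection (?a (\<alpha> t)) v"
        using u rho_generator reflection_minus_root by metis
      also have "\<dots> = reflection (?a (\<alpha> t)) (?a (?a v))"
        using R.longest_word_act_act[OF longest_word longest_word] by simp
      also have "\<dots> = \<rho> (?w \<otimes> t \<otimes> ?w) v"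
        using w car t by (simp add: rho_mult rho_generator reflection_act_act)
      finally show "\<rho> (?w \<otimes> t \<otimes> ?w) v = \<rho> u v" by simp
    qed
    then have "?w \<otimes> t \<otimes> ?w = u" using rho_eq_iff w car by simp
    then show ?thesis using u by simp
  qed
  then show "set (twist W S w0_word) \<subseteq> S" "map \<alpha> (twist W S w0_word) = R.twist_word (map \<alpha> w0_word)"
    using w0_word(1) by (auto simp: twist_def w0 R.twist_word_def)
qed

private lemma sorting_word_pow:
  "set (sorting_word_pow W S m cs) \<subseteq> S"
  "map \<alpha> (sorting_word_pow W S m cs) = R.power_word (R.sorting_list ds) m"
proof -
  show "set (sorting_word_pow W S m cs) \<subseteq> S"
    using w0_word(1) twist(1) by (auto simp: sorting_word_pow_def sorting_word split: if_splits)
  have "map \<alpha> (if even i then w0_word else twist W S w0_word) =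
      (if even i then map \<alpha> w0_word else R.twist_word (map \<alpha> w0_word))" for i :: nat
    using twist(2) by simp
  then show "map \<alpha> (sorting_word_pow W S m cs) = R.power_word (R.sorting_list ds) m"
    unfolding w0_word(2)[symmetric] sorting_word_pow_def sorting_word R.power_word_def map_concat map_map o_def
    by simp
qed

private lemma colored_inversions_eq:
  assumes "set ts \<subseteq> S"
  shows "colored_inversions \<rho> \<alpha> ts = colored_inv (map \<alpha> ts)"
proof -
  have "foldr (colored_act \<rho> \<alpha>) us x = foldr color_step (map \<alpha> us) x" if "set us \<subseteq> S" for us x
    using that by (induction us)
      (auto simp: colored_act_def color_step_def[of "\<alpha> _"] rho_generator case_prod_unfold)
  moreover have "set (take i ts) \<subseteq> S" for i using assms set_take_subset by fast
  ultimately show ?thesis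
    by (auto simp: colored_inversions_def colored_inv_def take_map)
qed

private lemma asso_word:
  "set (asso_word W S m cs) \<subseteq> S"
  "map \<alpha> (asso_word W S m cs) = ds @ R.power_word (R.sorting_list ds) m"
  using sorting_word_pow[of m] coxeter_listD(1)[OF cs] by (auto simp: asso_word_def)

private lemma asso_label_eq:
  assumes "i < length (asso_word W S m cs)"
  shows "asso_label W S \<rho> \<alpha> m cs i = R.labels ds m ! i"
  using assms colored_inversions_eq[OF sorting_word_pow(1), of m] sorting_word_pow(2)[of m]
  by (simp add: asso_label_def R.labels_eq_colored_inv[OF ds] nth_append)

private lemma asso_pos_facets_iff:
  "I \<in> asso_pos_facets W S m cs \<longleftrightarrow>
    I \<subseteq> {..<length (asso_word W S m cs)} \<and>
    length (nths (map \<alpha> (asso_word W S m cs)) (- I)) = m * card R.pos \<and>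
    act (nths (map \<alpha> (asso_word W S m cs)) (- I)) = act (R.sorting_list ds) ^^ m"
proof -
  let ?u = "nths (asso_word W S m cs) (- I)"
  have u: "set ?u \<subseteq> S" using asso_word(1) set_nths_subset by fast
  have pow: "\<rho> (word_prod W w0_word [^] (k::nat)) = act (map \<alpha> w0_word) ^^ k" for k
  proof (induction k)
    case (Suc k)
    then show ?case using w0_word(1) rho_word_prod
      by (simp add: fun_eq_iff rho_mult funpow_swap1)
  qed (simp add: rho_one fun_eq_iff)
  have "word_prod W ?u = word_prod W w0_word [^] m \<longleftrightarrow> act (map \<alpha> ?u) = act (map \<alpha> w0_word) ^^ m"
    using u w0_word(1) rho_eq_iff[of "word_prod W ?u" "word_prod W w0_word [^] m"]
    by (simp add: rho_word_prod pow)
  then show ?thesis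
    by (simp add: asso_pos_facets_def w0 w0_word(2) nths_map)
qed

lemma asso_related_iff_face:
  "asso_related W S \<rho> \<alpha> m cs x y \<longleftrightarrow> x \<noteq> y \<and> R.face (act (map \<alpha> cs)) m {x, y}"
proof -
  let ?Q = "asso_word W S m cs" and ?l = "asso_label W S \<rho> \<alpha> m cs"
  have "{x, y} \<in> asso_faces W S \<rho> \<alpha> m cs \<longleftrightarrow> (\<exists>I\<in>asso_pos_facets W S m cs. {x, y} \<subseteq> ?l ` I)"
    unfolding asso_faces_def asso_pos_faces_def by (auto simp: image_iff subset_image_iff) 
  also have "\<dots> \<longleftrightarrow> (\<exists>I\<in>asso_pos_facets W S m cs. {x, y} \<subseteq> (\<lambda>i. R.labels ds m ! i) ` I)"
  proof (rule bex_cong[OF HOL.refl])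
    fix I assume "I \<in> asso_pos_facets W S m cs"
    then have "?l ` I = (\<lambda>i. R.labels ds m ! i) ` I"
      by (intro image_cong HOL.refl asso_label_eq) (auto simp: asso_pos_facets_def)
    then show "{x, y} \<subseteq> ?l ` I \<longleftrightarrow> {x, y} \<subseteq> (\<lambda>i. R.labels ds m ! i) ` I"
      by simp
  qed
  also have "\<dots> \<longleftrightarrow> R.face (act ds) m {x, y}"
    using asso_word(2)[of m] unfolding R.face_iff_word[OF ds] Bex_def asso_pos_facets_iff
    by (metis length_map)
  finally show ?thesis by (simp add: asso_related_def)
qed

end

section \<open>Conditions (i) and (ii), and uniqueness\<close>

lemma almost_pos_roots_eq: "almost_pos_roots S \<Phi> \<alpha> m = R.colored_roots m"
  by (simp add: almost_pos_roots_def R.colored_roots_def pos_roots_def R.pos_def)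

text \<open>An element acting as \<open>reflection b\<close> moves \<open>b\<close> by
  \<open>2 b\<close>, which therefore lies in the span of its letters. The converse is
  \<open>reflection_in_words\<close> inside the parabolic subsystem.\<close>

lemma parabolic_roots_eq:
  assumes s: "s \<in> S"
  shows "parabolic_roots W S \<rho> \<Phi> s = \<Phi> \<inter> span (\<alpha> ` S - {\<alpha> s})"
proof -
  have img: "\<alpha> ` (S - {s}) = \<alpha> ` S - {\<alpha> s}" using inj_on_image_set_diff[OF inj_on_simple, of S "{s}"] s
    by simp
  have "b \<in> span (\<alpha> ` S - {\<alpha> s})"
    if b: "b \<in> \<Phi>" and w: "w \<in> generate W (S - {s})" "\<rho> w = reflection b" for b w
  proof -
    obtain ws where ws: "set ws \<subseteq> S - {s}" "word_prod W ws = w" using ex_word_generate[of "S - {s}" w] w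
      by blast
    then have "set ws \<subseteq> S" by auto
    then have "act (map \<alpha> ws) = reflection b" using rho_word_prod[of ws] w ws(2) by simp
    then have "2 *\<^sub>R b \<in> span (set (map \<alpha> ws))"
      using diff_act_in_span[of b "map \<alpha> ws"] reflection_self[OF R.root_nonzero[OF b]]
        by (simp add: scaleR_2)
    also have "span (set (map \<alpha> ws)) \<subseteq> span (\<alpha> ` S - {\<alpha> s})"
      using ws(1) img by (intro span_mono) auto
    finally have "(1 / 2) *\<^sub>R (2 *\<^sub>R b) \<in> span (\<alpha> ` S - {\<alpha> s})"
      by (rule span_scale)
    then show ?thesis by simp
  qed
  moreover have "\<exists>w\<in>generate W (S - {s}). \<rho> w = reflection b"
    if b: "b \<in> \<Phi> \<inter> span (\<alpha> ` S - {\<alpha> s})" for b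
  proof -
    interpret J: simple_root_system "\<Phi> \<inter> span (\<alpha> ` S - {\<alpha> s})" "\<alpha> ` S - {\<alpha> s}"
      using R.parabolic_simple_root_system[of "\<alpha> s"] s by simp
    obtain vs where vs: "set vs \<subseteq> \<alpha> ` (S - {s})" "act vs = reflection b"
      using J.reflection_in_words[OF b] img by auto
    then obtain ws where ws: "set ws \<subseteq> S - {s}" "map \<alpha> ws = vs" using lift_word[of "S - {s}" vs]
      by blast
    then show ?thesis
      using word_prod_generate[of "S - {s}" ws] rho_word_prod[of ws] vs
        by (intro bexI[of _ "word_prod W ws"]) auto
  qed
  ultimately show ?thesis unfolding parabolic_roots_def by blast
qed

lemma tau_eq: "s \<in> S \<Longrightarrow> tau \<rho> \<alpha> m s x = rotate_root m (\<alpha> s) x"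
  by (cases x) (auto simp: tau_def rotate_root_def rho_generator)

lemma conjugate_coxeter_list:
  assumes "coxeter_list (s # ws)"
  shows "coxeter_list (ws @ [s])"
    "word_prod W (ws @ [s]) = inv s \<otimes> word_prod W (s # ws) \<otimes> s"
proof -
  show "coxeter_list (ws @ [s])" using assms by (auto simp: coxeter_list_def)
  have s: "s \<in> carrier W" "set ws \<subseteq> S" "set [s] \<subseteq> S"
    using assms generators_carrier by (auto simp: coxeter_list_def)
  then show "word_prod W (ws @ [s]) = inv s \<otimes> word_prod W (s # ws) \<otimes> s"
    using word_prod_append[OF s(2,3)] word_prod_closed[OF s(2)] by (simp add: m_assoc[symmetric])
qed

lemma initial_iff:
  assumes "c \<in> coxeter_elements W S"
  shows "initial W S s c \<longleftrightarrow> (\<exists>ws. coxeter_list (s # ws) \<and> word_prod W (s # ws) = c)"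
  unfolding initial_def
  using reduced_word_coxeter_list[OF assms] coxeter_list_reduced reduced_word_def[of W S _ c] by metis

context
  fixes cword :: "'a \<Rightarrow> 'a list" and m :: nat
  assumes cword: "\<And>c. c \<in> coxeter_elements W S \<Longrightarrow> reduced_word W S (cword c) c"
    and m: "m \<ge> 1" and nonempty: "S \<noteq> {}"
begin

private abbreviation related where
  "related \<equiv> \<lambda>c. asso_related W S \<rho> \<alpha> m (cword c)"

text \<open>All words for one element act equally, so the choice made by \<open>cword\<close>
  disappears.\<close>

private lemma related_iff:
  assumes "coxeter_list cs"
  shows "related (word_prod W cs) x y \<longleftrightarrow> x \<noteq> y \<and> R.face (act (map \<alpha> cs)) m {x, y}"
proof -
  let ?c = "word_prod W cs"
  have c: "?c \<in> coxeter_elements W S" using assms by (auto simp: coxeter_elements_eq)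
  have l: "coxeter_list (cword ?c)" using reduced_word_coxeter_list[OF c cword[OF c]] .
  have "act (map \<alpha> (cword ?c)) = act (map \<alpha> cs)"
    using cword[OF c] word_prod_eq_iff[of "cword ?c" cs] coxeter_listD(1)[OF assms]
    by (simp add: reduced_word_def)
  then show ?thesis using asso_related_iff_face[OF l nonempty] by simp
qed

private lemma m': "0 < m"
  using m by simp

lemma compatibility_family_related: "compatibility_family W S \<rho> \<Phi> \<alpha> m related"
  unfolding compatibility_family_def
proof (intro conjI ballI impI)
  fix c s x assume c: "c \<in> coxeter_elements W S" and s: "s \<in> S" and x: "x \<in> almost_pos_roots S \<Phi> \<alpha> m"
  obtain cs where cs: "coxeter_list cs" "word_prod W cs = c" using c by (auto simp: coxeter_elements_eq)
  have x': "x \<in> R.colored_roots m" using x by (simp add: almost_pos_roots_eq)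
  have "fst x \<in> \<Phi>" using x' R.pos_root R.simple_root by (auto simp: R.colored_roots_def)
  then show "related c (\<alpha> s, m) x \<longleftrightarrow> x \<in> parabolic_almost_pos_roots W S \<rho> \<Phi> \<alpha> m s"
    using R.face_simple_iff[OF coxeter_listD(2)[OF cs(1)] imageI[OF s] x' m'] related_iff[OF cs(1)] cs(2) x
    by (auto simp: parabolic_almost_pos_roots_def parabolic_roots_eq[OF s])
next
  fix c s x y
  assume c: "c \<in> coxeter_elements W S" and s: "s \<in> S" and init: "initial W S s c"
    and "x \<in> almost_pos_roots S \<Phi> \<alpha> m" "y \<in> almost_pos_roots S \<Phi> \<alpha> m"
  then have xy: "x \<in> R.colored_roots m" "y \<in> R.colored_roots m" by (simp_all add: almost_pos_roots_eq)
  obtain ws where ws: "coxeter_list (s # ws)" "word_prod W (s # ws) = c" using init initial_iff[OF c] by blast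
  have cox: "R.coxeter_word (\<alpha> s # map \<alpha> ws)" using coxeter_listD(2)[OF ws(1)] by simp
  have "related c x y \<longleftrightarrow> x \<noteq> y \<and> R.face (act (\<alpha> s # map \<alpha> ws)) m {x, y}"
    using related_iff[OF ws(1)] ws(2) by (simp only: list.map)
  also have "\<dots> \<longleftrightarrow> rotate_root m (\<alpha> s) x \<noteq> rotate_root m (\<alpha> s) y \<and>
      R.face (act (map \<alpha> ws @ [\<alpha> s])) m {rotate_root m (\<alpha> s) x, rotate_root m (\<alpha> s) y}"
    using R.face_rotate[OF cox m', of "{x, y}"] R.rotate_root_eq_iff[OF cox m' xy] xy by simp
  also have "\<dots> \<longleftrightarrow> related (word_prod W (ws @ [s])) (rotate_root m (\<alpha> s) x) (rotate_root m (\<alpha> s) y)"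
    using related_iff[OF conjugate_coxeter_list(1)[OF ws(1)]] by (simp only: map_append list.map)
  finally show "related c x y \<longleftrightarrow>
      related (inv s \<otimes> c \<otimes> s) (tau \<rho> \<alpha> m s x) (tau \<rho> \<alpha> m s y)"
    using conjugate_coxeter_list(2)[OF ws(1)] ws(2) tau_eq[OF s] by simp
qed

lemma compatibility_family_unique:
  assumes R: "compatibility_family W S \<rho> \<Phi> \<alpha> m R" and R': "compatibility_family W S \<rho> \<Phi> \<alpha> m R'"
    and c: "c \<in> coxeter_elements W S" and x: "x \<in> almost_pos_roots S \<Phi> \<alpha> m"
    and y: "y \<in> almost_pos_roots S \<Phi> \<alpha> m"
  shows "R c x y \<longleftrightarrow> R' c x y"
proof -
  let ?A = "almost_pos_roots S \<Phi> \<alpha> m"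
  \<comment> \<open>\<open>y\<close> is quantified because rotation moves it together with
    \<open>x\<close>; \<open>cs\<close> is quantified because the induction changes the Coxeter
    word, on the side of the roots.\<close>
  let ?P = "\<lambda>ds x. \<forall>cs. coxeter_list cs \<longrightarrow> map \<alpha> cs = ds \<longrightarrow>
      (\<forall>y\<in>?A. R (word_prod W cs) x y \<longleftrightarrow> R' (word_prod W cs) x y)"
  obtain cs where cs: "coxeter_list cs" "word_prod W cs = c" using c by (auto simp: coxeter_elements_eq)
  have elements: "word_prod W us \<in> coxeter_elements W S" if "coxeter_list us" for us
    using that by (auto simp: coxeter_elements_eq)
  have "?P (map \<alpha> cs) x"
  proof (rule R.rotation_induct[OF coxeter_listD(2)[OF cs(1)] _ m', of x ?P])
    show "x \<in> R.colored_roots m" using x by (simp add: almost_pos_roots_eq)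
    fix ds q assume "q \<in> \<alpha> ` S"
    then obtain s where "s \<in> S" "q = \<alpha> s" by blast
    then show "?P ds (q, m)"
      using R R' elements unfolding compatibility_family_def by metis
  next
    fix t ds x assume cox: "R.coxeter_word (t # ds)" and x: "x \<in> R.colored_roots m"
      and IH: "?P (ds @ [t]) (rotate_root m t x)"
    show "?P (t # ds) x"
    proof (intro allI impI ballI)
      fix us y assume us: "coxeter_list us" "map \<alpha> us = t # ds" and y: "y \<in> ?A"
      then obtain s ws where sw: "us = s # ws" "\<alpha> s = t" "map \<alpha> ws = ds" by auto
      have s: "s \<in> S" using us sw by (auto simp: coxeter_list_def)
      have init: "initial W S s (word_prod W us)"
        using initial_iff[OF elements[OF us(1)]] us(1) sw(1) by blast
      have step: "Q (word_prod W us) x y \<longleftrightarrow>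
          Q (word_prod W (ws @ [s])) (rotate_root m t x) (rotate_root m t y)"
        if Q: "compatibility_family W S \<rho> \<Phi> \<alpha> m Q" for Q
      proof -
        have "Q (word_prod W us) x y \<longleftrightarrow>
            Q (inv s \<otimes> word_prod W us \<otimes> s) (tau \<rho> \<alpha> m s x) (tau \<rho> \<alpha> m s y)"
          using Q elements[OF us(1)] s init x y unfolding compatibility_family_def
          by (auto simp: almost_pos_roots_eq)
        then show ?thesis
          using conjugate_coxeter_list(2)[of s ws] us(1) sw tau_eq[OF s] by simp
      qed
      have "rotate_root m t y \<in> ?A"
        using R.rotate_root_in[OF cox m'] y by (simp add: almost_pos_roots_eq)
      moreover have "coxeter_list (ws @ [s])" "map \<alpha> (ws @ [s]) = ds @ [t]"
        using conjugate_coxeter_list(1) us(1) sw by auto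
      ultimately show "R (word_prod W us) x y \<longleftrightarrow> R' (word_prod W us) x y"
        using IH step[OF R] step[OF R'] by blast
    qed
  qed
  then show ?thesis using cs y by blast
qed

end

end

theorem mainTheorem11:
  fixes W :: "('a, 'b) monoid_scheme" and S :: "'a set"
    and \<rho> :: "'a \<Rightarrow> 'v::euclidean_space \<Rightarrow> 'v" and \<Phi> :: "'v set" and \<alpha> :: "'a \<Rightarrow> 'v"
    and m :: nat and cword :: "'a \<Rightarrow> 'a list"
  assumes "coxeter_system W S" and "finite (carrier W)"
    and "root_system_of W S \<rho> \<Phi> \<alpha>"
    and "m \<ge> 1"
    and "\<forall>c\<in>coxeter_elements W S. reduced_word W S (cword c) c"
  shows "compatibility_family W S \<rho> \<Phi> \<alpha> m (\<lambda>c. asso_related W S \<rho> \<alpha> m (cword c)) \<and>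
    (\<forall>R. compatibility_family W S \<rho> \<Phi> \<alpha> m R \<longrightarrow>
       (\<forall>c\<in>coxeter_elements W S.
          \<forall>x\<in>almost_pos_roots S \<Phi> \<alpha> m. \<forall>y\<in>almost_pos_roots S \<Phi> \<alpha> m.
            R c x y \<longleftrightarrow> asso_related W S \<rho> \<alpha> m (cword c) x y))"
proof -
  interpret coxeter_root_system W S \<rho> \<Phi> \<alpha>
    using assms by unfold_locales
  show ?thesis
  proof (cases "S = {}")
    \<comment> \<open>Letters of \<open>c c c ...\<close> are found modulo the length of
      \<open>c\<close>, so an empty generating set is treated apart: it has no colored
      roots.\<close>
    case True
    have "R.pos = {}" using R.root_in_span R.pos_root R.root_nonzero True by fastforce
    then have "R.colored_roots m = {}" unfolding R.colored_roots_def using True by blast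
    then have "almost_pos_roots S \<Phi> \<alpha> m = {}" by (simp only: almost_pos_roots_eq)
    then show ?thesis using True by (simp add: compatibility_family_def)
  next
    case False
    have cword: "\<And>c. c \<in> coxeter_elements W S \<Longrightarrow> reduced_word W S (cword c) c" using assms(5)
      by blast
    note family = compatibility_family_related[OF cword assms(4) False]
    show ?thesis
      using family compatibility_family_unique[OF cword assms(4) False _ family] by blast
  qed
qed

end
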